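(* Let $g$ be a totally positive function of finite type $m\ge 2$ and let $a,K,M\in\mathbb{N}$ with $K/a\in\mathbb{N}$ and $K/M\in\mathbb{N}$. Let $P_KSg\in\mathbb{C}^K$ be the vector $(P_KSg)(n)=\sum_{k\in\mathbb{Z}}g(n-kK)$, $n=0,\ldots,K-1$. If $a/M<1$, then the Gabor family $\mathcal{G}(P_KSg,a,1/M)=\{M_{l/M}T_{ka}P_KSg: k=0,\ldots,K/a-1,\ l=0,\ldots,M-1\}$ is a frame for $\mathbb{C}^K$. Furthermore, if $\gamma$ is the dual window of $\mathcal{G}(g,a,1/M)$ in $L^2(\mathbb{R})$ produced by the algorithm described below (with $\alpha=a$, $\beta=1/M$ and any $L\in\mathbb{N}_0$), then $P_KS\gamma$, i.e. $(\sum_{k\in\mathbb{Z}}\gamma(n-kK))_{n=0}^{K-1}$, is a dual window of $\mathcal{G}(P_KSg,a,1/M)$.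
   Context: $j$ is the imaginary unit, $\hat g(\xi)=\int g(x)e^{-2\pi jx\xi}dx$. $g\in L^1(\mathbb{R})$ is totally positive of finite type $m$ if $\hat g(\xi)=C\prod_{k=1}^m(1+2\pi j\delta_k\xi)^{-1}$ with $C>0$ and nonzero real $\delta_k$; let $p$ (resp. $q$) be the number of positive (resp. negative) $\delta_k$. On $\mathbb{C}^K$ (indices mod $K$), $M_\xi T_kf(n)=f((n-k)\bmod K)e^{2\pi j\xi n}$ for $\xi\in\frac1K\mathbb{Z}$. On $L^2(\mathbb{R})$, $M_\xi T_xf(t)=f(t-x)e^{2\pi j\xi t}$. Frame: $A\|f\|^2\le\sum|\langle f,e_i\rangle|^2\le B\|f\|^2$ for all $f$, $A,B>0$. A dual window of a Gabor frame $\mathcal{G}(\phi,\alpha,\beta)$ is $\psi$ with $\mathcal{G}(\psi,\alpha,\beta)$ a frame and $f=\sum\langle f,M_{l\beta}T_{k\alpha}\phi\rangle M_{l\beta}T_{k\alpha}\psi$ for all $f$ (sum over the index set of the family). Algorithm (input $g$, $\alpha,\beta>0$ with $\alpha\beta<1$, $L\in\mathbb{N}_0$): for each $x\in[0,\alpha)$ set $r=\lfloor 1/(1-\alpha\beta)\rfloor$, $k_1=-(r+1)p-L$, $k_2=(r+1)q+L$, $i_1=\lfloor (k_1+p-1)/(\alpha\beta)-x/\alpha\rfloor+1$, $i_2=\lceil (k_2-q+1)/(\alpha\beta)-x/\alpha\rceil-1$; form $P=(g(x+\alpha i-k/\beta))_{i_1\le i\le i_2,\,k_1\le k\le k_2}$,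 let $P^\dagger=(q_{k,i})$ be its Moore–Penrose pseudoinverse, and set $\gamma(x+\alpha i)=\beta q_{0,i}$ for $i_1\le i\le i_2$, $\gamma(x+\alpha i)=0$ otherwise. *)

theory Defs
  imports "HOL-Analysis.Analysis" "Jordan_Normal_Form.Matrix"
begin

definition fourier :: "(real \<Rightarrow> real) \<Rightarrow> real \<Rightarrow> complex" where
  "fourier g \<xi> = (LINT x|lborel. complex_of_real (g x) * cis (- 2 * pi * x * \<xi>))"

definition tp_finite_type :: "(real \<Rightarrow> real) \<Rightarrow> nat \<Rightarrow> (nat \<Rightarrow> real) \<Rightarrow> bool" where
  "tp_finite_type g m \<delta> \<longleftrightarrow>
     integrable lborel g \<and> (\<forall>k<m. \<delta> k \<noteq> 0) \<and>
     (\<exists>C>0. \<forall>\<xi>::real. fourier g \<xi> =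
        complex_of_real C * (\<Prod>k<m. inverse (1 + \<i> * complex_of_real (2 * pi * \<delta> k * \<xi>))))"

definition tp_pos :: "nat \<Rightarrow> (nat \<Rightarrow> real) \<Rightarrow> nat" where
  "tp_pos m \<delta> = card {k. k < m \<and> \<delta> k > 0}"

definition tp_neg :: "nat \<Rightarrow> (nat \<Rightarrow> real) \<Rightarrow> nat" where
  "tp_neg m \<delta> = card {k. k < m \<and> \<delta> k < 0}"

definition pinv :: "real mat \<Rightarrow> real mat" where
  "pinv A = (THE X. X \<in> carrier_mat (dim_col A) (dim_row A) \<and>
      A * X * A = A \<and> X * A * X = X \<and>
      transpose_mat (A * X) = A * X \<and> transpose_mat (X * A) = X * A)"

definition alg_r :: "real \<Rightarrow> real \<Rightarrow> int" where
  "alg_r \<alpha> \<beta> = \<lfloor>1 / (1 - \<alpha> * \<beta>)\<rfloor>"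

definition alg_k1 :: "nat \<Rightarrow> real \<Rightarrow> real \<Rightarrow> nat \<Rightarrow> int" where
  "alg_k1 p \<alpha> \<beta> L = - (alg_r \<alpha> \<beta> + 1) * int p - int L"

definition alg_k2 :: "nat \<Rightarrow> real \<Rightarrow> real \<Rightarrow> nat \<Rightarrow> int" where
  "alg_k2 q \<alpha> \<beta> L = (alg_r \<alpha> \<beta> + 1) * int q + int L"

definition alg_i1 :: "nat \<Rightarrow> real \<Rightarrow> real \<Rightarrow> nat \<Rightarrow> real \<Rightarrow> int" where
  "alg_i1 p \<alpha> \<beta> L x =
     \<lfloor>(of_int (alg_k1 p \<alpha> \<beta> L) + real p - 1) / (\<alpha> * \<beta>) - x / \<alpha>\<rfloor> + 1"

definition alg_i2 :: "nat \<Rightarrow> real \<Rightarrow> real \<Rightarrow> nat \<Rightarrow> real \<Rightarrow> int" where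
  "alg_i2 q \<alpha> \<beta> L x =
     \<lceil>(of_int (alg_k2 q \<alpha> \<beta> L) - real q + 1) / (\<alpha> * \<beta>) - x / \<alpha>\<rceil> - 1"

definition alg_P :: "(real \<Rightarrow> real) \<Rightarrow> nat \<Rightarrow> nat \<Rightarrow> real \<Rightarrow> real \<Rightarrow> nat \<Rightarrow> real \<Rightarrow> real mat" where
  "alg_P g p q \<alpha> \<beta> L x =
     (let i1 = alg_i1 p \<alpha> \<beta> L x; i2 = alg_i2 q \<alpha> \<beta> L x;
          k1 = alg_k1 p \<alpha> \<beta> L; k2 = alg_k2 q \<alpha> \<beta> L
      in mat (nat (i2 - i1 + 1)) (nat (k2 - k1 + 1))
           (\<lambda>(i, k). g (x + \<alpha> * of_int (int i + i1) - of_int (int k + k1) / \<beta>)))"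

definition alg_gamma :: "(real \<Rightarrow> real) \<Rightarrow> nat \<Rightarrow> nat \<Rightarrow> real \<Rightarrow> real \<Rightarrow> nat \<Rightarrow> real \<Rightarrow> real" where
  "alg_gamma g p q \<alpha> \<beta> L t =
     (let i = \<lfloor>t / \<alpha>\<rfloor>; x = t - \<alpha> * of_int i;
          i1 = alg_i1 p \<alpha> \<beta> L x; i2 = alg_i2 q \<alpha> \<beta> L x;
          k1 = alg_k1 p \<alpha> \<beta> L
      in if i1 \<le> i \<and> i \<le> i2
         then \<beta> * (pinv (alg_P g p q \<alpha> \<beta> L x) $$ (nat (0 - k1), nat (i - i1)))
         else 0)"

section \<open>Finite discrete setting: vectors in C^K as functions on int, indices mod K\<close>

definition PKS :: "nat \<Rightarrow> (real \<Rightarrow> real) \<Rightarrow> int \<Rightarrow> complex" where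
  "PKS K g n = complex_of_real (\<Sum>\<^sub>\<infinity>k::int. g (of_int (n - k * int K)))"

definition cinner :: "nat \<Rightarrow> (int \<Rightarrow> complex) \<Rightarrow> (int \<Rightarrow> complex) \<Rightarrow> complex" where
  "cinner K f h = (\<Sum>n\<in>{0..<int K}. f n * cnj (h n))"

definition cnorm2 :: "nat \<Rightarrow> (int \<Rightarrow> complex) \<Rightarrow> real" where
  "cnorm2 K f = (\<Sum>n\<in>{0..<int K}. (cmod (f n))\<^sup>2)"

definition dframe :: "nat \<Rightarrow> 'i set \<Rightarrow> ('i \<Rightarrow> int \<Rightarrow> complex) \<Rightarrow> bool" where
  "dframe K I e \<longleftrightarrow> finite I \<and> (\<exists>A B. A > 0 \<and> B > 0 \<and>
     (\<forall>f. A * cnorm2 K f \<le> (\<Sum>i\<in>I. (cmod (cinner K f (e i)))\<^sup>2) \<and>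
          (\<Sum>i\<in>I. (cmod (cinner K f (e i)))\<^sup>2) \<le> B * cnorm2 K f))"

definition dMT :: "nat \<Rightarrow> real \<Rightarrow> int \<Rightarrow> (int \<Rightarrow> complex) \<Rightarrow> int \<Rightarrow> complex" where
  "dMT K \<xi> k f n = f ((n - k) mod int K) * cis (2 * pi * \<xi> * of_int n)"

definition dgabor_index :: "nat \<Rightarrow> nat \<Rightarrow> nat \<Rightarrow> (nat \<times> nat) set" where
  "dgabor_index K a M = {0..<K div a} \<times> {0..<M}"

definition dgabor :: "nat \<Rightarrow> nat \<Rightarrow> nat \<Rightarrow> (int \<Rightarrow> complex) \<Rightarrow> nat \<times> nat \<Rightarrow> int \<Rightarrow> complex" where
  "dgabor K a M \<phi> = (\<lambda>(k, l). dMT K (real l / real M) (int k * int a) \<phi>)"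

definition ddual_window :: "nat \<Rightarrow> nat \<Rightarrow> nat \<Rightarrow> (int \<Rightarrow> complex) \<Rightarrow> (int \<Rightarrow> complex) \<Rightarrow> bool" where
  "ddual_window K a M \<phi> \<psi> \<longleftrightarrow>
     dframe K (dgabor_index K a M) (dgabor K a M \<psi>) \<and>
     (\<forall>f. \<forall>n\<in>{0..<int K}.
        f n = (\<Sum>kl\<in>dgabor_index K a M.
                 cinner K f (dgabor K a M \<phi> kl) * dgabor K a M \<psi> kl n))"

end

theory Submission
  imports Defs "Jordan_Normal_Form.Determinant" "HOL-Probability.Levy"
begin

text \<open>Let \<open>h\<^sub>j\<close> have the Fourier transform \<open>\<Prod>k\<le>j. (1 + 2 \<pi> \<i> \<delta>\<^sub>k \<xi>)\<^sup>-\<^sup>1\<close>, so that \<open>g\<close> is a multiple of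
  \<open>h\<^sub>m\<^sub>-\<^sub>1\<close> and \<open>h\<^sub>j = h\<^sub>j\<^sub>+\<^sub>1 + \<delta>\<^sub>j\<^sub>+\<^sub>1 h'\<^sub>j\<^sub>+\<^sub>1\<close>. Rolle's theorem, applied to \<open>exp (t / \<delta>)\<close> times a
  combination of translates of these functions, shows that each factor does not lose sign changes, and
  gains one at the end of a window next to which the combination vanishes. Counting the knots that carry
  the sign changes of the coefficients yields a uniqueness result of Schoenberg--Whitney type: the
  matrix \<open>P\<close> of the algorithm has full column rank, so \<open>P\<^sup>\<dagger>\<close> is a left inverse and the biorthogonality
  relations hold for \<open>k\<^sub>1 \<le> k \<le> k\<^sub>2\<close>. Since \<open>g\<close> is an exponential polynomial on each half line, the columns
  with \<open>k < k\<^sub>1\<close> (\<open>k > k\<^sub>2\<close>) satisfy a linear recurrence of order \<open>p\<close> (\<open>q\<close>), which extends the relations to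
  all integers \<open>k\<close>. Periodization turns them into the duality relations of the finite Gabor system,
  and the frame bounds follow from the reconstruction formula by Cauchy--Schwarz.\<close>

section \<open>Variation diminishing\<close>

text \<open>The chain of filters does not start from a function: the coefficients are point masses
  at the knots, and a single exponential kernel applied to them still jumps. Derivatives are
  therefore avoided. All sign information comes from \<open>exp (t / \<delta>) * f t\<close> being
  an antiderivative, or at the lowest level a step function, whose increments are governed by the
  signs of \<open>u\<close>. One predicate thus covers both levels, and one-sided continuity is
  enough when vanishing is passed down.

  The size of the matrix balances two demands. The strict bounds behind \<open>i1\<close> and
  \<open>i2\<close> keep the samples where the recurrences for the omitted columns hold, which
  shortens the sampling window by about p + q knot spacings. Yet there must be at least as many rows
  as columns. Since a knot spacing holds 1 / (\<alpha>\<beta>) > 1 samples, a longer column range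
  gains rows, and r is chosen so that the gain covers the loss.

  The relations are wanted for every integer k because each periodized relation is a sum over a
  whole residue class of k modulo K / M.\<close>

inductive alt :: "(real \<Rightarrow> real) \<Rightarrow> real set \<Rightarrow> nat \<Rightarrow> real \<Rightarrow> real \<Rightarrow> bool"
  for f W where
  alt_base: "t \<in> W \<Longrightarrow> \<sigma> \<in> {1, -1} \<Longrightarrow> 0 < \<sigma> * f t \<Longrightarrow> alt f W 0 t \<sigma>"
| alt_step: "alt f W n t \<sigma> \<Longrightarrow> t < t' \<Longrightarrow> t' \<in> W \<Longrightarrow> 0 < - \<sigma> * f t' \<Longrightarrow> alt f W (Suc n) t' (- \<sigma>)"

text \<open>The signs at consecutive points are unrelated here; only a zero between them is known.
  Sample zeros of a spline give exactly this much, and one Rolle step turns it into genuine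
  alternation.\<close>

inductive sepzeros :: "(real \<Rightarrow> real) \<Rightarrow> real set \<Rightarrow> nat \<Rightarrow> real \<Rightarrow> real \<Rightarrow> bool"
  for f W where
  sepzeros_base: "t \<in> W \<Longrightarrow> \<sigma> \<in> {1, -1} \<Longrightarrow> 0 < \<sigma> * f t \<Longrightarrow> sepzeros f W 0 t \<sigma>"
| sepzeros_step: "sepzeros f W n t \<sigma> \<Longrightarrow> t < z \<Longrightarrow> f z = 0 \<Longrightarrow> z < t' \<Longrightarrow> t' \<in> W \<Longrightarrow> \<sigma>' \<in> {1, -1} \<Longrightarrow>
    0 < \<sigma>' * f t' \<Longrightarrow> sepzeros f W (Suc n) t' \<sigma>'"

lemma alt_sign: "alt f W n t \<sigma> \<Longrightarrow> \<sigma> \<in> {1, -1} \<and> t \<in> W \<and> 0 < \<sigma> * f t"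
  by (induction rule: alt.induct) auto

lemma sepzeros_sign: "sepzeros f W n t \<sigma> \<Longrightarrow> \<sigma> \<in> {1, -1} \<and> t \<in> W \<and> 0 < \<sigma> * f t"
  by (induction rule: sepzeros.induct) auto

text \<open>Opposite signs exclude t = t', so the weak inequality delivered by Rolle points is
  enough.\<close>

lemma alt_append:
  assumes "alt f W n t \<sigma>" "t \<le> t'" "t' \<in> W" "0 < - \<sigma> * f t'"
  shows "alt f W (Suc n) t' (- \<sigma>)"
proof -
  have "t \<noteq> t'"
    using alt_sign[OF assms(1)] assms(4) by auto
  then show ?thesis
    using alt_step assms by force
qed

text \<open>The first point is discarded, so that the last point and its sign, on which the
  inductions build, stay the same.\<close>

lemma alt_drop: "alt f W (Suc n) t \<sigma> \<Longrightarrow> alt f W n t \<sigma>"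
proof (induction n arbitrary: t \<sigma>)
  case 0
  then have "\<sigma> \<in> {1, -1} \<and> t \<in> W \<and> 0 < \<sigma> * f t"
    by (rule alt_sign)
  then show ?case
    by (auto intro: alt_base)
next
  case (Suc n)
  from Suc.prems show ?case
  proof cases
    case (alt_step s \<tau>)
    then show ?thesis
      using Suc.IH[of s \<tau>] alt.alt_step[of f W n s \<tau> t] by auto
  qed
qed

lemma alt_points:
  "alt f W n t \<sigma> \<Longrightarrow> \<exists>T. finite T \<and> card T = Suc n \<and> T \<subseteq> {x \<in> W. f x \<noteq> 0} \<inter> {..t}"
proof (induction rule: alt.induct)
  case (alt_base t \<sigma>)
  then show ?case
    by (intro exI[of _ "{t}"]) auto
next
  case (alt_step n t \<sigma> t')
  then obtain T where T: "finite T" "card T = Suc n" "T \<subseteq> {x \<in> W. f x \<noteq> 0} \<inter> {..t}"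
    by blast
  with alt_step(2) have "t' \<notin> T"
    by force
  with T alt_step show ?case
    by (intro exI[of _ "insert t' T"]) force
qed

text \<open>Sign information about \<open>u = f + \<delta> f'\<close>, where \<open>exp (t / \<delta>) * f t\<close> has a derivative of the
  sign of \<open>u / \<delta>\<close> and tends to \<open>0\<close> at \<open>-\<infinity>\<close> if \<open>\<delta> > 0\<close> and at \<open>\<infinity>\<close> if \<open>\<delta> < 0\<close>.\<close>

definition rolle :: "real \<Rightarrow> (real \<Rightarrow> real) \<Rightarrow> (real \<Rightarrow> real) \<Rightarrow> bool" where
  "rolle \<delta> f u \<longleftrightarrow>
     (\<forall>a b \<sigma>. a < b \<longrightarrow> \<sigma> \<in> {1, -1} \<longrightarrow> f a \<noteq> 0 \<or> f b \<noteq> 0 \<longrightarrow>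
        sgn \<delta> * \<sigma> * f a \<le> 0 \<longrightarrow> 0 \<le> sgn \<delta> * \<sigma> * f b \<longrightarrow> (\<exists>t\<in>{a..b}. 0 < \<sigma> * u t)) \<and>
     (\<forall>b \<sigma>. \<sigma> \<in> {1, -1} \<longrightarrow> 0 < \<sigma> * f b \<longrightarrow> (\<exists>t. sgn \<delta> * t \<le> sgn \<delta> * b \<and> 0 < \<sigma> * u t))"

lemma rolle_posD:
  assumes "rolle \<delta> f u" "\<delta> > 0" "\<sigma> \<in> {1, -1}" 
  shows "a < b \<Longrightarrow> f a \<noteq> 0 \<or> f b \<noteq> 0 \<Longrightarrow> \<sigma> * f a \<le> 0 \<Longrightarrow> 0 \<le> \<sigma> * f b \<Longrightarrow> \<exists>t\<ge>a. t \<le> b \<and> 0 < \<sigma> * u t"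
    and "0 < \<sigma> * f b \<Longrightarrow> \<exists>t\<le>b. 0 < \<sigma> * u t"
  using assms unfolding rolle_def by (fastforce, force)

lemma rolle_negD:
  assumes "rolle \<delta> f u" "\<delta> < 0" "\<sigma> \<in> {1, -1}" 
  shows "a < b \<Longrightarrow> f a \<noteq> 0 \<or> f b \<noteq> 0 \<Longrightarrow> 0 \<le> \<sigma> * f a \<Longrightarrow> \<sigma> * f b \<le> 0 \<Longrightarrow> \<exists>t\<ge>a. t \<le> b \<and> 0 < \<sigma> * u t"
    and "0 < \<sigma> * f b \<Longrightarrow> \<exists>t\<ge>b. 0 < \<sigma> * u t"
  using assms unfolding rolle_def by (fastforce, force)

text \<open>The Booleans tell which of the ends A and B is a boundary carrying a zero. On the other
  side the window runs to infinity, where decay replaces the boundary zero.\<close>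

definition window :: "bool \<Rightarrow> bool \<Rightarrow> real \<Rightarrow> real \<Rightarrow> real set" where
  "window l r A B = {t. (l \<longrightarrow> A \<le> t) \<and> (r \<longrightarrow> t \<le> B)}"

context
  fixes l r A B \<delta> f u W
  assumes ru: "rolle \<delta> f u"
    and fA: "l \<Longrightarrow> f A = 0" and fB: "r \<Longrightarrow> f B = 0"
  defines "W \<equiv> window l r A B"
begin

lemma W_convex: "s \<in> W \<Longrightarrow> t \<in> W \<Longrightarrow> s \<le> x \<Longrightarrow> x \<le> t \<Longrightarrow> x \<in> W"
  by (auto simp: W_def window_def)

lemma W_strict:
  "t \<in> W \<Longrightarrow> f t \<noteq> 0 \<Longrightarrow> (l \<longrightarrow> A < t \<and> A \<in> W) \<and> (r \<longrightarrow> t < B \<and> B \<in> W)"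
  using fA fB by (auto simp: W_def window_def order.strict_iff_order)

text \<open>A sign of \<open>f\<close> at t has to be built up from zero on the left: from the
  boundary zero at A or, without a boundary, from the limit of the weighted function at minus
  infinity.\<close>

lemma start_pos:
  assumes "\<delta> > 0" "t \<in> W" "\<sigma> \<in> {1, -1}" "0 < \<sigma> * f t"
  shows "\<exists>s\<le>t. s \<in> W \<and> 0 < \<sigma> * u s"
proof (cases l)
  case True
  have "A < t" "A \<in> W" using W_strict[of t] assms True by auto
  then show ?thesis
    using rolle_posD(1)[OF ru assms(1,3), of A t] fA True assms W_convex[of A t] by force
next
  case False
  then show ?thesis
    using rolle_posD(2)[OF ru assms(1,3), of t] assms by (fastforce simp: W_def window_def)
qed

lemma end_neg:
  assumes "\<delta> < 0" "t \<in> W" "\<sigma> \<in> {1, -1}" "0 < \<sigma> * f t"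
  shows "\<exists>s\<ge>t. s \<in> W \<and> 0 < \<sigma> * u s"
proof (cases r)
  case True
  have "t < B" "B \<in> W" using W_strict[of t] assms True by auto
  then show ?thesis
    using rolle_negD(1)[OF ru assms(1,3), of t B] fB True assms W_convex[of t B] by force
next
  case False
  then show ?thesis
    using rolle_negD(2)[OF ru assms(1,3), of t] assms by (fastforce simp: W_def window_def)
qed

text \<open>The return of \<open>f\<close> to zero at B forces a value of \<open>u\<close> of the
  opposite sign, which is the extra change.\<close>

lemma finish_pos:
  assumes "\<delta> > 0" "t \<in> W" "0 < \<sigma> * f t" "alt u W n s \<sigma>" "s \<le> t"
  shows "\<exists>t' \<sigma>'. alt u W (n + of_bool r) t' \<sigma>'"
proof (cases r)
  case True
  have \<sigma>: "- \<sigma> \<in> {1, -1}" using alt_sign[OF assms(4)] by auto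
  have "f t \<noteq> 0" using assms(3) by auto
  then have B: "t < B" "B \<in> W" using W_strict[of t] assms True by auto
  obtain x where "x \<ge> t" "x \<le> B" "0 < - \<sigma> * u x"
    using rolle_posD(1)[OF ru assms(1) \<sigma>, of t B] fB True assms B by force
  then have "alt u W (Suc n) x (- \<sigma>)"
    using alt_append[OF assms(4)] W_convex[of t B x] assms B by auto
  then show ?thesis using True by auto
qed (use assms in auto)

text \<open>For negative \<open>\<delta>\<close> the Rolle point of an interval has the sign
  opposite to \<open>f\<close> at its right end. So n + of_bool l points are found before t, the
  last of sign - \<sigma>. As \<open>alt\<close> counts changes and not points, the case of no
  points is a separate disjunct, which also keeps the truncated subtraction harmless.\<close>

lemma finish_neg:
  assumes "\<delta> < 0" "t \<in> W" "0 < \<sigma> * f t" "n + of_bool l = 0 \<or> alt u W (n + of_bool l - 1) s (- \<sigma>)" "s \<le> t"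
    and \<sigma>: "\<sigma> \<in> {1, -1}"
  shows "\<exists>t' \<sigma>'. alt u W (n + of_bool l) t' \<sigma>'"
proof -
  obtain x where x: "x \<ge> t" "x \<in> W" "0 < \<sigma> * u x"
    using end_neg assms by blast
  show ?thesis
  proof (cases "n + of_bool l = 0")
    case True
    then show ?thesis using x \<sigma> alt_base by metis
  next
    case False
    then show ?thesis
      using assms x alt_append[of u W "n + of_bool l - 1" s "- \<sigma>" x] by force
  qed
qed

lemma start_neg:
  assumes "\<delta> < 0" "t \<in> W" "\<sigma> \<in> {1, -1}" "0 < \<sigma> * f t"
  shows "\<exists>s\<le>t. \<not> l \<or> alt u W 0 s (- \<sigma>)"
proof (cases l)
  case True
  have \<sigma>: "- \<sigma> \<in> {1, -1}" using assms by auto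
  have A: "A < t" "A \<in> W" using W_strict[of t] assms True by auto
  then obtain x where "x \<ge> A" "x \<le> t" "0 < - \<sigma> * u x"
    using rolle_negD(1)[OF ru assms(1) \<sigma>, of A t] fA True assms by force
  then show ?thesis
    using alt_base[of x W "- \<sigma>" u] \<sigma> W_convex[of A t x] A assms by auto
qed (use assms in auto)

lemma alt_rolle_pos:
  assumes "\<delta> > 0"
  shows "alt f W n t \<sigma> \<Longrightarrow> \<exists>s\<le>t. alt u W n s \<sigma>"
proof (induction rule: alt.induct)
  case (alt_base t \<sigma>)
  then show ?case
    using start_pos[OF assms] alt.alt_base by meson
next
  case (alt_step n t \<sigma> t')
  then obtain s where s: "s \<le> t" "alt u W n s \<sigma>" by auto
  have sg: "\<sigma> \<in> {1, -1}" "t \<in> W" "0 < \<sigma> * f t" using alt_sign[OF alt_step(1)] by auto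
  then obtain x where "x \<ge> t" "x \<le> t'" "0 < - \<sigma> * u x"
    using rolle_posD(1)[OF ru assms, of "- \<sigma>" t t'] alt_step by force
  then show ?case
    using alt_append[OF s(2)] s W_convex[of t t' x] alt_step sg by (intro exI[of _ x]) auto
qed

lemma alt_rolle_neg:
  assumes "\<delta> < 0"
  shows "alt f W n t \<sigma> \<Longrightarrow> \<exists>s\<le>t. n + of_bool l = 0 \<or> alt u W (n + of_bool l - 1) s (- \<sigma>)"
proof (induction rule: alt.induct)
  case (alt_base t \<sigma>)
  then show ?case
    using start_neg[OF assms, of t \<sigma>] by auto
next
  case (alt_step n t \<sigma> t')
  then obtain s where s: "s \<le> t" "n + of_bool l = 0 \<or> alt u W (n + of_bool l - 1) s (- \<sigma>)" by auto
  have sg: "\<sigma> \<in> {1, -1}" "t \<in> W" "0 < \<sigma> * f t" using alt_sign[OF alt_step(1)] by auto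
  then obtain x where x: "x \<ge> t" "x \<le> t'" "0 < \<sigma> * u x"
    using rolle_negD(1)[OF ru assms, of "\<sigma>" t t'] alt_step by force
  then have xW: "x \<in> W" using W_convex[of t t' x] alt_step sg by auto
  have "alt u W (n + of_bool l) x \<sigma>"
  proof (cases "n + of_bool l = 0")
    case True
    then show ?thesis using x xW sg alt_base by metis
  next
    case False
    then show ?thesis
      using s x xW alt_append[of u W "n + of_bool l - 1" s "- \<sigma>" x] by force
  qed
  then show ?case
    using x by auto
qed

text \<open>The half from z to t' always yields the sign of \<open>f\<close> at t'. If this is also
  the sign at t, the half from t to z yields the opposite one in between; two alternations arise and
  one is dropped.\<close>

lemma sepzeros_rolle_pos:
  assumes "\<delta> > 0"
  shows "sepzeros f W n t \<sigma> \<Longrightarrow> \<exists>s\<le>t. alt u W n s \<sigma>"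
proof (induction rule: sepzeros.induct)
  case (sepzeros_base t \<sigma>)
  then show ?case
    using start_pos[OF assms] alt.alt_base by meson
next
  case (sepzeros_step n t \<sigma> z t' \<sigma>')
  then obtain s where s: "s \<le> t" "alt u W n s \<sigma>" by auto
  have sg: "\<sigma> \<in> {1, -1}" "t \<in> W" "0 < \<sigma> * f t" using sepzeros_sign[OF sepzeros_step(1)] by auto
  have zW: "z \<in> W" using W_convex[of t t' z] sepzeros_step sg by auto
  obtain y where y: "y \<ge> z" "y \<le> t'" "0 < \<sigma>' * u y"
    using rolle_posD(1)[OF ru assms, of \<sigma>' z t'] sepzeros_step by force
  then have yW: "y \<in> W" using W_convex[of z t' y] zW sepzeros_step by auto
  show ?case
  proof (cases "\<sigma>' = - \<sigma>")
    case True
    then show ?thesis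
      using alt_append[OF s(2)] s y yW sepzeros_step by (intro exI[of _ y]) auto
  next
    case False
    then have eq: "\<sigma>' = \<sigma>" using sg sepzeros_step by auto
    obtain x where x: "x \<ge> t" "x \<le> z" "0 < - \<sigma> * u x"
      using rolle_posD(1)[OF ru assms, of "- \<sigma>" t z] sepzeros_step sg by force
    then have "alt u W (Suc n) x (- \<sigma>)"
      using alt_append[OF s(2), of x] s W_convex[of t z x] zW sg by auto
    then have "alt u W (Suc (Suc n)) y \<sigma>"
      using alt_append[of u W "Suc n" x "- \<sigma>" y] x y yW eq by auto
    then show ?thesis using alt_drop eq y by blast
  qed
qed

lemma sepzeros_rolle_neg:
  assumes "\<delta> < 0"
  shows "sepzeros f W n t \<sigma> \<Longrightarrow> \<exists>s\<le>t. n + of_bool l = 0 \<or> alt u W (n + of_bool l - 1) s (- \<sigma>)"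
proof (induction rule: sepzeros.induct)
  case (sepzeros_base t \<sigma>)
  then show ?case
    using start_neg[OF assms, of t \<sigma>] by auto
next
  case (sepzeros_step n t \<sigma> z t' \<sigma>')
  then obtain s where s: "s \<le> t" "n + of_bool l = 0 \<or> alt u W (n + of_bool l - 1) s (- \<sigma>)" by auto
  have sg: "\<sigma> \<in> {1, -1}" "t \<in> W" "0 < \<sigma> * f t" using sepzeros_sign[OF sepzeros_step(1)] by auto
  have zW: "z \<in> W" using W_convex[of t t' z] sepzeros_step sg by auto
  obtain x where x: "x \<ge> t" "x \<le> z" "0 < \<sigma> * u x"
    using rolle_negD(1)[OF ru assms, of \<sigma> t z] sepzeros_step sg by force
  then have xW: "x \<in> W" using W_convex[of t z x] zW sg by auto
  have ax: "alt u W (n + of_bool l) x \<sigma>"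
  proof (cases "n + of_bool l = 0")
    case True
    then show ?thesis using x xW sg alt_base by metis
  next
    case False
    then show ?thesis
      using s x xW alt_append[of u W "n + of_bool l - 1" s "- \<sigma>" x] by force
  qed
  show ?case
  proof (cases "\<sigma>' = - \<sigma>")
    case True
    then show ?thesis using ax x sepzeros_step by (intro exI[of _ x]) auto
  next
    case False
    then have eq: "\<sigma>' = \<sigma>" using sg sepzeros_step by auto
    obtain y where y: "y \<ge> z" "y \<le> t'" "0 < - \<sigma> * u y"
      using rolle_negD(1)[OF ru assms, of "- \<sigma>" z t'] sepzeros_step sg eq by force
    then have "alt u W (Suc (n + of_bool l)) y (- \<sigma>)"
      using alt_append[OF ax, of y] x W_convex[of z t' y] zW sepzeros_step by auto
    then have "alt u W (n + of_bool l) y (- \<sigma>)" by (rule alt_drop)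
    then show ?thesis using y eq by (intro exI[of _ y]) auto
  qed
qed

lemma alt_rolle:
  assumes "\<delta> \<noteq> 0" "alt f W n t \<sigma>"
  shows "\<exists>s \<tau>. alt u W (n + of_bool (r \<and> \<delta> > 0) + of_bool (l \<and> \<delta> < 0)) s \<tau>"
proof (cases "\<delta> > 0")
  case True
  then show ?thesis
    using alt_rolle_pos[OF True assms(2)] finish_pos[of t \<sigma> n] alt_sign[OF assms(2)] by auto
next
  case False
  with assms have "\<delta> < 0" by auto
  then obtain s where "s \<le> t" "n + of_bool l = 0 \<or> alt u W (n + of_bool l - 1) s (- \<sigma>)"
    using alt_rolle_neg[OF _ assms(2)] by auto
  then show ?thesis
    using finish_neg[OF \<open>\<delta> < 0\<close>] alt_sign[OF assms(2)] \<open>\<delta> < 0\<close> by fastforce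
qed

lemma sepzeros_rolle:
  assumes "\<delta> \<noteq> 0" "sepzeros f W n t \<sigma>"
  shows "\<exists>s \<tau>. alt u W (n + of_bool (r \<and> \<delta> > 0) + of_bool (l \<and> \<delta> < 0)) s \<tau>"
proof (cases "\<delta> > 0")
  case True
  then show ?thesis
    using sepzeros_rolle_pos[OF True assms(2)] finish_pos[of t \<sigma> n] sepzeros_sign[OF assms(2)] by auto
next
  case False
  with assms have "\<delta> < 0" by auto
  then obtain s where "s \<le> t" "n + of_bool l = 0 \<or> alt u W (n + of_bool l - 1) s (- \<sigma>)"
    using sepzeros_rolle_neg[OF _ assms(2)] by auto
  then show ?thesis
    using finish_neg[OF \<open>\<delta> < 0\<close>] sepzeros_sign[OF assms(2)] \<open>\<delta> < 0\<close> by fastforce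
qed

end

lemma tp_pos_0 [simp]: "tp_pos 0 \<delta> = 0" and tp_neg_0 [simp]: "tp_neg 0 \<delta> = 0"
  by (simp_all add: tp_pos_def tp_neg_def)

lemma tp_pos_Suc: "tp_pos (Suc m) \<delta> = tp_pos m \<delta> + of_bool (\<delta> m > 0)"
proof -
  have "{k. k < Suc m \<and> \<delta> k > 0} = {k. k < m \<and> \<delta> k > 0} \<union> (if \<delta> m > 0 then {m} else {})"
    by (auto simp: less_Suc_eq)
  then show ?thesis by (simp add: tp_pos_def)
qed

lemma tp_neg_Suc: "tp_neg (Suc m) \<delta> = tp_neg m \<delta> + of_bool (\<delta> m < 0)"
proof -
  have "{k. k < Suc m \<and> \<delta> k < 0} = {k. k < m \<and> \<delta> k < 0} \<union> (if \<delta> m < 0 then {m} else {})"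
    by (auto simp: less_Suc_eq)
  then show ?thesis by (simp add: tp_neg_def)
qed

lemma tp_pos_neg: "(\<And>k. k < m \<Longrightarrow> \<delta> k \<noteq> 0) \<Longrightarrow> tp_pos m \<delta> + tp_neg m \<delta> = m"
proof (induction m)
  case (Suc m)
  moreover have "\<delta> m \<noteq> 0" using Suc by auto
  ultimately show ?case
    by (auto simp: tp_pos_Suc tp_neg_Suc)
qed simp

text \<open>Positive factors pick up their extra change at B and negative ones at A; this is how the
  numbers p and q enter.\<close>

lemma alt_chain:
  assumes "\<And>j. j < m \<Longrightarrow> rolle (\<delta> j) (f (Suc j)) (f j)" "\<And>j. j < m \<Longrightarrow> \<delta> j \<noteq> 0"
    and "\<And>j. 0 < j \<Longrightarrow> j \<le> m \<Longrightarrow> (l \<longrightarrow> f j A = 0) \<and> (r \<longrightarrow> f j B = 0)"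
    and "alt (f m) (window l r A B) n t \<sigma>"
  shows "\<exists>s \<tau>. alt (f 0) (window l r A B) (n + of_bool r * tp_pos m \<delta> + of_bool l * tp_neg m \<delta>) s \<tau>"
  using assms
proof (induction m arbitrary: n t \<sigma>)
  case (Suc m)
  have "\<exists>s \<tau>. alt (f m) (window l r A B)
      (n + of_bool (r \<and> \<delta> m > 0) + of_bool (l \<and> \<delta> m < 0)) s \<tau>"
    by (rule alt_rolle[of "\<delta> m" "f (Suc m)" "f m" l A r B n t \<sigma>]) (use Suc.prems in simp_all)
  then obtain s \<tau> where "alt (f m) (window l r A B)
      (n + of_bool (r \<and> \<delta> m > 0) + of_bool (l \<and> \<delta> m < 0)) s \<tau>"
    by blast
  from Suc.IH[OF _ _ _ this] Suc.prems show ?case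
    by (simp add: tp_pos_Suc tp_neg_Suc of_bool_conj algebra_simps)
qed auto

text \<open>The outermost factor converts separated zeros into alternation, and
  \<open>alt_chain\<close> takes over for the remaining ones.\<close>

lemma sepzeros_chain:
  assumes "\<And>j. j < m \<Longrightarrow> rolle (\<delta> j) (f (Suc j)) (f j)" "\<And>j. j < m \<Longrightarrow> \<delta> j \<noteq> 0"
    and "\<And>j. 0 < j \<Longrightarrow> j \<le> m \<Longrightarrow> (l \<longrightarrow> f j A = 0) \<and> (r \<longrightarrow> f j B = 0)"
    and "sepzeros (f m) (window l r A B) n t \<sigma>" "m > 0"
  shows "\<exists>s \<tau>. alt (f 0) (window l r A B) (n + of_bool r * tp_pos m \<delta> + of_bool l * tp_neg m \<delta>) s \<tau>"
proof -
  obtain k where k: "m = Suc k" using assms(5) by (cases m) auto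
  have "\<exists>s \<tau>. alt (f k) (window l r A B)
      (n + of_bool (r \<and> \<delta> k > 0) + of_bool (l \<and> \<delta> k < 0)) s \<tau>"
    by (rule sepzeros_rolle[of "\<delta> k" "f (Suc k)" "f k" l A r B n t \<sigma>]) (use assms k in simp_all)
  then obtain s \<tau> where alt: "alt (f k) (window l r A B)
      (n + of_bool (r \<and> \<delta> k > 0) + of_bool (l \<and> \<delta> k < 0)) s \<tau>"
    by blast
  have 1: "rolle (\<delta> j) (f (Suc j)) (f j)" if "j < k" for j
    using assms(1) k that by simp
  have 2: "\<delta> j \<noteq> 0" if "j < k" for j
    using assms(2) k that by simp
  have 3: "(l \<longrightarrow> f j A = 0) \<and> (r \<longrightarrow> f j B = 0)" if "0 < j" "j \<le> k" for j
    using assms(3) k that by simp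
  show ?thesis
    using alt_chain[of k \<delta> f l A r B, OF 1 2 3 alt]
    by (simp add: k tp_pos_Suc tp_neg_Suc of_bool_conj algebra_simps)
qed

section \<open>Schoenberg-Whitney uniqueness for samples of splines\<close>

lemma int_run_left:
  fixes i lo :: int
  assumes "lo \<le> i" "G i"
  shows "\<exists>l. lo \<le> l \<and> l \<le> i \<and> (\<forall>k. l \<le> k \<longrightarrow> k \<le> i \<longrightarrow> G k) \<and> (l = lo \<or> \<not> G (l - 1))"
  using assms
proof (induction i rule: int_ge_induct)
  case base
  then show ?case by (intro exI[of _ lo]) auto
next
  case (step i)
  show ?case
  proof (cases "G i")
    case True
    then obtain l where l: "lo \<le> l" "l \<le> i" "\<forall>k. l \<le> k \<longrightarrow> k \<le> i \<longrightarrow> G k" "l = lo \<or> \<not> G (l - 1)"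
      using step by blast
    have "G k" if "l \<le> k" "k \<le> i + 1" for k
      using that l(3) step.prems by (cases "k = i + 1") auto
    with l show ?thesis
      by (intro exI[of _ l]) auto
  next
    case False
    with step show ?thesis by (intro exI[of _ "i + 1"]) auto
  qed
qed

lemma int_run_right:
  fixes i hi :: int
  assumes "i \<le> hi" "G i"
  shows "\<exists>r. i \<le> r \<and> r \<le> hi \<and> (\<forall>k. i \<le> k \<longrightarrow> k \<le> r \<longrightarrow> G k) \<and> (r = hi \<or> \<not> G (r + 1))"
proof -
  obtain l where l: "- hi \<le> l" "l \<le> - i" "\<forall>k. l \<le> k \<longrightarrow> k \<le> - i \<longrightarrow> G (- k)" "l = - hi \<or> \<not> G (- (l - 1))"
    using int_run_left[of "- hi" "- i" "\<lambda>k. G (- k)"] assms by auto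
  show ?thesis
  proof (intro exI[of _ "- l"] conjI allI impI)
    fix k assume "i \<le> k" "k \<le> - l"
    then show "G k" using l(3)[rule_format, of "- k"] by auto
  qed (use l in \<open>auto simp: algebra_simps\<close>)
qed

text \<open>Schoenberg--Whitney type uniqueness. A maximal run of sample intervals on which \<open>f m\<close> does not
  vanish identically carries more sign changes than the knots \<open>M * k\<close> it can contain allow.\<close>

lemma spline_eq_0:
  fixes f :: "nat \<Rightarrow> real \<Rightarrow> real" and i1 i2 k1 k2 :: int and a M x :: real
  assumes roll: "\<And>j. j < m \<Longrightarrow> rolle (\<delta> j) (f (Suc j)) (f j)"
    and nz: "\<And>j. j < m \<Longrightarrow> \<delta> j \<noteq> 0" and m: "m > 0"
    and gap: "\<And>j a b. j < m \<Longrightarrow> a < b \<Longrightarrow> (\<And>t. a < t \<Longrightarrow> t < b \<Longrightarrow> f (Suc j) t = 0) \<Longrightarrow>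
      (\<And>t. a < t \<Longrightarrow> t < b \<Longrightarrow> f j t = 0)"
    and supp: "\<And>t. f 0 t \<noteq> 0 \<Longrightarrow> \<exists>k\<in>{k1..k2}. t = M * of_int k"
    and aM: "0 < a" "a < M"
    and smp: "\<And>i. i \<in> {i1..i2} \<Longrightarrow> f m (x + a * of_int i) = 0"
    and lo: "x + a * of_int i1 \<le> M * (of_int k1 + real (tp_pos m \<delta>) - 1) + a"
    and hi: "x + a * of_int i2 \<ge> M * (of_int k2 - real (tp_neg m \<delta>) + 1) - a"
    and num: "k2 - k1 \<le> i2 - i1" "k1 \<le> k2"
  shows "f 0 t = 0"
proof (rule ccontr)
  assume t: "f 0 t \<noteq> 0"
  define y where "y i = x + a * of_int i" for i :: int
  have y_less: "i < j \<Longrightarrow> y i < y j" and y_le: "i \<le> j \<Longrightarrow> y i \<le> y j" for i j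
    using aM by (auto simp: y_def)
  have smp': "f m (y i) = 0" if "i1 \<le> i" "i \<le> i2" for i
    using smp[of i] that by (simp add: y_def)
  \<comment> \<open>Vanishing of the top level on an open interval passes down through all levels to
    the coefficients.\<close>
  have gap': "f j s = 0" if "j \<le> m" "\<And>t. u < t \<Longrightarrow> t < v \<Longrightarrow> f m t = 0" "u < s" "s < v" for j s u v
    using that
  proof (induction j arbitrary: s rule: inc_induct)
    case (step j)
    show ?case
    proof (rule gap[of j u v])
      show "\<And>s. u < s \<Longrightarrow> s < v \<Longrightarrow> f (Suc j) s = 0"
        using step.IH step.prems by blast
    qed (use step in auto)
  qed auto
  obtain t1 where t1: "f m t1 \<noteq> 0"
    using gap'[of 0 "t - 1" "t + 1" t] t by force
  \<comment> \<open>For i = i1 - 1 and i = i2 these are the half lines beyond the samples; the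
    others lie between consecutive samples.\<close>
  define J where "J i = {t. (i1 \<le> i \<longrightarrow> y i < t) \<and> (i < i2 \<longrightarrow> t < y (i + 1))}" for i
  define G where "G i \<longleftrightarrow> (\<exists>t\<in>J i. f m t \<noteq> 0)" for i
  \<comment> \<open>The floor finds the interval of t1, and the clamping sends points beyond the
    samples to the half lines. The point t1 is no sample, since \<open>f m\<close> vanishes at
    samples.\<close>
  define i0 where "i0 = max (i1 - 1) (min i2 \<lfloor>(t1 - x) / a\<rfloor>)"
  have i0: "i1 - 1 \<le> i0" "i0 \<le> i2" using num by (auto simp: i0_def)
  have "t1 \<in> J i0"
  proof -
    have yt: "y i \<noteq> t1" if "i1 \<le> i" "i \<le> i2" for i
      using smp'[of i] that t1 by auto
    have "y i0 \<le> t1" if "i1 \<le> i0"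
    proof -
      have "i0 \<le> \<lfloor>(t1 - x) / a\<rfloor>" using that by (auto simp: i0_def)
      then have "of_int i0 \<le> (t1 - x) / a" by linarith
      then show ?thesis using aM by (simp add: y_def field_simps)
    qed
    moreover have "t1 < y (i0 + 1)" if "i0 < i2"
    proof -
      have "\<lfloor>(t1 - x) / a\<rfloor> \<le> i0" using that by (auto simp: i0_def)
      then have "(t1 - x) / a < of_int (i0 + 1)" by linarith
      then show ?thesis using aM by (simp add: y_def field_simps)
    qed
    ultimately show ?thesis
      using yt[of i0] i0 by (auto simp: J_def order.strict_iff_order)
  qed
  then have G0: "G i0" using t1 by (auto simp: G_def)
  obtain iL where iL: "i1 - 1 \<le> iL" "iL \<le> i0" "\<And>i. iL \<le> i \<Longrightarrow> i \<le> i0 \<Longrightarrow> G i" "iL = i1 - 1 \<or> \<not> G (iL - 1)"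
    using int_run_left[of "i1 - 1" i0 G, OF i0(1) G0] by blast
  obtain iR where iR: "i0 \<le> iR" "iR \<le> i2" "\<And>i. i0 \<le> i \<Longrightarrow> i \<le> iR \<Longrightarrow> G i" "iR = i2 \<or> \<not> G (iR + 1)"
    using int_run_right[of i0 i2 G, OF i0(2) G0] by blast
  have G: "G i" if "iL \<le> i" "i \<le> iR" for i
    using iL(3) iR(3) that by (cases "i \<le> i0") auto
  define l where "l \<longleftrightarrow> iL \<noteq> i1 - 1"
  define r where "r \<longleftrightarrow> iR \<noteq> i2"
  \<comment> \<open>At a bounded end of the run, A or B is the midpoint of the adjoining sample
    interval. All levels vanish there, so it is a boundary zero for every step of the chain.\<close>
  define A where "A = y iL - a / 2"
  define B where "B = y (iR + 1) + a / 2"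
  let ?W = "window l r A B"
  have gapl: "f j s = 0" if "l" "j \<le> m" "y iL - a < s" "s < y iL" for j s
  proof (rule gap'[OF that(2) _ that(3,4)])
    fix t assume "y iL - a < t" "t < y iL"
    then have "t \<in> J (iL - 1)"
      by (auto simp: J_def y_def algebra_simps)
    then show "f m t = 0"
      using iL(4) that(1) by (auto simp: G_def l_def)
  qed
  have gapr: "f j s = 0" if "r" "j \<le> m" "y (iR + 1) < s" "s < y (iR + 1) + a" for j s
  proof (rule gap'[OF that(2) _ that(3,4)])
    fix t assume "y (iR + 1) < t" "t < y (iR + 1) + a"
    then have "t \<in> J (iR + 1)"
      by (auto simp: J_def y_def algebra_simps)
    then show "f m t = 0"
      using iR(4) that(1) by (auto simp: G_def r_def)
  qed
  have JW: "J i \<subseteq> ?W" if "iL \<le> i" "i \<le> iR" for i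
  proof
    fix t assume t: "t \<in> J i"
    have "A \<le> t" if l
      using t that \<open>iL \<le> i\<close> iL(1) y_le[of iL i] aM by (auto simp: J_def A_def l_def)
    moreover have "t \<le> B" if r
      using t that \<open>i \<le> iR\<close> iR(2) y_le[of "i+1" "iR+1"] aM by (auto simp: J_def B_def r_def)
    ultimately show "t \<in> ?W" by (auto simp: window_def)
  qed
  have sep: "\<exists>t\<in>J (iL + int n). \<exists>\<sigma>. sepzeros (f m) ?W n t \<sigma>" if "iL + int n \<le> iR" for n
    using that
  proof (induction n)
    case 0
    then obtain t where t: "t \<in> J iL" "f m t \<noteq> 0" using G[of iL] by (auto simp: G_def)
    then have "sepzeros (f m) ?W 0 t (sgn (f m t))"
      using JW[of iL] 0 by (intro sepzeros_base) (auto simp: sgn_if)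
    with t show ?case by auto
  next
    case (Suc n)
    then obtain t \<sigma> where t: "t \<in> J (iL + int n)" "sepzeros (f m) ?W n t \<sigma>" by auto
    obtain t' where t': "t' \<in> J (iL + int n + 1)" "f m t' \<noteq> 0"
      using G[of "iL + int n + 1"] Suc.prems by (auto simp: G_def)
    have "sepzeros (f m) ?W (Suc n) t' (sgn (f m t'))"
    proof (rule sepzeros_step[OF t(2)])
      show "t < y (iL + int n + 1)" using t Suc.prems iR(2) by (auto simp: J_def)
      show "y (iL + int n + 1) < t'" using t' iL(1) by (auto simp: J_def)
      show "f m (y (iL + int n + 1)) = 0" using Suc.prems iR iL by (intro smp') auto
      show "t' \<in> ?W" using JW[of "iL + int n + 1"] t' Suc.prems by auto
    qed (use t' in \<open>auto simp: sgn_if\<close>)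
    with t' show ?case by (auto simp: algebra_simps)
  qed
  define N where "N = nat (iR - iL)"
  have N: "int N = iR - iL" using iL iR by (simp add: N_def)
  obtain t2 \<sigma> where sepN: "sepzeros (f m) ?W N t2 \<sigma>"
    using sep[of N] N by auto
  define S where "S = N + of_bool r * tp_pos m \<delta> + of_bool l * tp_neg m \<delta>"
  have ends: "(l \<longrightarrow> f j A = 0) \<and> (r \<longrightarrow> f j B = 0)" if "j \<le> m" for j
    using gapl[of j A] gapr[of j B] that aM by (auto simp: A_def B_def)
  obtain t3 \<tau> where alt0: "alt (f 0) ?W S t3 \<tau>"
    using sepzeros_chain[of m \<delta> f l A r B N t2 \<sigma>, OF roll nz ends sepN m] unfolding S_def by blast
  obtain T where T: "finite T" "card T = Suc S" "T \<subseteq> {x \<in> ?W. f 0 x \<noteq> 0}"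
    using alt_points[OF alt0] by blast
  \<comment> \<open>Alternating points of the bottom level are distinct knots with nonzero
    coefficients, so the window contains more than S such knots.\<close>
  define Q where "Q = {k \<in> {k1..k2}. M * of_int k \<in> ?W \<and> f 0 (M * of_int k) \<noteq> 0}"
  have finQ: "finite Q" unfolding Q_def by (rule finite_subset[of _ "{k1..k2}"]) auto
  have "T \<subseteq> (\<lambda>k. M * of_int k) ` Q"
  proof
    fix t assume "t \<in> T"
    then have t: "t \<in> ?W" "f 0 t \<noteq> 0" using T(3) by auto
    then obtain k where "k \<in> {k1..k2}" "t = M * of_int k" using supp by blast
    with t show "t \<in> (\<lambda>k. M * of_int k) ` Q" by (auto simp: Q_def)
  qed
  then have "card T \<le> card Q"
    using finQ by (meson surj_card_le)
  with T have cQ: "Suc S \<le> card Q" by simp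
  then have neQ: "Q \<noteq> {}" by auto
  define u where "u = Min Q"
  define v where "v = Max Q"
  have "Q \<subseteq> {u..v}" using finQ neQ by (auto simp: u_def v_def)
  then have "card Q \<le> card {u..v}" by (intro card_mono) auto
  with cQ have uv: "int S \<le> v - u" by auto
  have uQ: "u \<in> Q" "v \<in> Q" using finQ neQ by (auto simp: u_def v_def)
  then have uv_bd: "k1 \<le> u" "v \<le> k2" by (auto simp: Q_def)
  \<comment> \<open>Coefficients vanish on the adjoining gaps, so the extreme knots are bounded by
    samples and not merely by A and B.\<close>
  have uL: "y iL \<le> M * of_int u" if l
  proof (rule ccontr)
    assume "\<not> ?thesis"
    then show False
      using gapl[of 0 "M * of_int u"] that uQ aM by (auto simp: Q_def window_def A_def)
  qed
  have vR: "M * of_int v \<le> y (iR + 1)" if r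
  proof (rule ccontr)
    assume "\<not> ?thesis"
    then show False
      using gapr[of 0 "M * of_int v"] that uQ aM by (auto simp: Q_def window_def B_def)
  qed
  have pq: "tp_pos m \<delta> + tp_neg m \<delta> = m"
    using nz by (rule tp_pos_neg)
  have MS: "M * real S \<le> M * of_int v - M * of_int u"
  proof -
    have "real S \<le> of_int (v - u)" using uv by linarith
    then show ?thesis using mult_left_mono[of "real S" "of_int (v - u)" M] aM by (simp add: algebra_simps)
  qed
  have aN: "a * (real N + 1) < M * (real N + 1)"
    using aM by (intro mult_strict_right_mono) auto
  have Nr: "real N = of_int iR - of_int iL" using N by linarith
  have Mk: "M * of_int k1 \<le> M * of_int u" "M * of_int v \<le> M * of_int k2"
    using uv_bd aM by auto
  \<comment> \<open>Two boundaries: S = N + m changes would have to fit into a length a (N + 1) < M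
    (N + 1). One boundary: the open end is controlled by \<open>lo\<close> or \<open>hi\<close>,
    which gives S < N + p or S < N + q against equality. No boundary: S = i2 - i1 + 1 exceeds k2 -
    k1.\<close>
  show False
  proof (cases l; cases r)
    assume lr: l r
    have "M * real S \<le> a * (real N + 1)"
      using MS uL vR lr by (simp add: y_def Nr algebra_simps)
    with aN have "M * real S < M * (real N + 1)" by linarith
    then have "real S < real N + 1" using aM by simp
    then show False using lr pq m by (auto simp: S_def)
  next
    assume lr: l "\<not> r"
    then have "iR = i2" by (simp add: r_def)
    then have "M * real S \<le> M * real (tp_neg m \<delta>) - M + a * (real N + 1)"
      using MS uL hi lr Mk by (simp add: y_def Nr algebra_simps)
    with aN have "M * real S < M * real (tp_neg m \<delta> + N)" by (simp add: algebra_simps)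
    then have "real S < real (tp_neg m \<delta> + N)" using aM by simp
    then show False using lr by (auto simp: S_def)
  next
    assume lr: "\<not> l" r
    then have i1: "i1 = iL + 1" by (simp add: l_def)
    then have "M * real S \<le> M * real (tp_pos m \<delta>) - M + a * (real N + 1)"
      using MS vR lo lr Mk by (simp add: y_def Nr i1 algebra_simps)
    with aN have "M * real S < M * real (tp_pos m \<delta> + N)" by (simp add: algebra_simps)
    then have "real S < real (tp_pos m \<delta> + N)" using aM by simp
    then show False using lr by (auto simp: S_def)
  next
    assume lr: "\<not> l" "\<not> r"
    then have "int S = i2 - i1 + 1" using N by (simp add: l_def r_def S_def)
    then show False using uv uv_bd num by simp
  qed
qed

section \<open>Fourier transform and exponential filters\<close>

lemma cis_measurable [measurable]: "cis \<in> borel_measurable borel"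
  by (intro borel_measurable_continuous_onI continuous_intros)

text \<open>The positive and negative parts of u have the same mass. Normalized by it they are
  probability densities with equal characteristic functions, and Levy's uniqueness theorem
  applies.\<close>

lemma fourier_eq_0_imp_AE:
  fixes u :: "real \<Rightarrow> real"
  assumes u[measurable]: "integrable lborel u" and F: "\<And>\<xi>. fourier u \<xi> = 0"
  shows "AE x in lborel. u x = 0"
proof -
  have [measurable]: "u \<in> borel_measurable borel" using u by auto
  define p where "p x = max 0 (u x)" for x
  define n where "n x = max 0 (- u x)" for x
  have [measurable]: "p \<in> borel_measurable borel" "n \<in> borel_measurable borel"
    by (simp_all add: p_def[abs_def] n_def[abs_def])
  have int: "integrable lborel p" "integrable lborel n"
    unfolding p_def n_def using u by auto
  have upn: "u x = p x - n x" for x by (simp add: p_def n_def)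
  have nonneg: "0 \<le> p x" "0 \<le> n x" for x by (auto simp: p_def n_def)
  have split: "(LINT x|lborel. complex_of_real (p x) * cis (t * x)) = (LINT x|lborel. complex_of_real (n x) * cis (t * x))" for t
  proof -
    have i: "integrable lborel (\<lambda>x. complex_of_real (h x) * cis (t * x))"
      if "integrable lborel h" "\<And>x. 0 \<le> h x" for h :: "real \<Rightarrow> real"
    proof -
      have [measurable]: "h \<in> borel_measurable borel" using that(1) by auto
      show ?thesis
        by (rule Bochner_Integration.integrable_bound[OF that(1)]) (auto simp: norm_mult that(2))
    qed
    \<comment> \<open>Characteristic functions have the phase t x, which is the frequency - t / (2
      pi) here.\<close>
    have "(LINT x|lborel. complex_of_real (u x) * cis (t * x)) = 0"
      using F[of "- t / (2 * pi)"] by (simp add: fourier_def mult.commute)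
    then show ?thesis
      by (simp add: upn left_diff_distrib Bochner_Integration.integral_diff[OF i i] int nonneg)
  qed
  define I where "I = (LINT x|lborel. p x)"
  have In: "(LINT x|lborel. n x) = I"
    using split[of 0] by (simp add: I_def)
  show ?thesis
  proof (cases "I = 0")
    case True
    then have "AE x in lborel. p x = 0" "AE x in lborel. n x = 0"
      using integral_nonneg_eq_0_iff_AE[OF int(1)] integral_nonneg_eq_0_iff_AE[OF int(2)] In nonneg
      by (simp_all add: I_def)
    then show ?thesis
      by eventually_elim (simp add: upn)
  next
    case False
    have "0 \<le> I" unfolding I_def by (rule integral_nonneg_AE) (simp add: nonneg)
    with False have I: "0 < I" by simp
    have dist: "real_distribution (density lborel (\<lambda>x. ennreal (h x / I)))"
      if [measurable]: "h \<in> borel_measurable borel" and h: "integrable lborel h" "\<And>x. 0 \<le> h x" "(LINT x|lborel. h x) = I" for h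
    proof -
      have "(\<integral>\<^sup>+x. ennreal (h x / I) \<partial>lborel) = ennreal (LINT x|lborel. h x / I)"
        using h I by (intro nn_integral_eq_integral) auto
      also have "\<dots> = 1" using h I by simp
      finally have "prob_space (density lborel (\<lambda>x. ennreal (h x / I)))"
        by (intro prob_spaceI) (simp add: emeasure_density)
      then show ?thesis
        by (auto simp: real_distribution_def real_distribution_axioms_def)
    qed
    have char: "char (density lborel (\<lambda>x. ennreal (h x / I))) t = (LINT x|lborel. complex_of_real (h x) * cis (t * x)) / I"
      if [measurable]: "h \<in> borel_measurable borel" and h: "\<And>x. 0 \<le> h x" for h t
    proof -
      have "char (density lborel (\<lambda>x. ennreal (h x / I))) t = (LINT x|lborel. (h x / I) *\<^sub>R cis (t * x))"
        unfolding char_def using h I by (subst integral_density) (auto simp: cis_conv_exp mult_ac)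
      also have "\<dots> = (LINT x|lborel. complex_of_real (h x) * cis (t * x) / I)"
        by (simp add: scaleR_conv_of_real)
      finally show ?thesis by simp
    qed
    have "density lborel (\<lambda>x. ennreal (p x / I)) = density lborel (\<lambda>x. ennreal (n x / I))"
      by (intro Levy_uniqueness dist ext)
         (use int nonneg In I_def char split in auto)
    then have "AE x in lborel. ennreal (p x / I) = ennreal (n x / I)"
      by (intro sigma_finite_measure.density_unique[OF sigma_finite_lborel]) auto
    then show ?thesis
      by eventually_elim (use I nonneg in \<open>simp add: upn\<close>)
  qed
qed

section \<open>Exponential filters and their Rolle property\<close>

definition expk :: "real \<Rightarrow> real" where
  "expk s = (if 0 \<le> s then exp (- s) else 0)"

lemma expk_nonneg: "0 \<le> expk s" by (simp add: expk_def)

lemma expk_measurable [measurable]: "expk \<in> borel_measurable borel"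
  unfolding expk_def[abs_def] by measurable

lemma integrable_exp_Ici:
  fixes c :: real
  assumes "c > 0"
  shows "integrable lborel (\<lambda>x. indicator {0..} x * exp (- c * x))"
proof -
  have "integrable lebesgue (\<lambda>x. indicat_real {0..} x *\<^sub>R exp (- c * x))"
    using assms by (intro nonnegative_absolutely_integrable_1 [unfolded set_integrable_def] integrable_on_exp_minus_to_infinity) auto
  then show ?thesis
    by (subst (asm) integrable_completion) auto
qed

lemma integrable_expk_exp:
  assumes "c < 1"
  shows "integrable lborel (\<lambda>s. expk s * exp (c * s))"
proof -
  have "(\<lambda>s. expk s * exp (c * s)) = (\<lambda>x. indicator {0..} x * exp (- (1 - c) * x))"
    by (auto simp: expk_def exp_add[symmetric] algebra_simps)
  then show ?thesis using integrable_exp_Ici[of "1 - c"] assms by simp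
qed

lemma integrable_expk: "integrable lborel expk"
  using integrable_expk_exp[of 0] by simp

text \<open>The antiderivative - exp (- z s) / z with z = 1 + i \<theta> vanishes at infinity
  because z has real part 1.\<close>

lemma integral_expk_cis:
  "(LINT s|lborel. complex_of_real (expk s) * cis (- \<theta> * s)) = inverse (1 + \<i> * complex_of_real \<theta>)"
proof -
  define z where "z = 1 + \<i> * complex_of_real \<theta>"
  have z: "z \<noteq> 0" by (auto simp: z_def complex_eq_iff)
  define f where "f s = exp (- z * complex_of_real s)" for s
  define F where "F s = - exp (- z * complex_of_real s) / z" for s
  have norm_f: "norm (f s) = exp (- s)" for s
    by (simp add: f_def z_def)
  have fe: "f s = complex_of_real (exp (- s)) * cis (- \<theta> * s)" for s
    by (simp add: f_def z_def cis_conv_exp exp_of_real[symmetric] exp_add[symmetric] algebra_simps)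
  have cont: "continuous_on UNIV f"
    unfolding f_def by (intro continuous_intros)
  then have [measurable]: "f \<in> borel_measurable borel"
    by (rule borel_measurable_continuous_onI)
  have lim: "(F \<longlongrightarrow> 0) at_top"
  proof (rule tendsto_norm_zero_cancel)
    have "norm (F s) = exp (- s) / norm z" for s
      using norm_f[of s] by (simp add: F_def f_def norm_divide)
    moreover have "((\<lambda>s. exp (- s) / norm z) \<longlongrightarrow> 0) at_top"
      by (intro tendsto_divide_zero filterlim_compose[OF exp_at_bot] filterlim_uminus_at_bot_at_top)
    ultimately show "((\<lambda>s. norm (F s)) \<longlongrightarrow> 0) at_top"
      by simp
  qed
  have "(LBINT x=0..\<infinity>. f x) = 0 - (- 1 / z)"
  proof (rule interval_integral_FTC_integrable[where F = F])
    show "(F has_vector_derivative f x) (at x)" for x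
    proof -
      have "((\<lambda>w. - exp (- z * w) / z) has_field_derivative f x) (at (complex_of_real x))"
        using z by (auto intro!: derivative_eq_intros simp: f_def)
      from has_vector_derivative_real_field[OF this] show ?thesis by (simp add: F_def[abs_def])
    qed
    show "isCont f x" for x using cont by (simp add: continuous_on_eq_continuous_at)
    show "set_integrable lborel (einterval 0 \<infinity>) f"
      unfolding set_integrable_def
      by (rule Bochner_Integration.integrable_bound[OF integrable_expk])
         (auto simp: indicator_def einterval_def norm_f expk_def)
    have "isCont F 0" unfolding F_def by (intro continuous_intros) (use z in auto)
    then have "(F \<longlongrightarrow> F 0) (at_right 0)"
      by (meson isCont_def tendsto_within_subset top_greatest filterlim_at_split)
    then show "((F \<circ> real_of_ereal) \<longlongrightarrow> - 1 / z) (at_right 0)"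
      by (simp add: zero_ereal_def ereal_tendsto_simps F_def)
    show "((F \<circ> real_of_ereal) \<longlongrightarrow> 0) (at_left \<infinity>)"
      using lim by (simp add: ereal_tendsto_simps)
  qed simp
  \<comment> \<open>The integrands differ only at s = 0, which the open interval omits.\<close>
  moreover have "(LINT s|lborel. complex_of_real (expk s) * cis (- \<theta> * s)) = (LBINT x=0..\<infinity>. f x)"
    unfolding interval_lebesgue_integral_def set_lebesgue_integral_def
    by (simp, intro integral_cong_AE)
       (measurable, use AE_lborel_singleton[of 0] in eventually_elim, auto simp: expk_def fe einterval_def indicator_def scaleR_conv_of_real)
  ultimately show ?thesis
    by (simp add: z_def inverse_eq_divide)
qed

text \<open>Convolution with the kernel \<open>phi \<delta>\<close> below, scaled so that one
  formula covers both signs of \<open>\<delta>\<close>. For continuous u it solves f + \<delta> f' =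
  u.\<close>

definition efilter :: "real \<Rightarrow> (real \<Rightarrow> real) \<Rightarrow> real \<Rightarrow> real" where
  "efilter \<delta> u x = (LINT s|lborel. expk s * u (x - \<delta> * s))"

text \<open>For small rates this class contains the kernels and is stable under filters, shifts and
  finite sums. It supplies integrability for the Fourier transform and summability for the
  periodization at once.\<close>

definition decays :: "real \<Rightarrow> (real \<Rightarrow> real) \<Rightarrow> bool" where
  "decays c u \<longleftrightarrow> u \<in> borel_measurable borel \<and> (\<exists>C\<ge>0. \<forall>x. \<bar>u x\<bar> \<le> C * exp (- c * \<bar>x\<bar>))"

lemma decays_integrable:
  assumes "decays c u" "c > 0"
  shows "integrable lborel u"
proof -
  obtain C where C: "C \<ge> 0" "\<And>x. \<bar>u x\<bar> \<le> C * exp (- c * \<bar>x\<bar>)"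
    and [measurable]: "u \<in> borel_measurable borel"
    using assms by (auto simp: decays_def)
  let ?e = "\<lambda>x. indicator {0..} x * exp (- c * x) :: real"
  have i: "integrable lborel ?e" using integrable_exp_Ici assms by simp
  have j: "integrable lborel (\<lambda>x. ?e (0 + (- 1) * x))"
    by (rule lborel_integrable_real_affine[OF i]) simp
  have "integrable lborel (\<lambda>x. C * (?e x + ?e (0 + (- 1) * x)))"
    by (intro integrable_mult_right Bochner_Integration.integrable_add i j)
  then show ?thesis
  proof (rule Bochner_Integration.integrable_bound; (intro AE_I2)?)
    fix x
    have "exp (- c * \<bar>x\<bar>) \<le> ?e x + ?e (0 + (- 1) * x)"
      by (auto simp: indicator_def abs_if)
    then have "C * exp (- c * \<bar>x\<bar>) \<le> C * (?e x + ?e (0 + (- 1) * x))"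
      using C(1) by (rule mult_left_mono)
    then show "norm (u x) \<le> norm (C * (?e x + ?e (0 + (- 1) * x)))"
      using C(2)[of x] by simp
  qed simp
qed

lemma decays_sum:
  assumes "\<And>i. i \<in> I \<Longrightarrow> decays c (u i)" "finite I"
  shows "decays c (\<lambda>x. \<Sum>i\<in>I. u i x)"
  using assms(2,1)
proof (induction I rule: finite_induct)
  case empty
  then show ?case by (auto simp: decays_def)
next
  case (insert i I)
  then have "decays c (u i)" "decays c (\<lambda>x. \<Sum>i\<in>I. u i x)" by auto
  then obtain C D where "C \<ge> 0" "D \<ge> 0" and CD: "\<And>x. \<bar>u i x\<bar> \<le> C * exp (- c * \<bar>x\<bar>)"
    "\<And>x. \<bar>\<Sum>i\<in>I. u i x\<bar> \<le> D * exp (- c * \<bar>x\<bar>)"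
    and [measurable]: "u i \<in> borel_measurable borel" "(\<lambda>x. \<Sum>i\<in>I. u i x) \<in> borel_measurable borel"
    unfolding decays_def by blast
  have "\<bar>u i x + (\<Sum>i\<in>I. u i x)\<bar> \<le> (C + D) * exp (- c * \<bar>x\<bar>)" for x
    using CD[of x] by (simp add: distrib_right)
  then show ?case
    using insert \<open>C \<ge> 0\<close> \<open>D \<ge> 0\<close> by (auto simp: decays_def intro!: exI[of _ "C + D"])
qed

lemma decays_shift:
  assumes "decays c u" "c \<ge> 0"
  shows "decays c (\<lambda>x. a * u (x + b))"
proof -
  obtain C where C: "C \<ge> 0" "\<And>x. \<bar>u x\<bar> \<le> C * exp (- c * \<bar>x\<bar>)"
    and [measurable]: "u \<in> borel_measurable borel"
    using assms by (auto simp: decays_def)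
  have "\<bar>a * u (x + b)\<bar> \<le> (\<bar>a\<bar> * C * exp (c * \<bar>b\<bar>)) * exp (- c * \<bar>x\<bar>)" for x
  proof -
    have "c * \<bar>x\<bar> \<le> c * (\<bar>x + b\<bar> + \<bar>b\<bar>)" using assms(2) by (intro mult_left_mono) auto
    then have "exp (- c * \<bar>x + b\<bar>) \<le> exp (c * \<bar>b\<bar>) * exp (- c * \<bar>x\<bar>)"
      by (simp add: exp_add[symmetric] algebra_simps)
    then have "\<bar>u (x + b)\<bar> \<le> C * (exp (c * \<bar>b\<bar>) * exp (- c * \<bar>x\<bar>))"
      using C(2)[of "x + b"] mult_left_mono[OF _ C(1)] by (meson order_trans)
    then have "\<bar>a\<bar> * \<bar>u (x + b)\<bar> \<le> \<bar>a\<bar> * (C * (exp (c * \<bar>b\<bar>) * exp (- c * \<bar>x\<bar>)))"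
      by (rule mult_left_mono) simp
    then show ?thesis by (simp add: abs_mult mult_ac)
  qed
  then show ?thesis
    using C(1) by (auto simp: decays_def intro!: exI[of _ "\<bar>a\<bar> * C * exp (c * \<bar>b\<bar>)"])
qed

lemma efilter_integrable:
  assumes "decays c u" "c \<ge> 0"
  shows "integrable lborel (\<lambda>s. expk s * u (x - \<delta> * s))"
proof -
  obtain C where C: "C \<ge> 0" "\<And>x. \<bar>u x\<bar> \<le> C * exp (- c * \<bar>x\<bar>)"
    and [measurable]: "u \<in> borel_measurable borel"
    using assms by (auto simp: decays_def)
  have "integrable lborel (\<lambda>s. C * expk s)"
    by (intro integrable_mult_right integrable_expk)
  then show ?thesis
  proof (rule Bochner_Integration.integrable_bound; (intro AE_I2)?)
    fix s
    have "C * exp (- c * \<bar>x - \<delta> * s\<bar>) \<le> C * 1"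
      using C(1) assms(2) by (intro mult_left_mono) auto
    then have "\<bar>u (x - \<delta> * s)\<bar> \<le> C" using C(2)[of "x - \<delta> * s"] by simp
    then have "expk s * \<bar>u (x - \<delta> * s)\<bar> \<le> expk s * C"
      by (rule mult_left_mono) (rule expk_nonneg)
    then show "norm (expk s * u (x - \<delta> * s)) \<le> norm (C * expk s)"
      using expk_nonneg C(1) by (simp add: abs_mult mult_ac)
  qed simp
qed

lemma efilter_measurable [measurable]:
  assumes [measurable]: "u \<in> borel_measurable borel"
  shows "efilter \<delta> u \<in> borel_measurable borel"
  unfolding efilter_def[abs_def] by measurable

text \<open>The inequality |x| \<le> |x - \<delta> s| + |\<delta>| s splits off a factor exp (c
  |\<delta>| s), which the weight exp (- s) absorbs as long as c |\<delta>| < 1.\<close>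

lemma efilter_decays:
  assumes "decays c u" "c \<ge> 0" "c * \<bar>\<delta>\<bar> < 1"
  shows "decays c (efilter \<delta> u)"
proof -
  obtain C where C: "C \<ge> 0" "\<And>x. \<bar>u x\<bar> \<le> C * exp (- c * \<bar>x\<bar>)"
    and [measurable]: "u \<in> borel_measurable borel"
    using assms by (auto simp: decays_def)
  define D where "D = (LINT s|lborel. expk s * exp (c * \<bar>\<delta>\<bar> * s))"
  have iD: "integrable lborel (\<lambda>s. expk s * exp (c * \<bar>\<delta>\<bar> * s))"
    using integrable_expk_exp[OF assms(3)] by simp
  have "\<bar>efilter \<delta> u x\<bar> \<le> (C * D) * exp (- c * \<bar>x\<bar>)" for x
  proof -
    have "\<bar>efilter \<delta> u x\<bar> \<le> (LINT s|lborel. \<bar>expk s * u (x - \<delta> * s)\<bar>)"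
      unfolding efilter_def using integral_norm_bound[of lborel "\<lambda>s. expk s * u (x - \<delta> * s)"] by simp
    also have "\<dots> \<le> (LINT s|lborel. C * exp (- c * \<bar>x\<bar>) * (expk s * exp (c * \<bar>\<delta>\<bar> * s)))"
    proof (rule integral_mono)
      fix s
      show "\<bar>expk s * u (x - \<delta> * s)\<bar> \<le> C * exp (- c * \<bar>x\<bar>) * (expk s * exp (c * \<bar>\<delta>\<bar> * s))"
      proof (cases "0 \<le> s")
        case True
        have "\<bar>x\<bar> \<le> \<bar>x - \<delta> * s\<bar> + \<bar>\<delta>\<bar> * s" using abs_triangle_ineq[of "x - \<delta> * s" "\<delta> * s"] True by (simp add: abs_mult)
        then have "c * \<bar>x\<bar> \<le> c * (\<bar>x - \<delta> * s\<bar> + \<bar>\<delta>\<bar> * s)" using assms(2) by (intro mult_left_mono) auto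
        then have "exp (- c * \<bar>x - \<delta> * s\<bar>) \<le> exp (- c * \<bar>x\<bar>) * exp (c * \<bar>\<delta>\<bar> * s)"
          by (simp add: exp_add[symmetric] algebra_simps)
        then have "\<bar>u (x - \<delta> * s)\<bar> \<le> C * (exp (- c * \<bar>x\<bar>) * exp (c * \<bar>\<delta>\<bar> * s))"
          using C(2)[of "x - \<delta> * s"] mult_left_mono[OF _ C(1)] by (meson order_trans)
        then have "expk s * \<bar>u (x - \<delta> * s)\<bar> \<le> expk s * (C * (exp (- c * \<bar>x\<bar>) * exp (c * \<bar>\<delta>\<bar> * s)))"
          by (rule mult_left_mono) (rule expk_nonneg)
        then show ?thesis using expk_nonneg[of s] by (simp add: abs_mult mult_ac)
      qed (simp add: expk_def)
    qed (use iD efilter_integrable[OF assms(1,2)] in \<open>auto intro: integrable_mult_right\<close>)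
    also have "\<dots> = (C * D) * exp (- c * \<bar>x\<bar>)"
      by (simp add: D_def)
    finally show ?thesis .
  qed
  moreover have "0 \<le> D" unfolding D_def by (rule integral_nonneg_AE) (simp add: expk_nonneg)
  ultimately show ?thesis
    using C(1) by (auto simp: decays_def intro!: exI[of _ "C * D"])
qed

lemma efilter_sum:
  assumes "\<And>i. i \<in> I \<Longrightarrow> decays c (u i)" "c \<ge> 0"
  shows "efilter \<delta> (\<lambda>x. \<Sum>i\<in>I. u i x) x = (\<Sum>i\<in>I. efilter \<delta> (u i) x)"
proof -
  have "(LINT s|lborel. (\<Sum>i\<in>I. expk s * u i (x - \<delta> * s))) = (\<Sum>i\<in>I. (LINT s|lborel. expk s * u i (x - \<delta> * s)))"
    by (rule Bochner_Integration.integral_sum) (rule efilter_integrable[OF assms])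
  then show ?thesis
    by (simp add: efilter_def sum_distrib_left)
qed

lemma efilter_shift: "efilter \<delta> (\<lambda>x. a * u (x + b)) x = a * efilter \<delta> u (x + b)"
  unfolding efilter_def integral_mult_right_zero[symmetric]
  by (rule Bochner_Integration.integral_cong) (auto simp: algebra_simps)

text \<open>Reflection changes the sign of \<open>\<delta>\<close>; the analytic facts below are
  proved for positive \<open>\<delta>\<close> and transferred by it.\<close>

lemma efilter_reflect: "efilter (- \<delta>) (\<lambda>x. u (- x)) x = efilter \<delta> u (- x)"
  unfolding efilter_def by (simp add: algebra_simps)

lemma decays_reflect: "decays c u \<Longrightarrow> decays c (\<lambda>x. u (- x))"
  unfolding decays_def
proof (elim conjE exE, intro conjI exI[of _ "_ :: real"] allI)
  fix C x assume "0 \<le> C" "\<forall>x. \<bar>u x\<bar> \<le> C * exp (- c * \<bar>x\<bar>)"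
  then show "\<bar>u (- x)\<bar> \<le> C * exp (- c * \<bar>x\<bar>)" by (metis abs_minus_cancel)
qed auto

text \<open>The substitution y = x - \<delta> s turns the weighted filter into the antiderivative of
  exp (y / \<delta>) u(y) that vanishes at minus infinity.\<close>

lemma exp_efilter_eq:
  assumes "\<delta> > 0" "decays c u" "c \<ge> 0"
  shows "integrable lborel (\<lambda>y. indicator {..x} y * (exp (y / \<delta>) * u y))"
    and "\<delta> * exp (x / \<delta>) * efilter \<delta> u x = (LINT y|lborel. indicator {..x} y * (exp (y / \<delta>) * u y))"
proof -
  let ?f = "\<lambda>y. indicator {..x} y * (exp (y / \<delta>) * u y)"
  have eq: "?f (x + (- \<delta>) * s) = exp (x / \<delta>) * (expk s * u (x - \<delta> * s))" for s
  proof (cases "0 \<le> s")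
    case True
    have "(x - \<delta> * s) / \<delta> = x / \<delta> + - s" using assms by (simp add: field_simps)
    then have "exp ((x - \<delta> * s) / \<delta>) = exp (x / \<delta>) * exp (- s)" by (simp only: exp_add)
    then show ?thesis using True assms by (simp add: expk_def indicator_def)
  next
    case False
    then have "\<delta> * s < 0" using assms by (simp add: mult_pos_neg)
    then show ?thesis using False by (simp add: expk_def)
  qed
  have "integrable lborel (\<lambda>s. ?f (x + (- \<delta>) * s))"
    unfolding eq by (intro integrable_mult_right efilter_integrable[OF assms(2,3)])
  then show "integrable lborel ?f"
    using lborel_integrable_real_affine_iff[of "- \<delta>" ?f x] assms(1) by simp
  have "(LINT y|lborel. ?f y) = \<bar>- \<delta>\<bar> *\<^sub>R (LINT s|lborel. ?f (x + (- \<delta>) * s))"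
    by (rule lborel_integral_real_affine) (use assms in simp)
  then show "\<delta> * exp (x / \<delta>) * efilter \<delta> u x = (LINT y|lborel. ?f y)"
    unfolding eq efilter_def using assms(1) by simp
qed

lemma exp_efilter_diff:
  assumes "\<delta> > 0" "decays c u" "c \<ge> 0" "a \<le> b"
  shows "integrable lborel (\<lambda>y. indicator {a<..b} y * (exp (y / \<delta>) * u y))"
    and "\<delta> * exp (b / \<delta>) * efilter \<delta> u b - \<delta> * exp (a / \<delta>) * efilter \<delta> u a =
      (LINT y|lborel. indicator {a<..b} y * (exp (y / \<delta>) * u y))"
proof -
  have eq: "indicator {a<..b} y * (exp (y / \<delta>) * u y) =
      indicator {..b} y * (exp (y / \<delta>) * u y) - indicator {..a} y * (exp (y / \<delta>) * u y)" for y
    using assms(4) by (auto simp: indicator_def)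
  note I = exp_efilter_eq[OF assms(1-3)]
  show "integrable lborel (\<lambda>y. indicator {a<..b} y * (exp (y / \<delta>) * u y))"
    unfolding eq by (intro Bochner_Integration.integrable_diff I)
  show "\<delta> * exp (b / \<delta>) * efilter \<delta> u b - \<delta> * exp (a / \<delta>) * efilter \<delta> u a =
      (LINT y|lborel. indicator {a<..b} y * (exp (y / \<delta>) * u y))"
    unfolding eq I(2) by (intro Bochner_Integration.integral_diff[symmetric] I)
qed

lemma rolle_reflect:
  assumes "rolle (- \<delta>) (\<lambda>x. f (- x)) (\<lambda>x. u (- x))"
  shows "rolle \<delta> f u"
  unfolding rolle_def
proof (intro conjI allI impI)
  fix a b \<sigma> :: real assume a: "a < b" "\<sigma> \<in> {1, -1}" "f a \<noteq> 0 \<or> f b \<noteq> 0" "sgn \<delta> * \<sigma> * f a \<le> 0"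
    "0 \<le> sgn \<delta> * \<sigma> * f b"
  then obtain t where "t \<in> {-b..-a}" "0 < \<sigma> * u (- t)"
    using assms[unfolded rolle_def, THEN conjunct1, rule_format, of "- b" "- a" \<sigma>]
    by (auto simp: sgn_minus)
  then show "\<exists>t\<in>{a..b}. 0 < \<sigma> * u t" by (intro bexI[of _ "- t"]) auto
next
  fix b \<sigma> :: real assume "\<sigma> \<in> {1, -1}" "0 < \<sigma> * f b"
  then obtain t where "sgn (- \<delta>) * t \<le> sgn (- \<delta>) * (- b)" "0 < \<sigma> * u (- t)"
    using assms[unfolded rolle_def, THEN conjunct2, rule_format, of \<sigma> "- b"] by auto
  then show "\<exists>t. sgn \<delta> * t \<le> sgn \<delta> * b \<and> 0 < \<sigma> * u t"
    by (intro exI[of _ "- t"]) (simp add: sgn_minus)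
qed

text \<open>Under the sign hypotheses of \<open>rolle\<close> both terms of the weighted difference
  have the right sign and one is nonzero, so strictly positive increments are all that has to be
  treated.\<close>

lemma rolle_posI:
  assumes "\<delta> > 0"
    and 1: "\<And>a b \<sigma>. a < b \<Longrightarrow> \<sigma> \<in> {1, -1} \<Longrightarrow> 0 < \<sigma> * (exp (b / \<delta>) * f b - exp (a / \<delta>) * f a) \<Longrightarrow>
      \<exists>t\<in>{a..b}. 0 < \<sigma> * u t"
    and 2: "\<And>b \<sigma>. \<sigma> \<in> {1, -1} \<Longrightarrow> 0 < \<sigma> * f b \<Longrightarrow> \<exists>t\<le>b. 0 < \<sigma> * u t"
  shows "rolle \<delta> f u"
  unfolding rolle_def
proof (intro conjI allI impI)
  fix a b \<sigma> :: real assume a: "a < b" "\<sigma> \<in> {1, -1}" "f a \<noteq> 0 \<or> f b \<noteq> 0" "sgn \<delta> * \<sigma> * f a \<le> 0"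
    "0 \<le> sgn \<delta> * \<sigma> * f b"
  then have "0 \<le> \<sigma> * f b" "0 \<le> - (\<sigma> * f a)" using assms(1) by auto
  then have "0 \<le> exp (b / \<delta>) * (\<sigma> * f b)" "0 \<le> exp (a / \<delta>) * (- (\<sigma> * f a))"
    using mult_nonneg_nonneg[OF exp_ge_zero] by blast+
  moreover have "exp (b / \<delta>) * (\<sigma> * f b) \<noteq> 0 \<or> exp (a / \<delta>) * (- (\<sigma> * f a)) \<noteq> 0"
    using a by auto
  ultimately have "0 < exp (b / \<delta>) * (\<sigma> * f b) + exp (a / \<delta>) * (- (\<sigma> * f a))" by linarith
  then have "0 < \<sigma> * (exp (b / \<delta>) * f b - exp (a / \<delta>) * f a)"
    by (simp add: algebra_simps)
  then show "\<exists>t\<in>{a..b}. 0 < \<sigma> * u t" using 1 a by blast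
next
  fix b \<sigma> :: real assume "\<sigma> \<in> {1, -1}" "0 < \<sigma> * f b"
  then show "\<exists>t. sgn \<delta> * t \<le> sgn \<delta> * b \<and> 0 < \<sigma> * u t"
    using 2 assms(1) by auto
qed

lemma integral_pos_imp_ex:
  fixes f :: "real \<Rightarrow> real"
  assumes "0 < (LINT y|lborel. f y)"
  shows "\<exists>y. 0 < f y"
proof (rule ccontr)
  assume "\<not> ?thesis"
  then have "0 \<le> (LINT y|lborel. - f y)" by (intro integral_nonneg_AE) (auto simp: not_less)
  with assms show False by simp
qed

lemma mult_indicator_exp_pos_iff:
  fixes \<sigma> v z :: real
  shows "0 < \<sigma> * (indicator S y * (exp z * v)) \<longleftrightarrow> y \<in> S \<and> 0 < \<sigma> * v"
proof -
  have "\<sigma> * (exp z * v) = exp z * (\<sigma> * v)" by simp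
  then show ?thesis
    by (cases "y \<in> S") (simp_all only: indicator_simps mult_zero_left mult_zero_right mult_1 zero_less_mult_iff, auto)
qed

text \<open>A positive integral forces a positive value of its integrand. This form of Rolle's
  theorem also covers the discontinuous combinations at the first level.\<close>

lemma rolle_efilter:
  assumes "\<delta> \<noteq> 0" "decays c u" "c \<ge> 0"
  shows "rolle \<delta> (efilter \<delta> u) u"
proof -
  have pos: "rolle \<delta> (efilter \<delta> u) u" if "\<delta> > 0" "decays c u" for \<delta> u
  proof (rule rolle_posI[OF that(1)])
    fix a b \<sigma> :: real
    assume ab: "a < b" "\<sigma> \<in> {1, -1}" "0 < \<sigma> * (exp (b / \<delta>) * efilter \<delta> u b - exp (a / \<delta>) * efilter \<delta> u a)"
    then have "0 < \<delta> * (\<sigma> * (exp (b / \<delta>) * efilter \<delta> u b - exp (a / \<delta>) * efilter \<delta> u a))"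
      using mult_pos_pos[OF that(1)] by blast
    also have "\<dots> = \<sigma> * (\<delta> * exp (b / \<delta>) * efilter \<delta> u b - \<delta> * exp (a / \<delta>) * efilter \<delta> u a)"
      by (simp add: algebra_simps)
    also have "\<dots> = (LINT y|lborel. \<sigma> * (indicator {a<..b} y * (exp (y / \<delta>) * u y)))"
      using exp_efilter_diff(2)[OF that assms(3), of a b] ab by simp
    finally obtain y where "0 < \<sigma> * (indicator {a<..b} y * (exp (y / \<delta>) * u y))"
      using integral_pos_imp_ex by blast
    then show "\<exists>t\<in>{a..b}. 0 < \<sigma> * u t"
      unfolding mult_indicator_exp_pos_iff by (intro bexI[of _ y]) auto
  next
    fix b \<sigma> :: real
    assume b: "\<sigma> \<in> {1, -1}" "0 < \<sigma> * efilter \<delta> u b"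
    then have "0 < (\<delta> * exp (b / \<delta>)) * (\<sigma> * efilter \<delta> u b)"
      using that(1) by (simp add: zero_less_mult_iff)
    also have "\<dots> = \<sigma> * (\<delta> * exp (b / \<delta>) * efilter \<delta> u b)" by simp
    also have "\<dots> = (LINT y|lborel. \<sigma> * (indicator {..b} y * (exp (y / \<delta>) * u y)))"
      using exp_efilter_eq(2)[OF that assms(3), of b] by simp
    finally obtain y where "0 < \<sigma> * (indicator {..b} y * (exp (y / \<delta>) * u y))"
      using integral_pos_imp_ex by blast
    then show "\<exists>t\<le>b. 0 < \<sigma> * u t"
      unfolding mult_indicator_exp_pos_iff by (intro exI[of _ y]) auto
  qed
  show ?thesis
  proof (cases "\<delta> > 0")
    case False
    then have "rolle (- \<delta>) (efilter (- \<delta>) (\<lambda>x. u (- x))) (\<lambda>x. u (- x))"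
      using assms by (intro pos decays_reflect) auto
    moreover have "efilter (- \<delta>) (\<lambda>x. u (- x)) = (\<lambda>x. efilter \<delta> u (- x))"
      by (rule ext) (rule efilter_reflect)
    ultimately show ?thesis
      by (simp add: rolle_reflect)
  qed (use pos assms in auto)
qed

text \<open>As u is bounded, the weighted antiderivative \<open>H\<close> is Lipschitz on left half
  lines; the constant depends on the half line because the weight grows.\<close>

lemma efilter_continuous:
  assumes "\<delta> \<noteq> 0" "decays c u" "c \<ge> 0"
  shows "continuous_on UNIV (efilter \<delta> u)"
proof -
  have pos: "continuous_on UNIV (efilter \<delta> u)" if \<delta>: "\<delta> > 0" and u: "decays c u" for \<delta> u
  proof -
    define H where "H x = \<delta> * exp (x / \<delta>) * efilter \<delta> u x" for x
    obtain C where C: "C \<ge> 0" "\<And>x. \<bar>u x\<bar> \<le> C * exp (- c * \<bar>x\<bar>)"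
      using u by (auto simp: decays_def)
    have uC: "\<bar>u x\<bar> \<le> C" for x
    proof -
      have "C * exp (- c * \<bar>x\<bar>) \<le> C * 1" using C(1) assms(3) by (intro mult_left_mono) auto
      with C(2)[of x] show ?thesis by simp
    qed
    have lip: "\<bar>H b - H a\<bar> \<le> exp (X / \<delta>) * C * \<bar>b - a\<bar>" if "a \<le> b" "b \<le> X" for a b X
    proof -
      note D = exp_efilter_diff[OF \<delta> u assms(3) that(1)]
      have "\<bar>H b - H a\<bar> \<le> (LINT y|lborel. \<bar>indicator {a<..b} y * (exp (y / \<delta>) * u y)\<bar>)"
        unfolding H_def D(2)
        using integral_norm_bound[of lborel "\<lambda>y. indicator {a<..b} y * (exp (y / \<delta>) * u y)"] by simp
      also have "\<dots> \<le> (LINT y|lborel. indicator {a<..b} y * (exp (X / \<delta>) * C))"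
      proof (rule integral_mono)
        show "integrable lborel (\<lambda>y. \<bar>indicator {a<..b} y * (exp (y / \<delta>) * u y)\<bar>)"
          by (intro integrable_abs D)
        fix y
        have "exp (y / \<delta>) * \<bar>u y\<bar> \<le> exp (X / \<delta>) * C" if "y \<le> b"
          using that \<open>b \<le> X\<close> uC \<delta> by (intro mult_mono) (auto simp: divide_right_mono)
        then show "\<bar>indicator {a<..b} y * (exp (y / \<delta>) * u y)\<bar> \<le> indicator {a<..b} y * (exp (X / \<delta>) * C)"
          by (auto simp: indicator_def abs_mult)
      qed (use that in simp)
      also have "\<dots> = exp (X / \<delta>) * C * \<bar>b - a\<bar>" using that by simp
      finally show ?thesis .
    qed
    have "isCont H x" for x
    proof -
      have "(exp ((x + 1) / \<delta>) * C)-lipschitz_on {..<x + 1} H"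
      proof (rule lipschitz_onI)
        fix a b assume "a \<in> {..<x + 1}" "b \<in> {..<x + 1}"
        then show "dist (H a) (H b) \<le> exp ((x + 1) / \<delta>) * C * dist a b"
          using lip[of a b "x + 1"] lip[of b a "x + 1"]
          by (cases "a \<le> b") (auto simp: dist_real_def abs_minus_commute)
      qed (use C in simp)
      then have "continuous_on {..<x + 1} H" by (rule lipschitz_on_continuous_on)
      then show ?thesis by (simp add: continuous_on_eq_continuous_at)
    qed
    moreover have "efilter \<delta> u = (\<lambda>x. H x / (\<delta> * exp (x / \<delta>)))"
      using \<delta> by (auto simp: H_def)
    ultimately show ?thesis
      using \<delta> by (auto intro!: continuous_intros simp: continuous_at_imp_continuous_on)
  qed
  show ?thesis
  proof (cases "\<delta> > 0")
    case False
    then have "continuous_on UNIV (efilter (- \<delta>) (\<lambda>x. u (- x)))"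
      using assms by (intro pos decays_reflect) auto
    then have "continuous_on UNIV (\<lambda>x. efilter (- \<delta>) (\<lambda>x. u (- x)) (- x))"
      by (rule continuous_on_compose2) (auto intro: continuous_intros)
    then show ?thesis by (simp add: efilter_reflect)
  qed (use pos assms in auto)
qed

text \<open>Continuity from the side to which d points. The kernel \<open>phi \<delta>\<close> jumps
  at 0 and its value there is the limit from one side; this lifts vanishing almost everywhere to
  vanishing everywhere.\<close>

definition side_cont :: "real \<Rightarrow> (real \<Rightarrow> real) \<Rightarrow> bool" where
  "side_cont d u \<longleftrightarrow> (\<forall>t. ((\<lambda>s. u (t + d * s)) \<longlongrightarrow> u t) (at_right 0))"

lemma side_cont_shift: "side_cont d u \<Longrightarrow> side_cont d (\<lambda>x. a * u (x + b))"
  unfolding side_cont_def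
proof
  fix t assume "\<forall>t. ((\<lambda>s. u (t + d * s)) \<longlongrightarrow> u t) (at_right 0)"
  then have "((\<lambda>s. a * u ((t + b) + d * s)) \<longlongrightarrow> a * u (t + b)) (at_right 0)"
    by (intro tendsto_mult tendsto_const) blast
  then show "((\<lambda>s. a * u (t + d * s + b)) \<longlongrightarrow> a * u (t + b)) (at_right 0)"
    by (simp add: algebra_simps)
qed

lemma side_cont_sum: "(\<And>i. i \<in> I \<Longrightarrow> side_cont d (u i)) \<Longrightarrow> side_cont d (\<lambda>x. \<Sum>i\<in>I. u i x)"
  unfolding side_cont_def by (auto intro!: tendsto_sum)

lemma continuous_imp_side_cont:
  assumes "continuous_on UNIV u"
  shows "side_cont d u"
  unfolding side_cont_def
proof
  fix t
  have "((\<lambda>s. u (t + d * s)) \<longlongrightarrow> u (t + d * 0)) (at_right 0)"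
    by (rule isCont_tendsto_compose[where g = u])
       (use assms in \<open>auto simp: continuous_on_eq_continuous_at intro!: tendsto_eq_intros\<close>)
  then show "((\<lambda>s. u (t + d * s)) \<longlongrightarrow> u t) (at_right 0)" by simp
qed

text \<open>The weighted integral of u over a subinterval is a difference of two zeros, so u has no
  constant strict sign on any subinterval. A nonzero value at t would, by one-sided continuity,
  create such a subinterval next to t.\<close>

lemma efilter_gap:
  assumes "\<delta> \<noteq> 0" "decays c u" "c \<ge> 0" "side_cont d u" "d \<in> {1, -1}"
    and "\<And>t. a < t \<Longrightarrow> t < b \<Longrightarrow> efilter \<delta> u t = 0" "a < t" "t < b"
  shows "u t = 0"
proof -
  have pos: "\<not> (\<forall>y\<in>{p<..q}. 0 < \<sigma> * u y)"
    if \<delta>: "\<delta> > 0" and u: "decays c u" and z: "\<And>t. a < t \<Longrightarrow> t < b \<Longrightarrow> efilter \<delta> u t = 0"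
      and pq: "a < p" "p < q" "q < b" for \<delta> u a b p q \<sigma>
  proof
    assume y: "\<forall>y\<in>{p<..q}. 0 < \<sigma> * u y"
    let ?g = "\<lambda>y. \<sigma> * (indicator {p<..q} y * (exp (y / \<delta>) * u y))"
    have "p \<le> q" using pq by simp
    note D = exp_efilter_diff[OF \<delta> u assms(3) this]
    have "(LINT y|lborel. ?g y) = 0"
      using D(2) z[of p] z[of q] pq by simp
    moreover have g_pos: "0 < ?g y" if "y \<in> {p<..q}" for y
    proof -
      have "0 < exp (y / \<delta>) * (\<sigma> * u y)" using y that by (intro mult_pos_pos[OF exp_gt_zero]) auto
      then show ?thesis using that by (simp add: mult_ac)
    qed
    then have "0 \<le> ?g y" for y by (cases "y \<in> {p<..q}") (auto simp: less_imp_le)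
    ultimately have "AE y in lborel. ?g y = 0"
      using integral_nonneg_eq_0_iff_AE[of lborel ?g] D(1) by auto
    then have "AE y in lborel. y \<notin> {p<..q}"
      by eventually_elim (use g_pos in force)
    then have "emeasure lborel {p<..q} = 0"
      by (subst (asm) AE_iff_measurable[of "{p<..q}"]) auto
    then show False using pq by simp
  qed
  have no_pos: "\<not> (\<forall>y\<in>{p<..<q}. 0 < \<sigma> * u y)" if pq: "a < p" "p < q" "q < b" for p q \<sigma>
  proof (cases "\<delta> > 0")
    case True
    define r where "r = (p + q) / 2"
    have "p < r" "r < q" using pq by (auto simp: r_def)
    then show ?thesis
      using pos[OF True assms(2) assms(6), where p = p and q = r and \<sigma> = \<sigma>] pq by fastforce
  next
    case False
    define r where "r = (p + q) / 2"
    have r: "p < r" "r < q" using pq by (auto simp: r_def)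
    have "efilter (- \<delta>) (\<lambda>x. u (- x)) t = 0" if "- b < t" "t < - a" for t
      using assms(6)[of "- t"] that by (simp add: efilter_reflect)
    then have "\<not> (\<forall>y\<in>{-q<..-r}. 0 < \<sigma> * u (- y))"
      using False assms(1,2) pq r by (intro pos[of "- \<delta>" _ "- b" "- a"] decays_reflect) auto
    then obtain y where "y \<in> {-q<..-r}" "\<not> 0 < \<sigma> * u (- y)" by blast
    then show ?thesis using r by (intro notI) (drule bspec[of _ _ "- y"], auto)
  qed
  show ?thesis
  proof (rule ccontr)
    assume nz: "u t \<noteq> 0"
    define \<sigma> where "\<sigma> = sgn (u t)"
    have "((\<lambda>s. \<sigma> * u (t + d * s)) \<longlongrightarrow> \<sigma> * u t) (at_right 0)"
      using assms(4) by (intro tendsto_mult tendsto_const) (simp add: side_cont_def)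
    moreover have "0 < \<sigma> * u t" using nz by (simp add: \<sigma>_def sgn_if)
    ultimately have "\<forall>\<^sub>F s in at_right 0. 0 < \<sigma> * u (t + d * s)" by (rule order_tendstoD)
    then obtain e where e: "e > 0" "\<And>s. 0 < s \<Longrightarrow> s < e \<Longrightarrow> 0 < \<sigma> * u (t + d * s)"
      unfolding eventually_at_right_field by auto
    define h where "h = min e (min (t - a) (b - t)) / 2"
    have h: "0 < h" "h < e" "h < t - a" "h < b - t"
      using e(1) assms(7,8) by (auto simp: h_def min_def)
    show False
    proof (cases "d = 1")
      case True
      have "0 < \<sigma> * u y" if "y \<in> {t + h / 2<..<t + h}" for y
        using e(2)[of "y - t"] that h True by auto
      then show False using no_pos[of "t + h / 2" "t + h" \<sigma>] h assms by auto
    next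
      case False
      then have d: "d = - 1" using assms(5) by auto
      have "0 < \<sigma> * u y" if "y \<in> {t - h<..<t - h / 2}" for y
        using e(2)[of "t - y"] that h d by auto
      then show False using no_pos[of "t - h" "t - h / 2" \<sigma>] h assms by auto
    qed
  qed
qed

text \<open>Fubini applies since the absolute double integral is the product of two L1 norms. The
  inner integral is the transform of a translate of u, and its phase integrates against
  \<open>expk\<close> to the new factor.\<close>

lemma fourier_efilter:
  assumes [measurable]: "integrable lborel u"
  shows "fourier (efilter \<delta> u) \<xi> = fourier u \<xi> * inverse (1 + \<i> * complex_of_real (2 * pi * \<delta> * \<xi>))"
proof -
  have [measurable]: "u \<in> borel_measurable borel" using assms by auto
  let ?F = "\<lambda>s x. complex_of_real (expk s * u (x - \<delta> * s)) * cis (- 2 * pi * x * \<xi>)"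
  have ish: "integrable lborel (\<lambda>x. u (x - b))" for b
    using lborel_integrable_real_affine[OF assms, of 1 "- b"] by simp
  have norm_sh: "(LINT x|lborel. \<bar>u (x - b)\<bar>) = (LINT x|lborel. \<bar>u x\<bar>)" for b
    using lborel_integral_real_affine[of 1 "\<lambda>x. \<bar>u x\<bar>" "- b"] by simp
  have intF: "integrable (lborel \<Otimes>\<^sub>M lborel) (case_prod ?F)"
  proof (rule lborel_pair.Fubini_integrable)
    show "case_prod ?F \<in> borel_measurable (lborel \<Otimes>\<^sub>M lborel)" by measurable
    have "(LINT x|lborel. norm (?F s x)) = (LINT x|lborel. \<bar>u x\<bar>) * expk s" for s
      using expk_nonneg[of s] by (simp add: norm_mult abs_mult norm_sh)
    then show "integrable lborel (\<lambda>s. LINT x|lborel. norm (case_prod ?F (s, x)))"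
      using integrable_expk by simp
    show "AE s in lborel. integrable lborel (\<lambda>x. case_prod ?F (s, x))"
    proof (rule AE_I2)
      fix s
      have i: "integrable lborel (\<lambda>x. expk s * u (x - \<delta> * s))" by (intro integrable_mult_right ish)
      show "integrable lborel (\<lambda>x. case_prod ?F (s, x))"
        by (rule Bochner_Integration.integrable_bound[OF i]) (auto simp: norm_mult)
    qed
  qed
  have inner: "(LINT x|lborel. ?F s x) = complex_of_real (expk s) * cis (- (2 * pi * \<delta> * \<xi>) * s) * fourier u \<xi>" for s
  proof -
    have "(LINT x|lborel. ?F s x) = (LINT x|lborel. ?F s (\<delta> * s + 1 * x))"
      using lborel_integral_real_affine[of 1 "?F s" "\<delta> * s"] by simp
    also have "\<dots> = (LINT x|lborel. complex_of_real (expk s) * cis (- (2 * pi * \<delta> * \<xi>) * s) *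
        (complex_of_real (u x) * cis (- 2 * pi * x * \<xi>)))"
      by (rule Bochner_Integration.integral_cong) (auto simp: cis_mult mult_ac algebra_simps)
    finally show ?thesis by (simp add: fourier_def)
  qed
  have "fourier (efilter \<delta> u) \<xi> = (LINT x|lborel. (LINT s|lborel. ?F s x))"
    unfolding fourier_def efilter_def
    by (rule Bochner_Integration.integral_cong) (simp_all flip: integral_complex_of_real)
  also have "\<dots> = (LINT s|lborel. (LINT x|lborel. ?F s x))"
    by (rule lborel_pair.Fubini_integral[OF intF])
  also have "\<dots> = (LINT s|lborel. complex_of_real (expk s) * cis (- (2 * pi * \<delta> * \<xi>) * s)) * fourier u \<xi>"
    unfolding inner by simp
  also have "\<dots> = inverse (1 + \<i> * complex_of_real (2 * pi * \<delta> * \<xi>)) * fourier u \<xi>"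
    by (simp only: integral_expk_cis)
  finally show ?thesis by (simp add: mult.commute)
qed

section \<open>The exponential kernel and combinations of its translates\<close>

definition phi :: "real \<Rightarrow> real \<Rightarrow> real" where
  "phi \<delta> x = expk (x / \<delta>) / \<bar>\<delta>\<bar>"

lemma phi_reflect: "phi (- \<delta>) x = phi \<delta> (- x)"
  by (simp add: phi_def)

lemma phi_decays:
  assumes "\<delta> \<noteq> 0" "c \<ge> 0" "c * \<bar>\<delta>\<bar> < 1"
  shows "decays c (phi \<delta>)"
proof -
  have "\<bar>phi \<delta> x\<bar> \<le> (1 / \<bar>\<delta>\<bar>) * exp (- c * \<bar>x\<bar>)" for x
  proof (cases "0 \<le> x / \<delta>")
    case True
    then have "x / \<delta> = \<bar>x\<bar> / \<bar>\<delta>\<bar>" by (metis abs_divide abs_of_nonneg)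
    moreover have "c * \<bar>x\<bar> \<le> \<bar>x\<bar> / \<bar>\<delta>\<bar>"
      using assms mult_right_mono[of "c * \<bar>\<delta>\<bar>" 1 "\<bar>x\<bar>"] by (simp add: field_simps)
    ultimately have "expk (x / \<delta>) \<le> exp (- c * \<bar>x\<bar>)" using True by (simp add: expk_def)
    then show ?thesis
      using expk_nonneg by (simp add: phi_def divide_right_mono)
  qed (simp add: phi_def expk_def)
  then show ?thesis
    unfolding decays_def phi_def[abs_def] by (intro conjI exI[of _ "1 / \<bar>\<delta>\<bar>"]) (auto simp: phi_def)
qed

lemma fourier_phi:
  assumes "\<delta> \<noteq> 0"
  shows "fourier (phi \<delta>) \<xi> = inverse (1 + \<i> * complex_of_real (2 * pi * \<delta> * \<xi>))"
proof -
  have "fourier (phi \<delta>) \<xi> = \<bar>\<delta>\<bar> *\<^sub>R (LINT s|lborel. complex_of_real (phi \<delta> (0 + \<delta> * s)) * cis (- 2 * pi * (0 + \<delta> * s) * \<xi>))"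
    unfolding fourier_def by (rule lborel_integral_real_affine) (use assms in simp)
  also have "\<dots> = (LINT s|lborel. complex_of_real (expk s) * cis (- (2 * pi * \<delta> * \<xi>) * s))"
    unfolding integral_scaleR_right[symmetric]
    by (rule Bochner_Integration.integral_cong)
       (use assms in \<open>auto simp: phi_def scaleR_conv_of_real mult_ac\<close>)
  finally show ?thesis by (simp only: integral_expk_cis)
qed

lemma expk_side_cont: "side_cont 1 expk"
  unfolding side_cont_def
proof
  fix t :: real
  show "((\<lambda>s. expk (t + 1 * s)) \<longlongrightarrow> expk t) (at_right 0)"
  proof (cases "0 \<le> t")
    case True
    have "((\<lambda>s. exp (- (t + s))) \<longlongrightarrow> exp (- (t + 0))) (at_right 0)"
      by (intro tendsto_intros)
    moreover have "\<forall>\<^sub>F s in at_right 0. exp (- (t + s)) = expk (t + 1 * s)"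
      using True unfolding eventually_at_right_field by (intro exI[of _ 1]) (auto simp: expk_def)
    ultimately show ?thesis
      using True by (simp add: expk_def Lim_transform_eventually)
  next
    case False
    have "\<forall>\<^sub>F s in at_right 0. 0 = expk (t + 1 * s)"
      using False unfolding eventually_at_right_field by (intro exI[of _ "- t"]) (auto simp: expk_def)
    then have "((\<lambda>s. expk (t + 1 * s)) \<longlongrightarrow> 0) (at_right 0)"
      by (rule Lim_transform_eventually[rotated]) simp
    then show ?thesis using False by (simp add: expk_def)
  qed
qed

lemma phi_side_cont:
  assumes "\<delta> \<noteq> 0"
  shows "side_cont (sgn \<delta>) (phi \<delta>)"
  unfolding side_cont_def
proof
  fix t
  have "filterlim (\<lambda>s. s / \<bar>\<delta>\<bar>) (at_right 0) (at_right 0)"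
  proof (rule filterlim_at_withinI)
    show "((\<lambda>s. s / \<bar>\<delta>\<bar>) \<longlongrightarrow> 0) (at_right 0)"
      using assms by (auto intro!: tendsto_eq_intros)
    show "\<forall>\<^sub>F s in at_right 0. s / \<bar>\<delta>\<bar> \<in> {0<..} - {0}"
      using assms unfolding eventually_at_right_field by (intro exI[of _ 1]) auto
  qed
  from filterlim_compose[OF expk_side_cont[unfolded side_cont_def, rule_format, of "t / \<delta>"] this]
  have "((\<lambda>s. expk (t / \<delta> + 1 * (s / \<bar>\<delta>\<bar>)) / \<bar>\<delta>\<bar>) \<longlongrightarrow> expk (t / \<delta>) / \<bar>\<delta>\<bar>) (at_right 0)"
    using assms by (intro tendsto_divide tendsto_const) auto
  moreover have "t / \<delta> + 1 * (s / \<bar>\<delta>\<bar>) = (t + sgn \<delta> * s) / \<delta>" for s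
    using assms by (auto simp: sgn_if abs_if field_simps)
  ultimately show "((\<lambda>s. phi \<delta> (t + sgn \<delta> * s)) \<longlongrightarrow> phi \<delta> t) (at_right 0)"
    by (simp add: phi_def)
qed

text \<open>Stands for the measure with mass \<open>c i\<close> at \<open>\<tau> i\<close>: a
  function that has the sign of the mass at each knot and vanishes elsewhere. It takes the part of
  \<open>u\<close> below the first kernel.\<close>

definition knots :: "('i \<Rightarrow> real) \<Rightarrow> 'i set \<Rightarrow> ('i \<Rightarrow> real) \<Rightarrow> real \<Rightarrow> real" where
  "knots \<tau> I c t = (\<Sum>i\<in>I. if t = \<tau> i then c i else 0)"

lemma knots_at:
  assumes "finite I" "inj_on \<tau> I" "i \<in> I"
  shows "knots \<tau> I c (\<tau> i) = c i"
proof -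
  have "knots \<tau> I c (\<tau> i) = (\<Sum>j\<in>I. if j = i then c i else 0)"
    unfolding knots_def using assms by (intro sum.cong) (auto dest: inj_onD)
  then show ?thesis using assms by simp
qed

lemma knots_nonzero: "knots \<tau> I c t \<noteq> 0 \<Longrightarrow> \<exists>i\<in>I. t = \<tau> i"
proof (rule ccontr)
  assume "knots \<tau> I c t \<noteq> 0" "\<not> (\<exists>i\<in>I. t = \<tau> i)"
  then show False unfolding knots_def by simp
qed

text \<open>The weight flattens the kernel to a pure step, so combinations of translates become step
  functions whose jumps are positive multiples of the coefficients.\<close>

lemma exp_phi:
  assumes "\<delta> > 0"
  shows "\<delta> * exp (x / \<delta>) * phi \<delta> (x - y) = (if y \<le> x then exp (y / \<delta>) else 0)"
proof (cases "y \<le> x")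
  case True
  have "exp (x / \<delta>) * exp (- ((x - y) / \<delta>)) = exp (y / \<delta>)"
    unfolding exp_add[symmetric] by (simp add: diff_divide_distrib)
  then show ?thesis using True assms by (simp add: phi_def expk_def)
next
  case False
  then have "(x - y) / \<delta> < 0" using assms by (simp add: field_simps)
  then show ?thesis using False by (simp add: phi_def expk_def)
qed

lemma sum_pos_imp_ex: "0 < (\<Sum>i\<in>I. w i :: real) \<Longrightarrow> \<exists>i\<in>I. 0 < w i"
  by (meson not_less sum_nonpos)

lemma rolle_phi:
  assumes "\<delta> \<noteq> 0" "finite I" "inj_on \<tau> I"
  shows "rolle \<delta> (\<lambda>x. \<Sum>i\<in>I. c i * phi \<delta> (x - \<tau> i)) (knots \<tau> I c)"
proof -
  have pos: "rolle \<delta> (\<lambda>x. \<Sum>i\<in>I. c i * phi \<delta> (x - \<tau> i)) (knots \<tau> I c)"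
    if \<delta>: "\<delta> > 0" and inj: "inj_on \<tau> I" for \<delta> \<tau>
  proof (rule rolle_posI[OF \<delta>])
    let ?f = "\<lambda>x. \<Sum>i\<in>I. c i * phi \<delta> (x - \<tau> i)"
    have H: "\<delta> * (exp (x / \<delta>) * ?f x) = (\<Sum>i\<in>I. c i * (if \<tau> i \<le> x then exp (\<tau> i / \<delta>) else 0))" for x
      unfolding sum_distrib_left exp_phi[OF \<delta>, symmetric] by (rule sum.cong) simp_all
    {
      fix a b \<sigma> :: real
      assume ab: "a < b" "\<sigma> \<in> {1, -1}" "0 < \<sigma> * (exp (b / \<delta>) * ?f b - exp (a / \<delta>) * ?f a)"
      have "0 < \<delta> * (\<sigma> * (exp (b / \<delta>) * ?f b - exp (a / \<delta>) * ?f a))"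
        using mult_pos_pos[OF \<delta> ab(3)] .
      also have "\<dots> = \<sigma> * (\<delta> * (exp (b / \<delta>) * ?f b) - \<delta> * (exp (a / \<delta>) * ?f a))"
        by (simp add: algebra_simps)
      also have "\<dots> = (\<Sum>i\<in>I. \<sigma> * (indicator {a<..b} (\<tau> i) * (exp (\<tau> i / \<delta>) * c i)))"
        by (simp only: H, unfold sum_subtractf[symmetric] sum_distrib_left, rule sum.cong)
          (use ab(1) in \<open>auto simp: indicator_def\<close>)
      finally obtain i where "i \<in> I" "0 < \<sigma> * (indicator {a<..b} (\<tau> i) * (exp (\<tau> i / \<delta>) * c i))"
        using sum_pos_imp_ex by blast
      then show "\<exists>t\<in>{a..b}. 0 < \<sigma> * knots \<tau> I c t"
        unfolding mult_indicator_exp_pos_iff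
        using knots_at[OF assms(2) inj] by (intro bexI[of _ "\<tau> i"]) auto
    next
      fix b \<sigma> :: real
      assume b: "\<sigma> \<in> {1, -1}" "0 < \<sigma> * ?f b"
      have "0 < (\<delta> * exp (b / \<delta>)) * (\<sigma> * ?f b)"
        using \<delta> by (intro mult_pos_pos[OF _ b(2)]) simp
      also have "\<dots> = \<sigma> * (\<delta> * (exp (b / \<delta>) * ?f b))"
        by (simp add: algebra_simps)
      also have "\<dots> = (\<Sum>i\<in>I. \<sigma> * (indicator {..b} (\<tau> i) * (exp (\<tau> i / \<delta>) * c i)))"
        by (simp only: H, unfold sum_distrib_left, rule sum.cong) (auto simp: indicator_def)
      finally obtain i where "i \<in> I" "0 < \<sigma> * (indicator {..b} (\<tau> i) * (exp (\<tau> i / \<delta>) * c i))"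
        using sum_pos_imp_ex by blast
      then show "\<exists>t\<le>b. 0 < \<sigma> * knots \<tau> I c t"
        unfolding mult_indicator_exp_pos_iff
        using knots_at[OF assms(2) inj] by (intro exI[of _ "\<tau> i"]) auto
    }
  qed
  show ?thesis
  proof (cases "\<delta> > 0")
    case False
    then have "rolle (- \<delta>) (\<lambda>x. \<Sum>i\<in>I. c i * phi (- \<delta>) (x - - \<tau> i)) (knots (\<lambda>i. - \<tau> i) I c)"
      using assms by (intro pos) (auto simp: inj_on_def)
    moreover have "knots (\<lambda>i. - \<tau> i) I c = (\<lambda>x. knots \<tau> I c (- x))"
      unfolding knots_def by (intro ext sum.cong) auto
    moreover have "(\<lambda>x. \<Sum>i\<in>I. c i * phi (- \<delta>) (x - - \<tau> i)) = (\<lambda>x. \<Sum>i\<in>I. c i * phi \<delta> (- x - \<tau> i))"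
      by (simp add: phi_reflect add.commute)
    ultimately show ?thesis by (simp add: rolle_reflect)
  qed (use pos assms in auto)
qed

text \<open>The weighted combination jumps at each knot by a positive multiple of the coefficient,
  and where the combination vanishes there is no jump.\<close>

lemma phi_gap:
  assumes "\<delta> \<noteq> 0" "finite I" "inj_on \<tau> I"
    and "\<And>t. a < t \<Longrightarrow> t < b \<Longrightarrow> (\<Sum>i\<in>I. c i * phi \<delta> (t - \<tau> i)) = 0" "a < t" "t < b"
  shows "knots \<tau> I c t = 0"
proof -
  have pos: "c i = 0"
    if \<delta>: "\<delta> > 0" and inj: "inj_on \<tau> I"
      and z: "\<And>t. a < t \<Longrightarrow> t < b \<Longrightarrow> (\<Sum>i\<in>I. c i * phi \<delta> (t - \<tau> i)) = 0"
      and i: "i \<in> I" "a < \<tau> i" "\<tau> i < b" for \<delta> \<tau> a b i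
  proof -
    let ?f = "\<lambda>x. \<Sum>i\<in>I. c i * phi \<delta> (x - \<tau> i)"
    have H: "\<delta> * (exp (x / \<delta>) * ?f x) = (\<Sum>i\<in>I. c i * (if \<tau> i \<le> x then exp (\<tau> i / \<delta>) else 0))" for x
      unfolding sum_distrib_left exp_phi[OF \<delta>, symmetric] by (rule sum.cong) simp_all
    obtain d where d: "d > 0" "\<And>j. j \<in> I \<Longrightarrow> \<tau> j \<noteq> \<tau> i \<Longrightarrow> d \<le> dist (\<tau> i) (\<tau> j)"
      using finite_set_avoid[of "\<tau> ` I" "\<tau> i"] assms(2) by auto
    \<comment> \<open>Smaller than the distance to all other knots, so only \<open>\<tau> i\<close>
      contributes to the increment from \<open>\<tau> i - h\<close> to
      \<open>\<tau> i\<close>.\<close>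
    define h where "h = min d (\<tau> i - a) / 2"
    have h: "0 < h" "h < d" "h < \<tau> i - a" using d(1) i by (auto simp: h_def min_def)
    have "0 = \<delta> * (exp (\<tau> i / \<delta>) * ?f (\<tau> i)) - \<delta> * (exp ((\<tau> i - h) / \<delta>) * ?f (\<tau> i - h))"
      using z[of "\<tau> i"] z[of "\<tau> i - h"] i h by simp
    also have "\<dots> = (\<Sum>j\<in>I. if j = i then c i * exp (\<tau> i / \<delta>) else 0)"
      unfolding H sum_subtractf[symmetric]
    proof (rule sum.cong)
      fix j assume j: "j \<in> I"
      show "c j * (if \<tau> j \<le> \<tau> i then exp (\<tau> j / \<delta>) else 0) - c j * (if \<tau> j \<le> \<tau> i - h then exp (\<tau> j / \<delta>) else 0)
        = (if j = i then c i * exp (\<tau> i / \<delta>) else 0)"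
      proof (cases "j = i")
        case False
        then have "\<tau> j \<noteq> \<tau> i" using inj i(1) j by (auto dest: inj_onD)
        then have "d \<le> \<bar>\<tau> i - \<tau> j\<bar>" using d(2)[OF j] by (simp add: dist_real_def)
        then have "\<tau> j \<le> \<tau> i \<longleftrightarrow> \<tau> j \<le> \<tau> i - h" using h by (auto simp: abs_if split: if_splits)
        then show ?thesis using False by simp
      qed (use h in simp)
    qed simp
    also have "\<dots> = c i * exp (\<tau> i / \<delta>)" using assms(2) i by simp
    finally show ?thesis by simp
  qed
  show ?thesis
  proof (rule ccontr)
    assume nz: "knots \<tau> I c t \<noteq> 0"
    then obtain i where i: "i \<in> I" "t = \<tau> i" using knots_nonzero by metis
    have "c i = 0"
    proof (cases "\<delta> > 0")
      case True
      then show ?thesis using pos[OF True assms(3,4) i(1)] assms i by auto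
    next
      case False
      show ?thesis
      proof (rule pos[of "- \<delta>" "\<lambda>i. - \<tau> i" "- b" "- a"])
        fix t assume "- b < t" "t < - a"
        then have "(\<Sum>i\<in>I. c i * phi \<delta> (- t - \<tau> i)) = 0" by (intro assms(4)) auto
        then show "(\<Sum>i\<in>I. c i * phi (- \<delta>) (t - - \<tau> i)) = 0"
          by (simp add: phi_reflect add.commute)
      qed (use assms False i in \<open>auto simp: inj_on_def\<close>)
    qed
    then show False using nz knots_at[OF assms(2,3) i(1)] i(2) by simp
  qed
qed

section \<open>Totally positive functions of finite type as iterated filters\<close>

fun tpf :: "(nat \<Rightarrow> real) \<Rightarrow> nat \<Rightarrow> real \<Rightarrow> real" where
  "tpf \<delta> 0 = phi (\<delta> 0)"
| "tpf \<delta> (Suc j) = efilter (\<delta> (Suc j)) (tpf \<delta> j)"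

lemma tpf_decays:
  assumes "c \<ge> 0" "\<And>k. k \<le> j \<Longrightarrow> \<delta> k \<noteq> 0 \<and> c * \<bar>\<delta> k\<bar> < 1"
  shows "decays c (tpf \<delta> j)"
  using assms by (induction j) (auto intro: phi_decays efilter_decays)

lemma ex_decay_rate: fixes m :: nat shows "\<exists>c>0. \<forall>k<m. c * \<bar>\<delta> k\<bar> < (1::real)"
\<comment> \<open>The reciprocal of a number exceeding every |\<delta> k|; the summand 1 gives
  strictness and covers m = 0.\<close>
proof (intro exI[of _ "1 / (1 + (\<Sum>k<m. \<bar>\<delta> k\<bar>))"] conjI allI impI)
  have S: "0 \<le> (\<Sum>k<m. \<bar>\<delta> k\<bar>)" by (rule sum_nonneg) simp
  then have S1: "0 < 1 + (\<Sum>k<m. \<bar>\<delta> k\<bar>)" by linarith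
  then show "0 < 1 / (1 + (\<Sum>k<m. \<bar>\<delta> k\<bar>))" by simp
  fix k assume "k < m"
  then have "\<bar>\<delta> k\<bar> \<le> (\<Sum>k<m. \<bar>\<delta> k\<bar>)" by (intro member_le_sum) auto
  then show "1 / (1 + (\<Sum>k<m. \<bar>\<delta> k\<bar>)) * \<bar>\<delta> k\<bar> < 1" using S1 by (simp add: divide_simps)
qed

lemma tpf_reflect: "tpf (\<lambda>k. - \<delta> k) j x = tpf \<delta> j (- x)"
proof (induction j arbitrary: x)
  case (Suc j)
  have "tpf (\<lambda>k. - \<delta> k) j = (\<lambda>x. tpf \<delta> j (- x))" using Suc by auto
  then show ?case by (simp add: efilter_reflect)
qed (simp add: phi_reflect)

lemma fourier_tpf:
  assumes "c > 0" "\<And>k. k \<le> j \<Longrightarrow> \<delta> k \<noteq> 0 \<and> c * \<bar>\<delta> k\<bar> < 1"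
  shows "fourier (tpf \<delta> j) \<xi> = (\<Prod>k<Suc j. inverse (1 + \<i> * complex_of_real (2 * pi * \<delta> k * \<xi>)))"
  using assms(2)
proof (induction j)
  case (Suc j)
  have "decays c (tpf \<delta> j)" using assms(1) Suc.prems by (intro tpf_decays) auto
  then have "integrable lborel (tpf \<delta> j)" using assms(1) by (rule decays_integrable)
  then show ?case using Suc by (simp add: fourier_efilter)
qed (simp add: fourier_phi)

lemma tpf_continuous:
  assumes "0 < j" "c \<ge> 0" "\<And>k. k \<le> j \<Longrightarrow> \<delta> k \<noteq> 0 \<and> c * \<bar>\<delta> k\<bar> < 1"
  shows "continuous_on UNIV (tpf \<delta> j)"
proof -
  obtain i where i: "j = Suc i" using assms(1) by (cases j) auto
  have "decays c (tpf \<delta> i)" using assms i by (intro tpf_decays) auto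
  then show ?thesis using assms i by (auto intro: efilter_continuous)
qed

lemma AE_eq_0_continuous:
  fixes u :: "real \<Rightarrow> real"
  assumes "continuous_on UNIV u" "AE x in lborel. u x = 0"
  shows "u x = 0"
proof (rule ccontr)
  assume "u x \<noteq> 0"
  have op: "open {x. u x \<noteq> 0}"
    using assms(1) by (intro open_Collect_neq continuous_intros) auto
  then have "\<not> negligible {x. u x \<noteq> 0}"
    using \<open>u x \<noteq> 0\<close> by (intro open_not_negligible) auto
  moreover have "{x. u x \<noteq> 0} \<in> null_sets lborel"
    using assms(2) op AE_iff_null_sets[of "{x. u x \<noteq> 0}" lborel] by auto
  then have "negligible {x. u x \<noteq> 0}"
    by (simp add: negligible_iff_null_sets null_sets_completionI)
  ultimately show False by simp
qed

text \<open>The transform determines g almost everywhere. For m \<ge> 2 at least one filter follows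
  the jumping kernel, so both sides are continuous and agree at every point, which matters because
  the algorithm samples g.\<close>

lemma tp_finite_type_eq:
  assumes "tp_finite_type g m \<delta>" "continuous_on UNIV g" "m \<ge> 2"
  shows "\<exists>C>0. \<forall>x. g x = C * tpf \<delta> (m - 1) x"
proof -
  obtain C where C: "C > 0" "\<And>\<xi>. fourier g \<xi> =
        complex_of_real C * (\<Prod>k<m. inverse (1 + \<i> * complex_of_real (2 * pi * \<delta> k * \<xi>)))"
    and ig: "integrable lborel g" and nz: "\<And>k. k < m \<Longrightarrow> \<delta> k \<noteq> 0"
    using assms(1) by (auto simp: tp_finite_type_def)
  obtain c where c: "c > 0" "\<And>k. k < m \<Longrightarrow> c * \<bar>\<delta> k\<bar> < 1" using ex_decay_rate by blast
  let ?h = "tpf \<delta> (m - 1)"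
  have k: "\<delta> k \<noteq> 0 \<and> c * \<bar>\<delta> k\<bar> < 1" if "k \<le> m - 1" for k
    using c nz that assms(3) by auto
  have ih: "integrable lborel ?h"
    using c k by (intro decays_integrable[of c] tpf_decays) auto
  have F: "fourier (\<lambda>x. g x - C * ?h x) \<xi> = 0" for \<xi>
  proof -
    have i: "integrable lborel (\<lambda>x. complex_of_real (h x) * cis (- 2 * pi * x * \<xi>))"
      if h: "integrable lborel h" for h :: "real \<Rightarrow> real"
    proof -
      have [measurable]: "h \<in> borel_measurable borel" using h by auto
      show ?thesis
        by (rule Bochner_Integration.integrable_bound[OF h]) (auto simp: norm_mult)
    qed
    have "fourier (\<lambda>x. g x - C * ?h x) \<xi> = (LINT x|lborel. complex_of_real (g x) * cis (- 2 * pi * x * \<xi>)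
        - complex_of_real C * (complex_of_real (?h x) * cis (- 2 * pi * x * \<xi>)))"
      unfolding fourier_def by (simp add: algebra_simps)
    also have "\<dots> = fourier g \<xi> - C * fourier ?h \<xi>"
      using i[OF ig] i[OF ih] by (simp add: fourier_def)
    also have "\<dots> = 0"
      using fourier_tpf[of c "m - 1" \<delta> \<xi>] c k assms(3) C(2) by simp
    finally show ?thesis .
  qed
  have "AE x in lborel. g x - C * ?h x = 0"
    using ig ih F by (intro fourier_eq_0_imp_AE) auto
  moreover have "continuous_on UNIV (\<lambda>x. g x - C * ?h x)"
    using assms c k by (intro continuous_intros tpf_continuous[of _ c]) auto
  ultimately have "g x - C * ?h x = 0" for x by (intro AE_eq_0_continuous)
  then show ?thesis using C(1) by (intro exI[of _ C]) auto
qed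

text \<open>The level is shifted by one against \<open>tpf\<close>: level 0 holds the coefficients,
  and the step from level j to level j + 1 belongs to the factor \<open>\<delta> j\<close>.\<close>

definition tpf_spline :: "(nat \<Rightarrow> real) \<Rightarrow> ('i \<Rightarrow> real) \<Rightarrow> 'i set \<Rightarrow> ('i \<Rightarrow> real) \<Rightarrow> nat \<Rightarrow> real \<Rightarrow> real" where
  "tpf_spline \<delta> \<tau> I c j = (case j of 0 \<Rightarrow> knots \<tau> I c | Suc i \<Rightarrow> (\<lambda>x. \<Sum>k\<in>I. c k * tpf \<delta> i (x - \<tau> k)))"

lemma tpf_spline_step:
  assumes "\<And>k. k \<le> j \<Longrightarrow> \<delta> k \<noteq> 0" "finite I" "inj_on \<tau> I"
  shows "rolle (\<delta> j) (tpf_spline \<delta> \<tau> I c (Suc j)) (tpf_spline \<delta> \<tau> I c j)"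
    and "(\<And>t. a < t \<Longrightarrow> t < b \<Longrightarrow> tpf_spline \<delta> \<tau> I c (Suc j) t = 0) \<Longrightarrow> a < t \<Longrightarrow> t < b \<Longrightarrow>
      tpf_spline \<delta> \<tau> I c j t = 0"
proof -
  obtain e where e: "e > 0" "\<And>k. k < Suc j \<Longrightarrow> e * \<bar>\<delta> k\<bar> < 1" using ex_decay_rate by blast
  have dec: "decays e (\<lambda>x. c k * tpf \<delta> i (x - \<tau> k))" if "i \<le> j" for i k
    using decays_shift[OF tpf_decays[of e i \<delta>], of "c k" "- \<tau> k"] assms(1) e that by auto
  have dec_sum: "decays e (tpf_spline \<delta> \<tau> I c (Suc i))" if "i \<le> j" for i
    unfolding tpf_spline_def using decays_sum[OF dec[OF that] assms(2)] by simp
  have step: "tpf_spline \<delta> \<tau> I c (Suc (Suc i)) = efilter (\<delta> (Suc i)) (tpf_spline \<delta> \<tau> I c (Suc i))"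
    if "Suc i = j" for i
  proof
    fix x
    have "efilter (\<delta> (Suc i)) (tpf_spline \<delta> \<tau> I c (Suc i)) x =
        (\<Sum>k\<in>I. efilter (\<delta> (Suc i)) (\<lambda>x. c k * tpf \<delta> i (x + - \<tau> k)) x)"
      unfolding tpf_spline_def nat.case add_uminus_conv_diff
      by (rule efilter_sum[of I e]) (use dec that e in auto)
    then show "tpf_spline \<delta> \<tau> I c (Suc (Suc i)) x = efilter (\<delta> (Suc i)) (tpf_spline \<delta> \<tau> I c (Suc i)) x"
      unfolding efilter_shift by (simp add: tpf_spline_def)
  qed
  have "rolle (\<delta> j) (tpf_spline \<delta> \<tau> I c (Suc j)) (tpf_spline \<delta> \<tau> I c j) \<and>
    ((\<forall>t. a < t \<longrightarrow> t < b \<longrightarrow> tpf_spline \<delta> \<tau> I c (Suc j) t = 0) \<longrightarrow> a < t \<longrightarrow> t < b \<longrightarrow>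
      tpf_spline \<delta> \<tau> I c j t = 0)"
  proof (cases j)
    case 0
    then show ?thesis
      using assms rolle_phi[of "\<delta> 0" I \<tau> c] phi_gap[of "\<delta> 0" I \<tau> a b c t] by (auto simp: tpf_spline_def)
  next
    case (Suc i)
    have d: "decays e (tpf_spline \<delta> \<tau> I c (Suc i))" using dec_sum Suc by simp
    \<comment> \<open>Level 1 is built from the jumping kernel, which is continuous from the side
      given by the sign of \<open>\<delta> 0\<close>. The levels above it are continuous.\<close>
    have side: "\<exists>d\<in>{1,-1}. side_cont d (tpf_spline \<delta> \<tau> I c (Suc i))"
    proof -
      have "\<exists>d\<in>{1,-1}. side_cont d (tpf \<delta> i)"
      proof (cases i)
        case 0
        have "\<delta> 0 \<noteq> 0" using assms(1) by simp
        then show ?thesis using 0 phi_side_cont[of "\<delta> 0"] by (intro bexI[of _ "sgn (\<delta> 0)"]) (auto simp: sgn_if)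
      next
        case (Suc l)
        have "continuous_on UNIV (tpf \<delta> i)"
          using Suc \<open>j = Suc i\<close> assms(1) e by (intro tpf_continuous[of _ e]) auto
        then show ?thesis using continuous_imp_side_cont[of "tpf \<delta> i" 1] by auto
      qed
      then obtain d where d: "d \<in> {1, -1}" "side_cont d (tpf \<delta> i)" by blast
      have "side_cont d (\<lambda>x. \<Sum>k\<in>I. c k * tpf \<delta> i (x + - \<tau> k))"
        by (intro side_cont_sum side_cont_shift d)
      then show ?thesis using d(1) by (auto simp: tpf_spline_def)
    qed
    then obtain d where dd: "d \<in> {1, -1}" "side_cont d (tpf_spline \<delta> \<tau> I c (Suc i))" by blast
    show ?thesis
      unfolding Suc step[OF Suc[symmetric]]
      using rolle_efilter[OF _ d, of "\<delta> (Suc i)"] efilter_gap[OF _ d _ dd(2,1), of "\<delta> (Suc i)" a b t] assms(1)[of "Suc i"] e(1) Suc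
      by auto
  qed
  then show "rolle (\<delta> j) (tpf_spline \<delta> \<tau> I c (Suc j)) (tpf_spline \<delta> \<tau> I c j)"
    and "(\<And>t. a < t \<Longrightarrow> t < b \<Longrightarrow> tpf_spline \<delta> \<tau> I c (Suc j) t = 0) \<Longrightarrow> a < t \<Longrightarrow> t < b \<Longrightarrow>
      tpf_spline \<delta> \<tau> I c j t = 0"
    by blast+
qed

text \<open>For the matrix of the algorithm this is linear independence of the columns: a vanishing
  combination of columns is a spline with zeros at all samples.\<close>

lemma tpf_samples_inj:
  fixes i1 i2 k1 k2 :: int and a M x :: real
  assumes nz: "\<And>k. k \<le> n \<Longrightarrow> \<delta> k \<noteq> 0" and aM: "0 < a" "a < M"
    and smp: "\<And>i. i \<in> {i1..i2} \<Longrightarrow> (\<Sum>k\<in>{k1..k2}. c k * tpf \<delta> n (x + a * of_int i - M * of_int k)) = 0"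
    and lo: "x + a * of_int i1 \<le> M * (of_int k1 + real (tp_pos (Suc n) \<delta>) - 1) + a"
    and hi: "x + a * of_int i2 \<ge> M * (of_int k2 - real (tp_neg (Suc n) \<delta>) + 1) - a"
    and num: "k2 - k1 \<le> i2 - i1" and k: "k \<in> {k1..k2}"
  shows "c k = 0"
proof -
  define \<tau> where "\<tau> k = M * of_int k" for k :: int
  define f where "f = tpf_spline \<delta> \<tau> {k1..k2} c"
  have inj: "inj_on \<tau> {k1..k2}" using aM by (auto simp: \<tau>_def inj_on_def)
  have "f 0 (\<tau> k) = 0"
  proof (rule spline_eq_0[where m = "Suc n" and f = f and \<delta> = \<delta>, OF _ _ _ _ _ aM _ lo hi num])
    show "rolle (\<delta> j) (f (Suc j)) (f j)" if "j < Suc n" for j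
      unfolding f_def using nz that inj by (intro tpf_spline_step(1)) auto
    show "f j t = 0" if "j < Suc n" "\<And>t. a < t \<Longrightarrow> t < b \<Longrightarrow> f (Suc j) t = 0" "a < t" "t < b" for j a b t
      using tpf_spline_step(2)[of j \<delta> "{k1..k2}" \<tau> a b c t] nz inj that unfolding f_def by auto
    show "\<exists>k\<in>{k1..k2}. t = M * of_int k" if "f 0 t \<noteq> 0" for t
      using that knots_nonzero[of \<tau> "{k1..k2}" c t] by (auto simp: f_def tpf_spline_def \<tau>_def)
    show "f (Suc n) (x + a * of_int i) = 0" if "i \<in> {i1..i2}" for i
      using smp[OF that] by (simp add: f_def tpf_spline_def \<tau>_def)
  qed (use nz k in auto)
  then show ?thesis
    using knots_at[OF _ inj k, of c] by (simp add: f_def tpf_spline_def)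
qed

section \<open>Linear recurrences in the tails\<close>

text \<open>The normalization \<open>d p = 1\<close> lets the recurrence be solved for the term
  farthest out in the tail, so p consecutive zeros propagate outwards.\<close>

definition tail_rec :: "nat \<Rightarrow> real \<Rightarrow> (real \<Rightarrow> real) \<Rightarrow> bool" where
  "tail_rec p M u \<longleftrightarrow> (\<exists>d::nat \<Rightarrow> real. d p = 1 \<and> (\<forall>t>0. (\<Sum>l\<le>p. d l * u (t + M * real l)) = 0))"

text \<open>Let S be the shift by M. The old operator leaves something that S multiplies by r, so
  composing it with S - r annihilates u; the new coefficients are those of the product
  polynomial.\<close>

lemma tail_rec_Suc:
  assumes "d p = 1" "\<And>t. t > 0 \<Longrightarrow> (\<Sum>l\<le>p. d l * u (t + M + M * real l)) = r * (\<Sum>l\<le>p. d l * u (t + M * real l))"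
  shows "tail_rec (Suc p) M u"
  unfolding tail_rec_def
proof (intro exI conjI allI impI)
  let ?d = "\<lambda>l. (if l = 0 then 0 else d (l - 1)) - r * (if l \<le> p then d l else 0)"
  show "?d (Suc p) = 1" using assms(1) by simp
  fix t :: real assume t: "t > 0"
  have "(\<Sum>l\<le>Suc p. ?d l * u (t + M * real l)) =
      (\<Sum>l\<le>Suc p. (if l = 0 then 0 else d (l - 1)) * u (t + M * real l)) -
      r * (\<Sum>l\<le>Suc p. (if l \<le> p then d l else 0) * u (t + M * real l))"
    by (simp only: left_diff_distrib sum_subtractf sum_distrib_left mult.assoc)
  also have "(\<Sum>l\<le>Suc p. (if l = 0 then 0 else d (l - 1)) * u (t + M * real l)) =
      (\<Sum>l\<le>p. d l * u (t + M + M * real l))"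
    by (subst sum.atMost_Suc_shift) (simp add: algebra_simps)
  also have "(\<Sum>l\<le>Suc p. (if l \<le> p then d l else 0) * u (t + M * real l)) = (\<Sum>l\<le>p. d l * u (t + M * real l))"
    by simp
  finally show "(\<Sum>l\<le>Suc p. ?d l * u (t + M * real l)) = 0"
    using assms(2)[OF t] by simp
qed

text \<open>Beyond the support of w the weighted antiderivative is constant, so the output is a pure
  exponential.\<close>

lemma efilter_tail_pos:
  assumes "\<delta> > 0" "decays c w" "c \<ge> 0" "\<And>t. t > 0 \<Longrightarrow> w t = 0" "t > 0" "M \<ge> 0"
  shows "efilter \<delta> w (t + M) = exp (- M / \<delta>) * efilter \<delta> w t"
proof -
  have "(\<lambda>y. indicator {t<..t + M} y * (exp (y / \<delta>) * w y)) = (\<lambda>y. 0)"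
    using assms(4,5) by (auto simp: indicator_def)
  then have "\<delta> * exp ((t + M) / \<delta>) * efilter \<delta> w (t + M) - \<delta> * exp (t / \<delta>) * efilter \<delta> w t = 0"
    using exp_efilter_diff(2)[OF assms(1-3), of t "t + M"] assms(6) by simp
  then have "exp ((t + M) / \<delta>) * efilter \<delta> w (t + M) = exp (t / \<delta>) * efilter \<delta> w t"
    using assms(1) by simp
  moreover have "exp (t / \<delta>) = exp ((t + M) / \<delta>) * exp (- M / \<delta>)"
    by (simp add: exp_add[symmetric] add_divide_distrib)
  ultimately show ?thesis by simp
qed

text \<open>For negative \<open>\<delta>\<close> the filter only looks ahead, where w
  vanishes.\<close>

lemma efilter_tail_neg:
  assumes "\<delta> < 0" "\<And>t. t > 0 \<Longrightarrow> w t = 0" "t > 0"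
  shows "efilter \<delta> w t = 0"
proof -
  have z: "expk s * w (t - \<delta> * s) = 0" for s
  proof (cases "0 \<le> s")
    case True
    then have "\<delta> * s \<le> 0" using assms by (intro mult_nonpos_nonneg) auto
    then have "0 < t - \<delta> * s" using assms by linarith
    then show ?thesis using assms(2) by simp
  qed (simp add: expk_def)
  show ?thesis unfolding efilter_def z by simp
qed

text \<open>The recurrence operator commutes with the filter. Applied to the previous function it
  gives w, which is zero for t > 0. Filtering w leaves a pure exponential if the new parameter is
  positive, removed by one more factor, and zero if it is negative; hence the order counts positive
  parameters.\<close>

lemma tpf_tail_rec:
  assumes "\<And>k. k \<le> j \<Longrightarrow> \<delta> k \<noteq> 0" "M \<ge> 0"
  shows "tail_rec (tp_pos (Suc j) \<delta>) M (tpf \<delta> j)"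
  using assms(1)
proof (induction j)
  case 0
  show ?case
  proof (cases "\<delta> 0 > 0")
    case True
    have "tail_rec (Suc 0) M (phi (\<delta> 0))"
    proof (rule tail_rec_Suc[where d = "\<lambda>_. 1" and r = "exp (- M / \<delta> 0)"])
      fix t :: real assume "t > 0"
      moreover have "- ((t + M) / \<delta> 0) = - M / \<delta> 0 + - (t / \<delta> 0)" by (simp add: add_divide_distrib)
      ultimately show "(\<Sum>l\<le>0. 1 * phi (\<delta> 0) (t + M + M * real l)) = exp (- M / \<delta> 0) * (\<Sum>l\<le>0. 1 * phi (\<delta> 0) (t + M * real l))"
        using True assms(2) by (simp add: phi_def expk_def flip: exp_add)
    qed simp
    then show ?thesis using True by (simp add: tp_pos_Suc)
  next
    case False
    then have "\<delta> 0 < 0" using 0 by (meson le0 not_less_iff_gr_or_eq)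
    then have "phi (\<delta> 0) t = 0" if "t > 0" for t
      using that by (simp add: phi_def expk_def divide_nonneg_neg not_le zero_le_divide_iff)
    then show ?thesis using False by (auto simp: tail_rec_def tp_pos_Suc intro!: exI[of _ "\<lambda>_. 1"])
  qed
next
  case (Suc j)
  let ?p = "tp_pos (Suc j) \<delta>"
  obtain d where d: "d ?p = 1" "\<And>t. t > 0 \<Longrightarrow> (\<Sum>l\<le>?p. d l * tpf \<delta> j (t + M * real l)) = 0"
    using Suc by (auto simp: tail_rec_def)
  obtain e where e: "e > 0" "\<And>k. k < Suc j \<Longrightarrow> e * \<bar>\<delta> k\<bar> < 1" using ex_decay_rate by blast
  define w where "w t = (\<Sum>l\<le>?p. d l * tpf \<delta> j (t + M * real l))" for t
  have dec: "decays e (\<lambda>t. d l * tpf \<delta> j (t + M * real l))" for l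
    using e Suc.prems by (intro decays_shift tpf_decays) auto
  have dw: "decays e w"
    unfolding w_def by (intro decays_sum dec) auto
  have w0: "w t = 0" if "t > 0" for t using d(2) that by (simp add: w_def)
  have ew: "efilter (\<delta> (Suc j)) w t = (\<Sum>l\<le>?p. d l * tpf \<delta> (Suc j) (t + M * real l))" for t
  proof -
    have "efilter (\<delta> (Suc j)) w t = (\<Sum>l\<le>?p. efilter (\<delta> (Suc j)) (\<lambda>t. d l * tpf \<delta> j (t + M * real l)) t)"
      unfolding w_def by (rule efilter_sum[of _ e]) (use dec e in auto)
    then show ?thesis by (simp add: efilter_shift)
  qed
  show ?case
  proof (cases "\<delta> (Suc j) > 0")
    case True
    have "tail_rec (Suc ?p) M (tpf \<delta> (Suc j))"
    proof (rule tail_rec_Suc[where d = d, OF d(1)])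
      fix t :: real assume "t > 0"
      then show "(\<Sum>l\<le>?p. d l * tpf \<delta> (Suc j) (t + M + M * real l)) =
          exp (- M / \<delta> (Suc j)) * (\<Sum>l\<le>?p. d l * tpf \<delta> (Suc j) (t + M * real l))"
        using efilter_tail_pos[OF True dw _ w0] e(1) assms(2) unfolding ew by simp
    qed
    then show ?thesis using True by (simp add: tp_pos_Suc)
  next
    case False
    then have "\<delta> (Suc j) < 0" using Suc.prems[of "Suc j"] by auto
    then have "(\<Sum>l\<le>?p. d l * tpf \<delta> (Suc j) (t + M * real l)) = 0" if "t > 0" for t
      using efilter_tail_neg[of _ w, OF _ w0] that unfolding ew[symmetric] by blast
    then show ?thesis using d(1) False by (auto simp: tail_rec_def tp_pos_Suc intro!: exI[of _ d])
  qed
qed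

text \<open>The recurrence at t = y i - M (k + p) expresses the term of k by those of k + 1, ..., k
  + p. For k < s this t is positive because every sample lies beyond M (s + p - 1); that is what the
  lower bound on the samples is for.\<close>

lemma tail_rec_vanish:
  fixes s k :: int
  assumes "tail_rec p M u" "finite I"
    and y: "\<And>i. i \<in> I \<Longrightarrow> M * (of_int s + real p - 1) < y i" and "M \<ge> 0"
    and z: "\<And>k. s \<le> k \<Longrightarrow> k < s + int p \<Longrightarrow> (\<Sum>i\<in>I. q i * u (y i - M * of_int k)) = 0"
    and k: "k < s + int p"
  shows "(\<Sum>i\<in>I. q i * u (y i - M * of_int k)) = 0"
proof -
  define v where "v k = (\<Sum>i\<in>I. q i * u (y i - M * of_int k))" for k :: int
  obtain d where d: "d p = 1" "\<And>t. t > 0 \<Longrightarrow> (\<Sum>l\<le>p. d l * u (t + M * real l)) = 0"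
    using assms(1) by (auto simp: tail_rec_def)
  have "v k = 0" if "k < s + int p" for k
    using that
  proof (induction "nat (s + int p - k)" arbitrary: k rule: less_induct)
    case less
    show ?case
    proof (cases "s \<le> k")
      case True
      then show ?thesis using z less.prems by (simp add: v_def)
    next
      case False
      have IH: "v (k + int p - int l) = 0" if "l < p" for l
        using that False less.prems by (intro less.hyps) auto
      have t: "0 < y i - M * of_int (k + int p)" if "i \<in> I" for i
      proof -
        have "(of_int (k + int p) :: real) \<le> of_int s + real p - 1" using False by linarith
        then have "M * of_int (k + int p) \<le> M * (of_int s + real p - 1)"
          using \<open>M \<ge> 0\<close> by (rule mult_left_mono)
        then show ?thesis using y[OF that] by linarith
      qed
      have "0 = (\<Sum>i\<in>I. q i * (\<Sum>l\<le>p. d l * u (y i - M * of_int (k + int p) + M * real l)))"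
        using d(2) t by simp
      also have "\<dots> = (\<Sum>i\<in>I. \<Sum>l\<le>p. d l * (q i * u (y i - M * of_int (k + int p - int l))))"
        unfolding sum_distrib_left by (intro sum.cong refl) (simp add: algebra_simps)
      also have "\<dots> = (\<Sum>l\<le>p. d l * v (k + int p - int l))"
        unfolding v_def sum_distrib_left by (rule sum.swap)
      also have "\<dots> = (\<Sum>l\<le>p. if l = p then v k else 0)"
        using IH d(1) by (intro sum.cong refl) auto
      finally show ?thesis by simp
    qed
  qed
  then show ?thesis using k by (simp add: v_def)
qed

text \<open>The first p columns of the range avoid k = 0, so they give p consecutive zeros, from
  which the recurrence reaches all smaller k. Large k follow by reflection, which exchanges p and
  q.\<close>

lemma tpf_biorthogonal:
  fixes i1 i2 k1 k2 k :: int
  assumes nz: "\<And>k. k \<le> n \<Longrightarrow> \<delta> k \<noteq> 0" and M: "M \<ge> 0" and a: "a > 0"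
    and bi: "\<And>k. k \<in> {k1..k2} \<Longrightarrow> (\<Sum>i\<in>{i1..i2}. q i * tpf \<delta> n (x + a * of_int i - M * of_int k)) = e * of_bool (k = 0)"
    and lo: "M * (of_int k1 + real (tp_pos (Suc n) \<delta>) - 1) < x + a * of_int i1"
    and hi: "x + a * of_int i2 < M * (of_int k2 - real (tp_neg (Suc n) \<delta>) + 1)"
    and k12: "k1 + int (tp_pos (Suc n) \<delta>) \<le> 0" "0 \<le> k2 - int (tp_neg (Suc n) \<delta>)"
  shows "(\<Sum>i\<in>{i1..i2}. q i * tpf \<delta> n (x + a * of_int i - M * of_int k)) = e * of_bool (k = 0)"
proof -
  let ?v = "\<lambda>k. \<Sum>i\<in>{i1..i2}. q i * tpf \<delta> n (x + a * of_int i - M * of_int k)"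
  have mono: "a * of_int i \<le> a * of_int j" if "i \<le> j" for i j :: int
    using that a by simp
  consider "k < k1" | "k \<in> {k1..k2}" | "k2 < k" by force
  then show ?thesis
  proof cases
    case 1
    have "?v k = 0"
    proof (rule tail_rec_vanish[OF tpf_tail_rec[OF nz M], where s = k1])
      show "M * (of_int k1 + real (tp_pos (Suc n) \<delta>) - 1) < x + a * of_int i" if "i \<in> {i1..i2}" for i
        using mono[of i1 i] that lo by auto
      show "?v k = 0" if "k1 \<le> k" "k < k1 + int (tp_pos (Suc n) \<delta>)" for k
        using bi[of k] that k12 by auto
    qed (use M 1 in auto)
    then show ?thesis using 1 k12 by auto
  next
    case 3
    have neg: "tp_pos (Suc n) (\<lambda>k. - \<delta> k) = tp_neg (Suc n) \<delta>"
      by (simp add: tp_pos_def tp_neg_def)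
    have eq: "(\<Sum>i\<in>{i1..i2}. q i * tpf (\<lambda>k. - \<delta> k) n (- (x + a * of_int i) - M * of_int k)) = ?v (- k)" for k
      by (simp add: tpf_reflect algebra_simps)
    have "(\<Sum>i\<in>{i1..i2}. q i * tpf (\<lambda>k. - \<delta> k) n (- (x + a * of_int i) - M * of_int (- k))) = 0"
    proof (rule tail_rec_vanish[OF tpf_tail_rec, where s = "- k2"])
      show "M * (of_int (- k2) + real (tp_pos (Suc n) (\<lambda>k. - \<delta> k)) - 1) < - (x + a * of_int i)"
        if "i \<in> {i1..i2}" for i
        using mono[of i i2] that hi unfolding neg by (auto simp: algebra_simps)
      show "(\<Sum>i\<in>{i1..i2}. q i * tpf (\<lambda>k. - \<delta> k) n (- (x + a * of_int i) - M * of_int k)) = 0"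
        if "- k2 \<le> k" "k < - k2 + int (tp_pos (Suc n) (\<lambda>k. - \<delta> k))" for k
        unfolding eq using bi[of "- k"] that k12 unfolding neg by auto
    qed (use M nz 3 in auto)
    then show ?thesis unfolding eq using 3 k12 by auto
  qed (rule bi)
qed

section \<open>Moore--Penrose inverse of a matrix of full column rank\<close>

text \<open>Injectivity makes the Gram matrix invertible, and its inverse times the transpose of A
  solves the Penrose equations. Uniqueness is proved too, as \<open>pinv\<close> is a definite
  description.\<close>

lemma pinv_left_inverse:
  fixes A :: "real mat"
  assumes A: "A \<in> carrier_mat nr nc"
    and inj: "\<And>v. v \<in> carrier_vec nc \<Longrightarrow> A *\<^sub>v v = 0\<^sub>v nr \<Longrightarrow> v = 0\<^sub>v nc"
  shows "pinv A \<in> carrier_mat nc nr" "pinv A * A = 1\<^sub>m nc"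
proof -
  define T where "T = transpose_mat A"
  have T: "T \<in> carrier_mat nc nr" using A by (simp add: T_def)
  define B where "B = T * A"
  have B: "B \<in> carrier_mat nc nc" using T A by (simp add: B_def)
  have "det B \<noteq> 0"
  proof
    assume "det B = 0"
    then obtain v where v: "v \<in> carrier_vec nc" "v \<noteq> 0\<^sub>v nc" "B *\<^sub>v v = 0\<^sub>v nc"
      using det_0_iff_vec_prod_zero[OF B] by auto
    have Av: "A *\<^sub>v v \<in> carrier_vec nr" using A v by simp
    have "T *\<^sub>v (A *\<^sub>v v) = 0\<^sub>v nc"
      using v T A unfolding B_def by simp
    then have "scalar_prod (A *\<^sub>v v) (A *\<^sub>v v) = 0"
      using transpose_vec_mult_scalar[OF A v(1) Av] v(1) by (simp add: T_def)
    then have "(\<Sum>i\<in>{0..<nr}. (vec_index (A *\<^sub>v v) i)\<^sup>2) = 0"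
      using Av A by (simp add: scalar_prod_def power2_eq_square del: index_mult_mat_vec)
    then have "\<forall>i\<in>{0..<nr}. vec_index (A *\<^sub>v v) i = 0"
      by (subst (asm) sum_nonneg_eq_0_iff) auto
    then have "A *\<^sub>v v = 0\<^sub>v nr"
      using Av A by (intro eq_vecI) auto
    then show False using inj v by blast
  qed
  from det_non_zero_imp_unit[OF B this, unfolded Units_def, of "()"]
  obtain C where C: "C \<in> carrier_mat nc nc" and CB: "C * B = 1\<^sub>m nc" and BC: "B * C = 1\<^sub>m nc"
    by (auto simp: ring_mat_def)
  have BT: "transpose_mat B = B"
    unfolding B_def using transpose_mult[OF T A] by (simp add: T_def)
  have CT: "transpose_mat C = C"
  proof -
    have "transpose_mat C * B = 1\<^sub>m nc"
      using transpose_mult[OF B C] BC BT by simp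
    have "transpose_mat C = transpose_mat C * (B * C)"
      using BC C by simp
    also have "\<dots> = (transpose_mat C * B) * C"
      using B C by (intro assoc_mult_mat[symmetric]) auto
    finally show ?thesis using \<open>transpose_mat C * B = 1\<^sub>m nc\<close> C by simp
  qed
  define X where "X = C * T"
  have X: "X \<in> carrier_mat nc nr" using C T by (simp add: X_def)
  have XA: "X * A = 1\<^sub>m nc"
    unfolding X_def using assoc_mult_mat[OF C T A] CB by (simp add: B_def)
  have AX: "transpose_mat (A * X) = A * X"
  proof -
    have "transpose_mat (A * X) = transpose_mat X * T"
      using transpose_mult[OF A X] by (simp add: T_def)
    also have "transpose_mat X = A * C"
      unfolding X_def using transpose_mult[OF C T] CT by (simp add: T_def)
    also have "(A * C) * T = A * X"
      unfolding X_def by (rule assoc_mult_mat[OF A C T])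
    finally show ?thesis .
  qed
  have AXA: "A * X * A = A"
    using assoc_mult_mat[OF A X A] XA A by simp
  have pX: "pinv A = X"
    unfolding pinv_def
  proof (rule the_equality)
    show "X \<in> carrier_mat (dim_col A) (dim_row A) \<and> A * X * A = A \<and> X * A * X = X \<and>
      transpose_mat (A * X) = A * X \<and> transpose_mat (X * A) = X * A"
      using X A XA AX AXA by simp
    fix Y
    assume Y: "Y \<in> carrier_mat (dim_col A) (dim_row A) \<and> A * Y * A = A \<and> Y * A * Y = Y \<and>
      transpose_mat (A * Y) = A * Y \<and> transpose_mat (Y * A) = Y * A"
    then have Yc: "Y \<in> carrier_mat nc nr" using A by simp
    \<comment> \<open>Symmetry of A Y gives T A Y = transpose (A Y A) = T, and cancelling the Gram
      matrix T A determines Y.\<close>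
    have "T * (A * Y) = T * transpose_mat (A * Y)" using Y by simp
    also have "\<dots> = transpose_mat (A * Y * A)"
      using transpose_mult[of "A * Y" nr nr A nc] A Yc by (simp add: T_def)
    also have "\<dots> = T" using Y by (simp add: T_def)
    finally have "B * Y = T"
      unfolding B_def using assoc_mult_mat[OF T A Yc] by simp
    then have "X = C * (B * Y)" by (simp add: X_def)
    also have "\<dots> = (C * B) * Y" using assoc_mult_mat[OF C B Yc] by simp
    finally show "Y = X" using CB Yc by simp
  qed
  show "pinv A \<in> carrier_mat nc nr" "pinv A * A = 1\<^sub>m nc"
    using pX X XA by simp_all
qed

section \<open>Finite Gabor systems\<close>

lemma cmod_cinner_le: "(cmod (cinner K f e))\<^sup>2 \<le> cnorm2 K f * cnorm2 K e"
proof -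
  have "cmod (cinner K f e) \<le> (\<Sum>n\<in>{0..<int K}. cmod (f n) * cmod (e n))"
    unfolding cinner_def by (rule sum_norm_le) (simp add: norm_mult)
  then have "(cmod (cinner K f e))\<^sup>2 \<le> (\<Sum>n\<in>{0..<int K}. cmod (f n) * cmod (e n))\<^sup>2"
    by (rule power_mono) simp
  also have "\<dots> \<le> cnorm2 K f * cnorm2 K e"
    unfolding cnorm2_def by (rule Cauchy_Schwarz_ineq_sum)
  finally show ?thesis .
qed

lemma cnorm2_nonneg: "0 \<le> cnorm2 K f"
  by (simp add: cnorm2_def sum_nonneg)

lemma bessel_bound:
  assumes "finite I"
  shows "\<exists>B>0. \<forall>f. (\<Sum>i\<in>I. (cmod (cinner K f (e i)))\<^sup>2) \<le> B * cnorm2 K f"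
proof (intro exI[of _ "1 + (\<Sum>i\<in>I. cnorm2 K (e i))"] conjI allI)
  show "0 < 1 + (\<Sum>i\<in>I. cnorm2 K (e i))"
    using sum_nonneg[of I "\<lambda>i. cnorm2 K (e i)"] cnorm2_nonneg by (smt (verit))
  fix f
  have "(\<Sum>i\<in>I. (cmod (cinner K f (e i)))\<^sup>2) \<le> (\<Sum>i\<in>I. cnorm2 K f * cnorm2 K (e i))"
    by (rule sum_mono) (rule cmod_cinner_le)
  also have "\<dots> \<le> (1 + (\<Sum>i\<in>I. cnorm2 K (e i))) * cnorm2 K f"
    using cnorm2_nonneg[of K f] by (simp add: sum_distrib_left[symmetric] algebra_simps)
  finally show "(\<Sum>i\<in>I. (cmod (cinner K f (e i)))\<^sup>2) \<le> (1 + (\<Sum>i\<in>I. cnorm2 K (e i))) * cnorm2 K f" .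
qed

text \<open>The expansion gives \<open>\<parallel>f\<parallel>\<^sup>2 = (\<Sum>i. \<langle>f, e i\<rangle> * cnj \<langle>f, h i\<rangle>)\<close>; by Cauchy--Schwarz an upper frame bound for
  one family is the inverse of a lower bound for the other.\<close>

lemma dframe_dual:
  assumes I: "finite I"
    and ex: "\<And>f n. n \<in> {0..<int K} \<Longrightarrow> f n = (\<Sum>i\<in>I. cinner K f (e i) * h i n)"
  shows "dframe K I e \<and> dframe K I h"
proof -
  let ?S = "\<lambda>e f. \<Sum>i\<in>I. (cmod (cinner K f (e i)))\<^sup>2"
  have S0: "0 \<le> ?S e f" for e :: "'a \<Rightarrow> int \<Rightarrow> complex" and f by (rule sum_nonneg) simp
  have key: "(cnorm2 K f)\<^sup>2 \<le> ?S e f * ?S h f" for f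
  proof -
    have "complex_of_real (cnorm2 K f) = (\<Sum>n\<in>{0..<int K}. f n * cnj (f n))"
      unfolding cnorm2_def of_real_sum by (intro sum.cong refl) (rule complex_norm_square)
    also have "\<dots> = (\<Sum>n\<in>{0..<int K}. \<Sum>i\<in>I. cinner K f (e i) * h i n * cnj (f n))"
      unfolding sum_distrib_right[symmetric] by (intro sum.cong refl) (simp add: ex[symmetric])
    also have "\<dots> = (\<Sum>i\<in>I. \<Sum>n\<in>{0..<int K}. cinner K f (e i) * h i n * cnj (f n))"
      by (rule sum.swap)
    also have "\<dots> = (\<Sum>i\<in>I. cinner K f (e i) * cnj (cinner K f (h i)))"
      by (intro sum.cong refl) (simp add: cinner_def[of K f "h _"] sum_distrib_left mult_ac)
    finally have "cmod (complex_of_real (cnorm2 K f)) \<le> (\<Sum>i\<in>I. cmod (cinner K f (e i)) * cmod (cinner K f (h i)))"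
      by (simp only:) (rule sum_norm_le, simp add: norm_mult)
    then have "(cnorm2 K f)\<^sup>2 \<le> (\<Sum>i\<in>I. cmod (cinner K f (e i)) * cmod (cinner K f (h i)))\<^sup>2"
      using cnorm2_nonneg[of K f] by (intro power_mono) simp_all
    also have "\<dots> \<le> ?S e f * ?S h f" by (rule Cauchy_Schwarz_ineq_sum)
    finally show ?thesis .
  qed
  have frame: "dframe K I e" if key: "\<And>f. (cnorm2 K f)\<^sup>2 \<le> ?S e f * ?S h f" for e h :: "'a \<Rightarrow> int \<Rightarrow> complex"
  proof -
    obtain Be where Be: "Be > 0" "\<And>f. ?S e f \<le> Be * cnorm2 K f" using bessel_bound[OF I] by metis
    obtain Bh where Bh: "Bh > 0" "\<And>f. ?S h f \<le> Bh * cnorm2 K f" using bessel_bound[OF I] by metis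
    have "(1 / Bh) * cnorm2 K f \<le> ?S e f" for f
    proof (cases "cnorm2 K f = 0")
      case False
      then have N: "0 < cnorm2 K f" using cnorm2_nonneg[of K f] by simp
      have "cnorm2 K f * cnorm2 K f \<le> ?S e f * (Bh * cnorm2 K f)"
        using order_trans[OF key[of f] mult_left_mono[OF Bh(2)[of f] S0]] by (simp add: power2_eq_square)
      then have "cnorm2 K f \<le> ?S e f * Bh" using N by (simp add: mult.assoc[symmetric])
      then show ?thesis using Bh(1) by (simp add: divide_le_eq)
    qed (use S0 in simp)
    then show ?thesis
      unfolding dframe_def using I Be Bh by (intro conjI exI[of _ "1 / Bh"] exI[of _ Be]) auto
  qed
  have "(cnorm2 K f)\<^sup>2 \<le> ?S h f * ?S e f" for f using key[of f] by (simp add: mult.commute)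
  then show ?thesis using frame[of e h] frame[of h e] key by blast
qed

lemma sum_cis_roots:
  assumes "M > 0"
  shows "(\<Sum>l<M. cis (2 * pi * (real l / real M) * of_int d)) = (if int M dvd d then of_nat M else 0)"
proof -
  define z where "z = cis (2 * pi * of_int d / real M)"
  have pw: "cis (2 * pi * (real l / real M) * of_int d) = z ^ l" for l
    unfolding z_def Complex.DeMoivre by (rule arg_cong[of _ _ cis]) simp
  show ?thesis
  proof (cases "int M dvd d")
    case True
    then obtain k where k: "d = int M * k" by blast
    have "2 * pi * of_int d / real M = 2 * pi * of_int k" using assms by (simp add: k)
    then have "z = 1" by (simp only: z_def) (rule cis_multiple_2pi, simp)
    then show ?thesis using True unfolding pw by simp
  next
    case False
    have "z \<noteq> 1"
    proof
      assume "z = 1"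
      then have "cos (2 * pi * of_int d / real M) = 1" by (simp add: z_def complex_eq_iff)
      then obtain k :: int where "2 * pi * of_int d / real M = of_int k * (2 * pi)"
        using cos_one_2pi_int by (metis mult.assoc)
      then have "real_of_int d = of_int k * real M" using assms by (simp add: field_simps)
      then have "d = k * int M" by (metis of_int_eq_iff of_int_mult of_int_of_nat_eq)
      then show False using False by simp
    qed
    moreover have "z ^ M = 1"
    proof -
      have "z ^ M = cis (2 * pi * of_int d)" using assms unfolding z_def Complex.DeMoivre by simp
      then show ?thesis by (simp add: cis_multiple_2pi)
    qed
    ultimately show ?thesis using False unfolding pw by (simp add: geometric_sum)
  qed
qed

lemma periodic_mod:
  fixes \<phi> :: "int \<Rightarrow> 'b" and K :: nat
  assumes "\<And>n. \<phi> (n + int K) = \<phi> n"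
  shows "\<phi> (n + j * int K) = \<phi> n" and "\<phi> (n mod int K) = \<phi> n"
proof -
  have *: "\<phi> (n + int i * int K) = \<phi> n" for n i
  proof (induction i)
    case (Suc i)
    then show ?case using assms[of "n + int i * int K"] by (simp add: algebra_simps)
  qed simp
  show **: "\<phi> (n + j * int K) = \<phi> n" for n j
  proof (cases "j \<ge> 0")
    case True
    then show ?thesis using *[of n "nat j"] by simp
  next
    case False
    then show ?thesis using *[of "n + j * int K" "nat (- j)"] by simp
  qed
  show "\<phi> (n mod int K) = \<phi> n"
    using **[of "n mod int K" "n div int K"] by simp
qed

text \<open>The sum over modulations kills all n' with n - n' not divisible by M, which leaves the
  hypothesis \<open>dual\<close>. Within one period K divides n - n' only for n' = n, so a single
  term survives.\<close>

lemma dgabor_dual: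
  assumes pos: "K > 0" "M > 0"
    and per: "\<And>n. \<phi> (n + int K) = \<phi> n" "\<And>n. \<psi> (n + int K) = \<psi> n"
    and dual: "\<And>n d. int M dvd d \<Longrightarrow>
      (\<Sum>k<K div a. cnj (\<phi> (n - d - int k * int a)) * \<psi> (n - int k * int a)) = (if int K dvd d then 1 / of_nat M else 0)"
    and n: "n \<in> {0..<int K}"
  shows "f n = (\<Sum>kl\<in>dgabor_index K a M. cinner K f (dgabor K a M \<phi> kl) * dgabor K a M \<psi> kl n)"
proof -
  let ?c = "\<lambda>l d. cis (2 * pi * (real l / real M) * of_int d)"
  let ?D = "\<lambda>n'. \<Sum>k<K div a. cnj (\<phi> (n' - int k * int a)) * \<psi> (n - int k * int a)"
  have "(\<Sum>kl\<in>dgabor_index K a M. cinner K f (dgabor K a M \<phi> kl) * dgabor K a M \<psi> kl n) =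
      (\<Sum>k<K div a. \<Sum>l<M. \<Sum>n'\<in>{0..<int K}. f n' * (?c l (n - n') * (cnj (\<phi> (n' - int k * int a)) * \<psi> (n - int k * int a))))"
    unfolding dgabor_index_def atLeast0LessThan sum.cartesian_product'
  proof (intro sum.cong refl)
    fix k l
    have "?c l (n - n') = ?c l n * cnj (?c l n')" for n'
      by (simp add: cis_cnj cis_mult ring_distribs)
    then show "cinner K f (dgabor K a M \<phi> (k, l)) * dgabor K a M \<psi> (k, l) n =
      (\<Sum>n'\<in>{0..<int K}. f n' * (?c l (n - n') * (cnj (\<phi> (n' - int k * int a)) * \<psi> (n - int k * int a))))"
      by (simp add: cinner_def dgabor_def dMT_def periodic_mod(2)[of \<phi>, OF per(1)] periodic_mod(2)[of \<psi>, OF per(2)]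
          sum_distrib_left sum_distrib_right mult_ac)
  qed
  also have "\<dots> = (\<Sum>n'\<in>{0..<int K}. \<Sum>k<K div a. \<Sum>l<M. f n' * (?c l (n - n') * (cnj (\<phi> (n' - int k * int a)) * \<psi> (n - int k * int a))))"
    by (subst (2) sum.swap, subst sum.swap) (rule refl)
  also have "\<dots> = (\<Sum>n'\<in>{0..<int K}. f n' * ((\<Sum>l<M. ?c l (n - n')) * ?D n'))"
    by (intro sum.cong refl) (simp add: sum_distrib_left sum_distrib_right sum.swap[of _ "{..<M}"])
  also have "\<dots> = (\<Sum>n'\<in>{0..<int K}. if n' = n then f n else 0)"
  proof (intro sum.cong refl)
    fix n' assume n': "n' \<in> {0..<int K}"
    have "int K dvd n - n' \<longleftrightarrow> n' = n"
    proof
      assume "int K dvd n - n'"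
      then have "n mod int K = n' mod int K" by (simp add: mod_eq_dvd_iff)
      then show "n' = n" using n n' by simp
    qed simp
    moreover have "int M dvd n - n' \<Longrightarrow> ?D n' = (if int K dvd n - n' then 1 / of_nat M else 0)"
      using dual[of "n - n'" n] by simp
    ultimately show "f n' * ((\<Sum>l<M. ?c l (n - n')) * ?D n') = (if n' = n then f n else 0)"
      unfolding sum_cis_roots[OF pos(2)] using pos by auto
  qed
  also have "\<dots> = f n" using n by simp
  finally show ?thesis by simp
qed

section \<open>Periodization of the biorthogonality relations\<close>

lemma has_sum_finite_sum:
  fixes f :: "'i \<Rightarrow> 'a \<Rightarrow> 'b::topological_comm_monoid_add"
  assumes "finite F" "\<And>i. (f i has_sum s i) A"
  shows "((\<lambda>x. \<Sum>i\<in>F. f i x) has_sum (\<Sum>i\<in>F. s i)) A"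
  using assms(1) by (induction F rule: finite_induct) (simp_all add: has_sum_add assms(2))

lemma PKS_periodic: "PKS K g (n + int K) = PKS K g n"
proof -
  have "(\<Sum>\<^sub>\<infinity>k::int. g (of_int (n - k * int K))) = (\<Sum>\<^sub>\<infinity>k::int. g (of_int (n - (k - 1) * int K)))"
    by (rule infsum_reindex_bij_betw[symmetric])
       (auto intro!: bij_betwI[where g = "\<lambda>k. k + 1"])
  then show ?thesis by (simp add: PKS_def algebra_simps)
qed

text \<open>The translation k a and the period t K merge into one index i = k + t N with N = K / a,
  and the periodized g does not see t. Unfolding its own period sum turns the exponent into e + s R
  with e = d / M and R = K / M; \<open>bi\<close> leaves the one s with e + s R = 0, which exists
  exactly if K divides d.\<close>

lemma PKS_dual_sum:
  fixes g \<gamma> :: "real \<Rightarrow> real" and a K M :: nat and n d :: int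
  assumes pos: "a > 0" "K > 0" "M > 0" and dvd: "a dvd K" "M dvd K" and d: "int M dvd d"
    and summ: "\<And>n. (\<lambda>k::int. g (of_int (n - k * int K))) summable_on UNIV"
    and fin: "\<And>n. finite {i::int. \<gamma> (of_int (n - i * int a)) \<noteq> 0}"
    and bi: "\<And>n k. (\<Sum>i | \<gamma> (of_int (n - i * int a)) \<noteq> 0.
        \<gamma> (of_int (n - i * int a)) * g (of_int (n - i * int a - k * int M))) = (if k = 0 then 1 / real M else 0)"
  shows "(\<Sum>k<K div a. cnj (PKS K g (n - d - int k * int a)) * PKS K \<gamma> (n - int k * int a)) = (if int K dvd d then 1 / of_nat M else 0)"
proof -
  define N where "N = K div a"
  have KN: "K = N * a" "N > 0" using dvd pos by (auto simp: N_def)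
  obtain e where e: "d = int M * e" using d by blast
  obtain R where R: "K = M * R" using dvd by blast
  define G where "G n = (\<Sum>\<^sub>\<infinity>k::int. g (of_int (n - k * int K)))" for n
  define F where "F = {i::int. \<gamma> (of_int (n - i * int a)) \<noteq> 0}"
  have finF: "finite F" unfolding F_def by (rule fin)
  have Gper: "G (n - t * int K) = G n" for n t
  proof -
    have "G (n + int K) = G n" for n using PKS_periodic[of K g n] by (simp add: PKS_def G_def)
    from periodic_mod(1)[of G, OF this, of n "- t"] show ?thesis by simp
  qed
  have "(\<Sum>k<N. G (n - d - int k * int a) * (\<Sum>\<^sub>\<infinity>t::int. \<gamma> (of_int (n - int k * int a - t * int K)))) =
     (\<Sum>k<N. \<Sum>i | i \<in> F \<and> i mod int N = int k. \<gamma> (of_int (n - i * int a)) * G (n - d - i * int a))"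
  proof (intro sum.cong refl)
    fix k assume k: "k \<in> {..<N}"
    let ?A = "{i. i \<in> F \<and> i mod int N = int k}"
    have bij: "bij_betw (\<lambda>t. int k + t * int N) UNIV {i. i mod int N = int k}"
    proof (rule bij_betwI[where g = "\<lambda>i. i div int N"])
      fix i assume "i \<in> {i. i mod int N = int k}"
      then show "int k + i div int N * int N = i"
        using div_mult_mod_eq[of i "int N"] by simp
    qed (use k in auto)
    have arg: "n - int k * int a - t * int K = n - (int k + t * int N) * int a" for t
      by (simp add: KN algebra_simps)
    have "(\<Sum>\<^sub>\<infinity>t::int. \<gamma> (of_int (n - int k * int a - t * int K))) =
        (\<Sum>\<^sub>\<infinity>i\<in>{i. i mod int N = int k}. \<gamma> (of_int (n - i * int a)))"
      unfolding arg by (rule infsum_reindex_bij_betw[OF bij])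
    also have "\<dots> = (\<Sum>\<^sub>\<infinity>i\<in>?A. \<gamma> (of_int (n - i * int a)))"
      by (rule infsum_cong_neutral) (auto simp: F_def)
    also have "\<dots> = (\<Sum>i\<in>?A. \<gamma> (of_int (n - i * int a)))"
      using finF by (intro infsum_finite) auto
    finally have "G (n - d - int k * int a) * (\<Sum>\<^sub>\<infinity>t::int. \<gamma> (of_int (n - int k * int a - t * int K))) =
        (\<Sum>i\<in>?A. \<gamma> (of_int (n - i * int a)) * G (n - d - int k * int a))"
      by (simp add: sum_distrib_left mult.commute)
    also have "\<dots> = (\<Sum>i\<in>?A. \<gamma> (of_int (n - i * int a)) * G (n - d - i * int a))"
    proof (intro sum.cong refl)
      fix i assume i: "i \<in> ?A"
      have "i = int k + (i div int N) * int N" using i by (metis (mono_tags) div_mult_mod_eq add.commute mem_Collect_eq)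
      then have "n - d - i * int a = (n - d - int k * int a) - (i div int N) * int K"
        unfolding KN(1) of_nat_mult by (metis (no_types, opaque_lifting) add_diff_eq diff_diff_eq distrib_right mult.assoc)
      then show "\<gamma> (of_int (n - i * int a)) * G (n - d - int k * int a) = \<gamma> (of_int (n - i * int a)) * G (n - d - i * int a)"
        by (simp only: Gper)
    qed
    finally show "G (n - d - int k * int a) * (\<Sum>\<^sub>\<infinity>t::int. \<gamma> (of_int (n - int k * int a - t * int K))) =
        (\<Sum>i\<in>?A. \<gamma> (of_int (n - i * int a)) * G (n - d - i * int a))" .
  qed
  also have "\<dots> = (\<Sum>i\<in>F. \<gamma> (of_int (n - i * int a)) * G (n - d - i * int a))"
  proof -
    have UF: "F = (\<Union>k\<in>{..<N}. {i. i \<in> F \<and> i mod int N = int k})"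
      using KN(2) by (auto intro!: bexI[of _ "nat (_ mod int N)"] simp: nat_less_iff)
    then show ?thesis
      using finF by (subst (2) UF, subst sum.UNION_disjoint) auto
  qed
  also have "\<dots> = (\<Sum>i\<in>F. \<Sum>\<^sub>\<infinity>s::int. \<gamma> (of_int (n - i * int a)) * g (of_int (n - d - i * int a - s * int K)))"
    unfolding G_def by (simp add: infsum_cmult_right' )
  \<comment> \<open>The sum over \<open>F\<close> is finite, so it may be exchanged with the
    infinite sum.\<close>
  also have "\<dots> = (\<Sum>\<^sub>\<infinity>s::int. \<Sum>i\<in>F. \<gamma> (of_int (n - i * int a)) * g (of_int (n - d - i * int a - s * int K)))"
  proof -
    have "((\<lambda>s::int. \<gamma> (of_int (n - i * int a)) * g (of_int (n - d - i * int a - s * int K))) has_sum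
        (\<Sum>\<^sub>\<infinity>s::int. \<gamma> (of_int (n - i * int a)) * g (of_int (n - d - i * int a - s * int K)))) UNIV" for i
      by (intro has_sum_infsum summable_on_cmult_right summ)
    from has_sum_finite_sum[OF finF this] show ?thesis by (rule infsumI[symmetric])
  qed
  also have "\<dots> = (\<Sum>\<^sub>\<infinity>s::int. if e + s * int R = 0 then 1 / real M else 0)"
  proof (rule infsum_cong)
    fix s :: int
    have "n - d - i * int a - s * int K = n - i * int a - (e + s * int R) * int M" for i
      by (simp add: e R algebra_simps)
    then show "(\<Sum>i\<in>F. \<gamma> (of_int (n - i * int a)) * g (of_int (n - d - i * int a - s * int K))) =
        (if e + s * int R = 0 then 1 / real M else 0)"
      using bi[of n "e + s * int R"] by (simp only: F_def)
  qed
  also have "\<dots> = (if int K dvd d then 1 / real M else 0)"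
  proof (cases "int K dvd d")
    case True
    then obtain s where s: "d = int K * s" by blast
    then have "e = int R * s" using e R pos by simp
    moreover have "R > 0" using R pos by (cases R) auto
    ultimately have eq: "e + t * int R = 0 \<longleftrightarrow> t = - s" for t
      by (metis add.commute add_eq_0_iff mult.commute mult_left_cancel mult_minus_right of_nat_0_less_iff less_irrefl)
    have "(\<Sum>\<^sub>\<infinity>t::int. if e + t * int R = 0 then 1 / real M else 0) = (\<Sum>\<^sub>\<infinity>t\<in>{- s}. if e + t * int R = 0 then 1 / real M else 0)"
      by (rule infsum_cong_neutral) (auto simp: eq)
    then show ?thesis using True by (simp add: eq)
  next
    case False
    have "e + t * int R \<noteq> 0" for t
    proof
      assume "e + t * int R = 0"
      then have "e = - (t * int R)" by linarith
      then have "d = int K * (- t)" using e R by simp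
      then show False using False by (metis dvd_triv_left)
    qed
    then show ?thesis using False by simp
  qed
  finally have main: "(\<Sum>k<N. G (n - d - int k * int a) * (\<Sum>\<^sub>\<infinity>t::int. \<gamma> (of_int (n - int k * int a - t * int K)))) =
     (if int K dvd d then 1 / real M else 0)" .
  have "(\<Sum>k<K div a. cnj (PKS K g (n - d - int k * int a)) * PKS K \<gamma> (n - int k * int a)) =
    complex_of_real (\<Sum>k<N. G (n - d - int k * int a) * (\<Sum>\<^sub>\<infinity>t::int. \<gamma> (of_int (n - int k * int a - t * int K))))"
    unfolding PKS_def G_def N_def by simp
  then show ?thesis unfolding main by simp
qed

section \<open>The algorithm\<close>

lemma summable_on_int_powers:
  fixes r :: real
  assumes "0 \<le> r" "r < 1"
  shows "(\<lambda>k::int. r ^ nat \<bar>k\<bar>) summable_on UNIV"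
proof -
  have s: "(\<lambda>n. r ^ n) summable_on UNIV"
    using assms by (intro norm_summable_imp_summable_on) simp
  have b1: "bij_betw int UNIV {0..}"
    by (rule bij_betwI[where g = nat]) auto
  have b2: "bij_betw (\<lambda>n. - int n - 1) UNIV {..<0}"
    by (rule bij_betwI[where g = "\<lambda>k. nat (- k - 1)"]) auto
  have "(\<lambda>k::int. r ^ nat \<bar>k\<bar>) summable_on {0..}"
    using s by (subst summable_on_reindex_bij_betw[OF b1, symmetric]) simp
  moreover have "(\<lambda>k::int. r ^ nat \<bar>k\<bar>) summable_on {..<0}"
  proof (subst summable_on_reindex_bij_betw[OF b2, symmetric])
    have "nat \<bar>- int n - 1\<bar> = Suc n" for n by simp
    then show "(\<lambda>n. r ^ nat \<bar>- int n - 1\<bar>) summable_on UNIV"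
      using summable_on_cmult_right[OF s, of r] by simp
  qed
  ultimately have "(\<lambda>k::int. r ^ nat \<bar>k\<bar>) summable_on ({0..} \<union> {..<0})"
    by (rule summable_on_Un_disjoint) auto
  moreover have "{0..} \<union> {..<0} = (UNIV :: int set)" by auto
  ultimately show ?thesis by simp
qed

text \<open>The point n - k K has distance at least |k| - |n| from 0, so the decay is bounded by a
  geometric series in |k|.\<close>

lemma decays_summable_on:
  assumes "decays c u" "c > 0" "K > 0"
  shows "(\<lambda>k::int. u (of_int (n - k * int K))) summable_on UNIV"
proof -
  obtain C where C: "C \<ge> 0" "\<And>x. \<bar>u x\<bar> \<le> C * exp (- c * \<bar>x\<bar>)"
    using assms by (auto simp: decays_def)
  define r where "r = exp (- c)"
  have r: "0 \<le> r" "r < 1" using assms by (auto simp: r_def)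
  have bound: "\<bar>u (of_int (n - k * int K))\<bar> \<le> C * exp (c * of_int \<bar>n\<bar>) * r ^ nat \<bar>k\<bar>" for k
  proof -
    have "\<bar>k\<bar> \<le> \<bar>k * int K\<bar>" using assms(3) by (simp add: abs_mult mult_le_cancel_left1)
    then have "\<bar>k\<bar> - \<bar>n\<bar> \<le> \<bar>n - k * int K\<bar>" by linarith
    then have "(of_int (\<bar>k\<bar> - \<bar>n\<bar>) :: real) \<le> of_int \<bar>n - k * int K\<bar>" by (simp only: of_int_le_iff)
    then have "c * (of_int \<bar>k\<bar> - of_int \<bar>n\<bar>) \<le> c * \<bar>of_int (n - k * int K)\<bar>"
      using assms(2) by (intro mult_left_mono) auto
    then have "exp (- c * \<bar>of_int (n - k * int K)\<bar>) \<le> exp (c * of_int \<bar>n\<bar> + - c * of_int \<bar>k\<bar>)"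
      by (simp add: algebra_simps)
    also have "\<dots> = exp (c * of_int \<bar>n\<bar>) * r ^ nat \<bar>k\<bar>"
      unfolding r_def exp_add exp_of_nat_mult[symmetric] by (simp add: mult.commute)
    finally show ?thesis
      using C(2)[of "of_int (n - k * int K)"] mult_left_mono[OF _ C(1)] by (smt (verit) mult.assoc)
  qed
  have "(\<lambda>k::int. norm (C * exp (c * of_int \<bar>n\<bar>) * r ^ nat \<bar>k\<bar>)) summable_on UNIV"
    using summable_on_cmult_right[OF summable_on_int_powers[OF r], of "C * exp (c * of_int \<bar>n\<bar>)"] C(1) r(1)
    by simp
  then have "(\<lambda>k::int. norm (u (of_int (n - k * int K)))) summable_on UNIV"
    by (rule Infinite_Sum.abs_summable_on_comparison_test) (use bound C(1) r(1) in simp)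
  then show ?thesis by (rule Infinite_Sum.abs_summable_summable)
qed

lemma sum_int_interval:
  fixes i1 i2 :: int
  shows "(\<Sum>i\<in>{i1..i2}. h i) = (\<Sum>j\<in>{0..<nat (i2 - i1 + 1)}. h (int j + i1))"
  by (rule sum.reindex_bij_betw[symmetric], rule bij_betwI[where g = "\<lambda>i. nat (i - i1)"]) auto

text \<open>The floor plus one and the ceiling minus one select the least and greatest index
  strictly inside the bounds. Strictness serves the recurrences; the reverse estimates, weaker by
  one step \<alpha>\<beta>, serve the uniqueness lemma.\<close>

lemma alg_index_bounds:
  fixes \<alpha> \<beta> x :: real and k1 k2 :: int
  assumes "\<alpha> > 0" "\<beta> > 0"
  shows "of_int (alg_k1 p \<alpha> \<beta> L) + real p - 1 < \<beta> * (x + \<alpha> * of_int (alg_i1 p \<alpha> \<beta> L x))"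
    and "\<beta> * (x + \<alpha> * of_int (alg_i1 p \<alpha> \<beta> L x)) \<le> of_int (alg_k1 p \<alpha> \<beta> L) + real p - 1 + \<alpha> * \<beta>"
    and "\<beta> * (x + \<alpha> * of_int (alg_i2 q \<alpha> \<beta> L x)) < of_int (alg_k2 q \<alpha> \<beta> L) - real q + 1"
    and "of_int (alg_k2 q \<alpha> \<beta> L) - real q + 1 - \<alpha> * \<beta> \<le> \<beta> * (x + \<alpha> * of_int (alg_i2 q \<alpha> \<beta> L x))"
proof -
  have eq: "\<beta> * (x + \<alpha> * (s / (\<alpha> * \<beta>) - x / \<alpha>)) = s" for s
    using assms by (simp add: field_simps)
  have mono: "\<beta> * (x + \<alpha> * s) < \<beta> * (x + \<alpha> * t) \<longleftrightarrow> s < t" "\<beta> * (x + \<alpha> * s) \<le> \<beta> * (x + \<alpha> * t) \<longleftrightarrow> s \<le> t" for s t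
    using assms by auto
  define s where "s = of_int (alg_k1 p \<alpha> \<beta> L) + real p - 1"
  define t where "t = of_int (alg_k2 q \<alpha> \<beta> L) - real q + 1"
  have i1: "s / (\<alpha> * \<beta>) - x / \<alpha> < of_int (alg_i1 p \<alpha> \<beta> L x)" "of_int (alg_i1 p \<alpha> \<beta> L x) \<le> s / (\<alpha> * \<beta>) - x / \<alpha> + 1"
    unfolding alg_i1_def s_def by linarith+
  have i2: "of_int (alg_i2 q \<alpha> \<beta> L x) < t / (\<alpha> * \<beta>) - x / \<alpha>" "t / (\<alpha> * \<beta>) - x / \<alpha> - 1 \<le> of_int (alg_i2 q \<alpha> \<beta> L x)"
    unfolding alg_i2_def t_def by linarith+
  show "s < \<beta> * (x + \<alpha> * of_int (alg_i1 p \<alpha> \<beta> L x))"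
    using i1(1) mono(1) eq[of s] by metis
  show "\<beta> * (x + \<alpha> * of_int (alg_i2 q \<alpha> \<beta> L x)) < t"
    using i2(1) mono(1) eq[of t] by metis
  have "\<beta> * (x + \<alpha> * of_int (alg_i1 p \<alpha> \<beta> L x)) \<le> \<beta> * (x + \<alpha> * (s / (\<alpha> * \<beta>) - x / \<alpha> + 1))"
    using i1(2) mono(2) by blast
  also have "\<dots> = s + \<alpha> * \<beta>" using eq[of s] by (simp add: algebra_simps)
  finally show "\<beta> * (x + \<alpha> * of_int (alg_i1 p \<alpha> \<beta> L x)) \<le> s + \<alpha> * \<beta>" .
  have "\<beta> * (x + \<alpha> * (t / (\<alpha> * \<beta>) - x / \<alpha> - 1)) \<le> \<beta> * (x + \<alpha> * of_int (alg_i2 q \<alpha> \<beta> L x))"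
    using i2(2) mono(2) by blast
  moreover have "\<beta> * (x + \<alpha> * (t / (\<alpha> * \<beta>) - x / \<alpha> - 1)) = t - \<alpha> * \<beta>" using eq[of t] by (simp add: algebra_simps)
  ultimately show "t - \<alpha> * \<beta> \<le> \<beta> * (x + \<alpha> * of_int (alg_i2 q \<alpha> \<beta> L x))" by simp
qed

text \<open>As a floor, r exceeds 1 / (1 - \<alpha>\<beta>) - 1 = \<alpha>\<beta> / (1 -
  \<alpha>\<beta>). This inequality is what the choice of r aims at.\<close>

lemma alg_r_bounds:
  assumes "0 < \<alpha>" "0 < \<beta>" "\<alpha> * \<beta> < 1"
  shows "1 \<le> alg_r \<alpha> \<beta>" "\<alpha> * \<beta> < of_int (alg_r \<alpha> \<beta>) * (1 - \<alpha> * \<beta>)"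
proof -
  have "0 < \<alpha> * \<beta>" using assms by simp
  then have "1 \<le> 1 / (1 - \<alpha> * \<beta>)" using assms by simp
  then show "1 \<le> alg_r \<alpha> \<beta>" by (simp add: alg_r_def le_floor_iff)
  have "1 / (1 - \<alpha> * \<beta>) - 1 < of_int (alg_r \<alpha> \<beta>)" unfolding alg_r_def by linarith
  then have "(1 / (1 - \<alpha> * \<beta>) - 1) * (1 - \<alpha> * \<beta>) < of_int (alg_r \<alpha> \<beta>) * (1 - \<alpha> * \<beta>)"
    using assms by (intro mult_strict_right_mono) auto
  moreover have "(1 / (1 - \<alpha> * \<beta>) - 1) * (1 - \<alpha> * \<beta>) = \<alpha> * \<beta>" using assms by (simp add: field_simps)
  ultimately show "\<alpha> * \<beta> < of_int (alg_r \<alpha> \<beta>) * (1 - \<alpha> * \<beta>)" by simp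
qed

text \<open>D is the length, in knot spacings, of the interval open to the samples, whereas k2 - k1
  = D + m - 2 with m = p + q. The samples satisfy D \<le> \<alpha>\<beta> (\<Delta> + 2), so
  \<alpha>\<beta> m \<le> D (1 - \<alpha>\<beta>) is enough; it holds because D \<ge> r m.\<close>

lemma alg_rows_ge_cols:
  assumes "0 < \<alpha>" "0 < \<beta>" "\<alpha> * \<beta> < 1"
  shows "alg_k2 q \<alpha> \<beta> L - alg_k1 p \<alpha> \<beta> L \<le> alg_i2 q \<alpha> \<beta> L x - alg_i1 p \<alpha> \<beta> L x"
proof -
  define r where "r = alg_r \<alpha> \<beta>"
  define m where "m = real p + real q"
  define D where "D = of_int r * m + 2 * real L + 2"
  define \<Delta> where "\<Delta> = real_of_int (alg_i2 q \<alpha> \<beta> L x - alg_i1 p \<alpha> \<beta> L x)"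
  note ab = alg_index_bounds(1,2)[OF assms(1,2), where L = L and x = x and p = p] alg_index_bounds(3,4)[OF assms(1,2), where L = L and x = x and q = q]
  have s: "0 < \<alpha> * \<beta>" using assms by simp
  have m: "0 \<le> m" by (simp add: m_def)
  have k: "real_of_int (alg_k2 q \<alpha> \<beta> L) - of_int (alg_k1 p \<alpha> \<beta> L) = D + m - 2"
    by (simp add: alg_k1_def alg_k2_def D_def m_def r_def algebra_simps)
  have "\<beta> * (x + \<alpha> * of_int (alg_i2 q \<alpha> \<beta> L x)) - \<beta> * (x + \<alpha> * of_int (alg_i1 p \<alpha> \<beta> L x)) \<ge>
      (D + m - 2) - m + 2 - 2 * (\<alpha> * \<beta>)"
    using ab k by (simp add: m_def)
  then have "D \<le> (\<alpha> * \<beta>) * (\<Delta> + 2)"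
    by (simp add: \<Delta>_def algebra_simps)
  moreover have "(\<alpha> * \<beta>) * m \<le> D * (1 - \<alpha> * \<beta>)"
  proof -
    have "(\<alpha> * \<beta>) * m \<le> of_int r * (1 - \<alpha> * \<beta>) * m"
      using alg_r_bounds(2)[OF assms] m by (intro mult_right_mono) (auto simp: r_def)
    also have "\<dots> \<le> of_int r * (1 - \<alpha> * \<beta>) * m + (2 * real L + 2) * (1 - \<alpha> * \<beta>)"
      using assms by simp
    also have "\<dots> = D * (1 - \<alpha> * \<beta>)"
      by (simp add: D_def algebra_simps)
    finally show ?thesis .
  qed
  ultimately have "(\<alpha> * \<beta>) * (D + m) \<le> (\<alpha> * \<beta>) * (\<Delta> + 2)"
    by (simp add: algebra_simps)
  then have "D + m \<le> \<Delta> + 2" using s by (rule mult_left_le_imp_le)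
  then have "real_of_int (alg_k2 q \<alpha> \<beta> L - alg_k1 p \<alpha> \<beta> L) \<le> real_of_int (alg_i2 q \<alpha> \<beta> L x - alg_i1 p \<alpha> \<beta> L x)"
    using k by (simp add: \<Delta>_def)
  then show ?thesis by (simp only: of_int_le_iff)
qed

lemma alg_biorthogonal:
  fixes \<delta> :: "nat \<Rightarrow> real" and n L :: nat and x \<alpha> \<beta> C :: real and k :: int
  assumes nz: "\<And>k. k \<le> n \<Longrightarrow> \<delta> k \<noteq> 0" and ab: "0 < \<alpha>" "0 < \<beta>" "\<alpha> * \<beta> < 1"
    and g: "\<And>x. g x = C * tpf \<delta> n x" and C: "C > 0"
  defines "p \<equiv> tp_pos (Suc n) \<delta>" and "q \<equiv> tp_neg (Suc n) \<delta>"
  defines "i1 \<equiv> alg_i1 p \<alpha> \<beta> L x" and "i2 \<equiv> alg_i2 q \<alpha> \<beta> L x"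
    and "k1 \<equiv> alg_k1 p \<alpha> \<beta> L" and "k2 \<equiv> alg_k2 q \<alpha> \<beta> L"
  shows "(\<Sum>i\<in>{i1..i2}. pinv (alg_P g p q \<alpha> \<beta> L x) $$ (nat (0 - k1), nat (i - i1)) *
      g (x + \<alpha> * of_int i - of_int k / \<beta>)) = of_bool (k = 0)"
proof -
  \<comment> \<open>The knot spacing; \<alpha>\<beta> < 1 says that samples are denser than
    knots.\<close>
  define M where "M = 1 / \<beta>"
  have M: "M > 0" "\<beta> * M = 1" "\<alpha> < M" using ab by (auto simp: M_def field_simps)
  define P where "P = alg_P g p q \<alpha> \<beta> L x"
  define nr where "nr = nat (i2 - i1 + 1)"
  define nc where "nc = nat (k2 - k1 + 1)"
  have P: "P = mat nr nc (\<lambda>(i, k). g (x + \<alpha> * of_int (int i + i1) - of_int (int k + k1) / \<beta>))"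
    unfolding P_def alg_P_def Let_def nr_def nc_def i1_def i2_def k1_def k2_def by (rule refl)
  have Pc: "P \<in> carrier_mat nr nc" unfolding P by simp
  have r: "1 \<le> alg_r \<alpha> \<beta>" by (rule alg_r_bounds[OF ab])
  have k12: "k1 + int p \<le> 0" "0 \<le> k2 - int q"
  proof -
    have "0 \<le> alg_r \<alpha> \<beta> * int p" "0 \<le> alg_r \<alpha> \<beta> * int q" using r by auto
    then show "k1 + int p \<le> 0" "0 \<le> k2 - int q"
      unfolding k1_def k2_def alg_k1_def alg_k2_def by (simp_all add: algebra_simps)
  qed
  have scale: "M * (\<beta> * y) = y" for y using M(2) by (simp add: mult.commute[of \<beta>] flip: mult.assoc)
  have M\<alpha>: "M * (\<alpha> * \<beta>) = \<alpha>" using scale[of \<alpha>] by (simp only: mult.commute)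
  note b = alg_index_bounds(1,2)[OF ab(1,2), where L = L and x = x and p = p, folded i1_def k1_def]
    alg_index_bounds(3,4)[OF ab(1,2), where L = L and x = x and q = q, folded i2_def k2_def]
  have lo: "M * (of_int k1 + real p - 1) < x + \<alpha> * of_int i1"
    using mult_strict_left_mono[OF b(1) M(1)] unfolding scale .
  have lo': "x + \<alpha> * of_int i1 \<le> M * (of_int k1 + real p - 1) + \<alpha>"
    using mult_left_mono[OF b(2) less_imp_le[OF M(1)]] M\<alpha> unfolding scale by (simp add: algebra_simps)
  have hi: "x + \<alpha> * of_int i2 < M * (of_int k2 - real q + 1)"
    using mult_strict_left_mono[OF b(3) M(1)] unfolding scale .
  have hi': "x + \<alpha> * of_int i2 \<ge> M * (of_int k2 - real q + 1) - \<alpha>"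
    using mult_left_mono[OF b(4) less_imp_le[OF M(1)]] M\<alpha> unfolding scale by (simp add: algebra_simps)
  have num: "k2 - k1 \<le> i2 - i1"
    unfolding i1_def i2_def k1_def k2_def by (rule alg_rows_ge_cols[OF ab])
  have inj: "v = 0\<^sub>v nc" if v: "v \<in> carrier_vec nc" "P *\<^sub>v v = 0\<^sub>v nr" for v
  proof -
    define c where "c k = vec_index v (nat (k - k1))" for k
    have "c k = 0" if k: "k \<in> {k1..k2}" for k
    proof (rule tpf_samples_inj[where n = n and \<delta> = \<delta> and a = \<alpha> and M = M and x = x, OF nz ab(1) M(3) _
          lo'[unfolded p_def] hi'[unfolded q_def] num k])
      fix i assume i: "i \<in> {i1..i2}"
      then have "nat (i - i1) < nr" by (auto simp: nr_def)
      moreover from this have "vec_index (P *\<^sub>v v) (nat (i - i1)) = 0" using v by simp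
      ultimately have "(\<Sum>j\<in>{0..<nc}. g (x + \<alpha> * of_int i - of_int (int j + k1) / \<beta>) * vec_index v j) = 0"
        using v(1) Pc i by (simp add: scalar_prod_def) (simp add: P)
      then have "(\<Sum>k\<in>{k1..k2}. g (x + \<alpha> * of_int i - of_int k / \<beta>) * c k) = 0"
        unfolding sum_int_interval nc_def[symmetric] by (simp add: c_def)
      then have "C * (\<Sum>k\<in>{k1..k2}. c k * tpf \<delta> n (x + \<alpha> * of_int i - M * of_int k)) = 0"
        unfolding sum_distrib_left by (simp add: g M_def mult_ac)
      then show "(\<Sum>k\<in>{k1..k2}. c k * tpf \<delta> n (x + \<alpha> * of_int i - M * of_int k)) = 0"
        using C by simp
    qed
    then have "vec_index v j = 0" if "j < nc" for j
      using that[unfolded nc_def] by (auto simp: c_def dest: meta_spec[of _ "int j + k1"])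
    then show ?thesis using v(1) by (intro eq_vecI) auto
  qed
  define X where "X = pinv P"
  have X: "X \<in> carrier_mat nc nr" "X * P = 1\<^sub>m nc"
    unfolding X_def using pinv_left_inverse[OF Pc inj] by auto
  define w where "w i = X $$ (nat (0 - k1), nat (i - i1))" for i
  have bi: "(\<Sum>i\<in>{i1..i2}. w i * tpf \<delta> n (x + \<alpha> * of_int i - M * of_int k)) = (1 / C) * of_bool (k = 0)"
    if k: "k \<in> {k1..k2}" for k
  proof -
    have lt: "nat (0 - k1) < nc" "nat (k - k1) < nc" using k k12 by (auto simp: nc_def)
    have eq: "real (nat (k - k1)) + real_of_int k1 = of_int k" using k by simp
    \<comment> \<open>The row nat (0 - k1) is the one of k = 0, so the identity matrix has the entry
      1 there exactly in the column of k = 0.\<close>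
    have "of_bool (k = 0) = (1\<^sub>m nc :: real mat) $$ (nat (0 - k1), nat (k - k1))"
      using lt k k12 by auto
    also have "\<dots> = (\<Sum>j\<in>{0..<nr}. X $$ (nat (0 - k1), j) * P $$ (j, nat (k - k1)))"
      unfolding X(2)[symmetric] using X(1) Pc lt by (simp add: scalar_prod_def)
    also have "\<dots> = (\<Sum>j\<in>{0..<nr}. X $$ (nat (0 - k1), j) * g (x + \<alpha> * of_int (int j + i1) - of_int k / \<beta>))"
      using lt(2) eq by (intro sum.cong refl) (simp add: P)
    also have "\<dots> = (\<Sum>i\<in>{i1..i2}. w i * g (x + \<alpha> * of_int i - of_int k / \<beta>))"
      unfolding sum_int_interval nr_def[symmetric] by (simp add: w_def)
    also have "\<dots> = C * (\<Sum>i\<in>{i1..i2}. w i * tpf \<delta> n (x + \<alpha> * of_int i - M * of_int k))"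
      unfolding sum_distrib_left by (simp add: g M_def mult_ac)
    finally show ?thesis using C by (simp add: field_simps)
  qed
  have "(\<Sum>i\<in>{i1..i2}. w i * tpf \<delta> n (x + \<alpha> * of_int i - M * of_int k)) = (1 / C) * of_bool (k = 0)"
    using tpf_biorthogonal[OF nz less_imp_le[OF M(1)] ab(1) bi lo[unfolded p_def] hi[unfolded q_def]
        k12(1)[unfolded p_def] k12(2)[unfolded q_def]] .
  then have "C * (\<Sum>i\<in>{i1..i2}. w i * tpf \<delta> n (x + \<alpha> * of_int i - M * of_int k)) = of_bool (k = 0)"
    using C by simp
  then show ?thesis
    unfolding sum_distrib_left by (simp add: g M_def w_def X_def P_def mult_ac)
qed

theorem theorem7:
  fixes g :: "real \<Rightarrow> real" and m :: nat and \<delta> :: "nat \<Rightarrow> real"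
    and a K M L :: nat
  assumes tp: "tp_finite_type g m \<delta>"
    and cont: "continuous_on UNIV g"
    and m2: "m \<ge> 2"
    and pos: "a > 0" "K > 0" "M > 0"
    and dvd: "a dvd K" "M dvd K"
    and lt: "real a / real M < 1"
  shows "dframe K (dgabor_index K a M) (dgabor K a M (PKS K g))
       \<and> ddual_window K a M (PKS K g)
           (PKS K (alg_gamma g (tp_pos m \<delta>) (tp_neg m \<delta>) (real a) (1 / real M) L))"
proof -
  define n where "n = m - 1"
  have m: "m = Suc n" using m2 by (simp add: n_def)
  obtain C where C: "C > 0" "\<And>x. g x = C * tpf \<delta> n x"
    using tp_finite_type_eq[OF tp cont m2] by (auto simp: n_def)
  have nz: "\<And>k. k \<le> n \<Longrightarrow> \<delta> k \<noteq> 0" using tp by (simp add: tp_finite_type_def m)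
  obtain c where c: "c > 0" "\<And>k. k < m \<Longrightarrow> c * \<bar>\<delta> k\<bar> < 1" using ex_decay_rate by blast
  have "decays c (\<lambda>x. C * tpf \<delta> n (x + 0))"
    using c nz by (intro decays_shift tpf_decays) (auto simp: m)
  moreover have "g = (\<lambda>x. C * tpf \<delta> n x)" using C(2) by auto
  ultimately have dec: "decays c g" by simp
  define p where "p = tp_pos m \<delta>"
  define q where "q = tp_neg m \<delta>"
  define \<gamma> where "\<gamma> = alg_gamma g p q (real a) (1 / real M) L"
  have ab: "0 < real a" "0 < 1 / real M" "real a * (1 / real M) < 1" using pos lt by auto
  define k1 where "k1 = alg_k1 p (real a) (1 / real M) L"
  define i1 where "i1 N = alg_i1 p (real a) (1 / real M) L (of_int (N mod int a))" for N :: int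
  define i2 where "i2 N = alg_i2 q (real a) (1 / real M) L (of_int (N mod int a))" for N :: int
  define w where "w N i = pinv (alg_P g p q (real a) (1 / real M) L (of_int (N mod int a))) $$ (nat (0 - k1), nat (i - i1 N))" for N i
  \<comment> \<open>At N - i a the algorithm uses the base point N mod a and the index N div a - i,
    so a single matrix serves the whole coset of multiples of a.\<close>
  have gam: "\<gamma> (of_int (N - i * int a)) =
      (if i1 N \<le> N div int a - i \<and> N div int a - i \<le> i2 N then 1 / real M * w N (N div int a - i) else 0)" for N i
  proof -
    have fl: "\<lfloor>real_of_int (N - i * int a) / real a\<rfloor> = N div int a - i"
    proof -
      have "\<lfloor>real_of_int (N - i * int a) / real a\<rfloor> = (N - i * int a) div int a"
        using floor_divide_of_int_eq[of "N - i * int a" "int a", where ?'a = real] by simp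
      also have "N - i * int a = N + (- i) * int a" by simp
      finally show ?thesis using pos(1) by (simp only: div_mult_self1) simp
    qed
    have x: "real_of_int (N - i * int a) - real a * of_int (N div int a - i) = of_int (N mod int a)"
    proof -
      have "N - i * int a - int a * (N div int a - i) = N mod int a"
        by (simp add: algebra_simps minus_mult_div_eq_mod)
      then show ?thesis by (metis of_int_diff of_int_mult of_int_of_nat_eq)
    qed
    show ?thesis
      unfolding \<gamma>_def alg_gamma_def Let_def fl x w_def i1_def i2_def k1_def by (rule refl)
  qed
  have sup: "{i. \<gamma> (of_int (N - i * int a)) \<noteq> 0} \<subseteq> {N div int a - i2 N..N div int a - i1 N}" for N
    unfolding gam by auto
  have fin: "finite {i. \<gamma> (of_int (N - i * int a)) \<noteq> 0}" for N
    using sup by (rule finite_subset) simp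
  have bi: "(\<Sum>i | \<gamma> (of_int (N - i * int a)) \<noteq> 0. \<gamma> (of_int (N - i * int a)) * g (of_int (N - i * int a - k * int M))) =
      (if k = 0 then 1 / real M else 0)" for N k
  proof -
    have arg: "real_of_int (N - i * int a - k * int M) = of_int (N mod int a) + real a * of_int (N div int a - i) - of_int k / (1 / real M)" for i
    proof -
      have "N - i * int a - k * int M = N mod int a + int a * (N div int a - i) - k * int M"
        by (simp add: algebra_simps)
      then show ?thesis by (metis (no_types) of_int_add of_int_diff of_int_mult of_int_of_nat_eq div_by_1 divide_divide_eq_right)
    qed
    have "(\<Sum>i | \<gamma> (of_int (N - i * int a)) \<noteq> 0. \<gamma> (of_int (N - i * int a)) * g (of_int (N - i * int a - k * int M))) =
        (\<Sum>i\<in>{N div int a - i2 N..N div int a - i1 N}. \<gamma> (of_int (N - i * int a)) * g (of_int (N - i * int a - k * int M)))"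
      using sup by (intro sum.mono_neutral_left) auto
    also have "\<dots> = (\<Sum>j\<in>{i1 N..i2 N}. 1 / real M * (w N j * g (of_int (N mod int a) + real a * of_int j - of_int k / (1 / real M))))"
      unfolding arg gam
      by (rule sum.reindex_bij_witness[of _ "\<lambda>j. N div int a - j" "\<lambda>i. N div int a - i"]) auto
    also have "\<dots> = 1 / real M * of_bool (k = 0)"
      unfolding sum_distrib_left[symmetric] w_def i1_def i2_def k1_def p_def q_def m
      by (subst alg_biorthogonal[OF nz ab C(2,1)]) auto
    finally show ?thesis by simp
  qed
  have summ: "\<And>N. (\<lambda>k::int. g (of_int (N - k * int K))) summable_on UNIV"
    using decays_summable_on[OF dec c(1) pos(2)] .
  have expand: "f N = (\<Sum>kl\<in>dgabor_index K a M. cinner K f (dgabor K a M (PKS K g) kl) * dgabor K a M (PKS K \<gamma>) kl N)"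
    if "N \<in> {0..<int K}" for f N
    using PKS_dual_sum[OF pos dvd _ summ fin bi] pos that
    by (intro dgabor_dual PKS_periodic) auto
  have "finite (dgabor_index K a M)" by (simp add: dgabor_index_def)
  from dframe_dual[OF this expand] show ?thesis
    using expand by (auto simp: ddual_window_def \<gamma>_def p_def q_def)
qed

end
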